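(* Let $\mathbb{X}=\mathbb{R}$ and $\mathbb{A}=[0,+\infty)$. Assume that there exists $\alpha^*\in[0,1)$ such that for all $\alpha\in(\alpha^*,1]$: (i) the function $x\mapsto\mathbb{E}[h_\alpha(x-D)]$ is quasiconvex on $\mathbb{R}$; and (ii) $\lim_{x\to-\infty}\mathbb{E}[h_\alpha(x-D)]>K+\inf_{x\in\mathbb{R}}\mathbb{E}[h_\alpha(x-D)]$. Assume also that $x\mapsto\mathbb{E}[h_1(x-D)]$ is strictly decreasing on $(-\infty,x^{\min}_1]$. Let $u(x):=\lim_{\alpha\uparrow1}u_\alpha(x)$, $s^*:=\lim_{\alpha\uparrow1}s_\alpha$ (both limits exist), and $H(x):=\bar c x+\mathbb{E}[h(x-D)]+\mathbb{E}[u(x-D)]$. Then there is a stationary policy $\varphi$ such that for all $x\in\mathbb{R}$ $$w+u(x)=K\mathbf{1}_{\{\varphi(x)>0\}}+H(x+\varphi(x))-\bar c x=\min\Big\{\min_{a\ge0}[K+H(x+a)],\,H(x)\Big\}-\bar c x;\qquad(\ast)$$ the functions $u$ and $H$ are continuous and inf-compact; a stationary average-cost optimal policy $\varphi$ satisfying $(\ast)$ can be selected as an $(s^*,S^* )$ policy, where $(s^*,S^* )$ is a limit point of $\{(s'_{\alpha_n},S'_{\alpha_n})\}_{n\ge1}$ for a sequence $\alpha_n\uparrow1$ with $\alpha_1>\alpha^*$ and discount-optimal $(s'_{\alpha_n},S'_{\alpha_n})$ policies; and it can also be selected as an $(s,S)$ policy with $S\in\operatorname{arg\,min}_xH(x)$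 and $s=\inf\{x\le S:H(x)\le K+H(S)\}$. That is, for every sequence $\{\alpha_n\uparrow1\}_{n\ge1}$ of nonnegative discount factors with $\alpha_1>\alpha^*$, the function $\tilde u(x):=\liminf_{n\to+\infty,\,y\to x}u_{\alpha_n}(y)$ equals $u$, and the first coordinate of every limit point of $\{(s'_{\alpha_n},S'_{\alpha_n})\}_{n\ge1}$ equals $s^*$; these are the same for all such sequences.
   Context: Inventory model with states $x\in\mathbb{R}$ and actions $a\in[0,+\infty)$. Constants $K>0$ (fixed ordering cost), $\bar c>0$ (unit ordering cost). $D_1,D_2,\ldots$ are i.i.d. nonnegative finite random variables, $D$ has the same distribution as $D_1$, $\mathbb{E}[D]<+\infty$, $P(D>0)>0$. The holding/backlog cost function $h:\mathbb{R}\to\mathbb{R}$ is such that $x\mapsto\mathbb{E}[h(x-D)]$ is finite, continuous and nonnegative and $\mathbb{E}[h(x-D)]\to+\infty$ as $|x|\to+\infty$. Dynamics: $x_{t+1}=x_t+a_t-D_{t+1}$. One-step cost: $c(x,a)=K\mathbf{1}_{\{a>0\}}+\bar c a+\mathbb{E}[h(x+a-D)]$. Policies may be randomized and history-dependent; a stationary policy is a map $\varphi:\mathbb{R}\to[0,+\infty)$. $v^\pi_\alpha(x)=\mathbb{E}_x^\pi[\sum_{t=0}^\infty\alpha^t c(x_t,a_t)]$, $v_\alpha(x)=\inf_\pi v^\pi_\alpha(x)$ for $\alpha\in[0,1)$; $\pi$ is (discount-)optimal for $\alpha$ if $v^\pi_\alpha=v_\alpha$. $m_\alpha:=\inf_{x}v_\alpha(x)$,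 $u_\alpha(x):=v_\alpha(x)-m_\alpha$, $w:=\lim_{\alpha\uparrow1}(1-\alpha)m_\alpha$ (the limit exists under the hypotheses). A policy $\pi$ is average-cost optimal if it minimizes $w^\pi(x)=\limsup_{N\to+\infty}\frac1N\mathbb{E}_x^\pi[\sum_{t=0}^{N-1}c(x_t,a_t)]$ over all policies, for every $x$. For $\alpha\in(0,1]$: $h_\alpha(x):=h(x)+(1-\alpha)\bar c x+\bar c\,\mathbb{E}[D]$ and $x^{\min}_\alpha:=\min\{\operatorname{arg\,min}_{x\in\mathbb{R}}\mathbb{E}[h_\alpha(x-D)]\}$. $G_\alpha(x):=\bar c x+\mathbb{E}[h(x-D)]+\alpha\mathbb{E}[v_\alpha(x-D)]$; for $\alpha\in(\alpha^*,1)$, $S_\alpha\in\operatorname{arg\,min}_{x}G_\alpha(x)$ and $s_\alpha:=\inf\{x\le S_\alpha:G_\alpha(x)\le K+G_\alpha(S_\alpha)\}$. For each $\alpha\in(\alpha^*,1)$, $(s'_\alpha,S'_\alpha)$ denotes the thresholds of some optimal $(s'_\alpha,S'_\alpha)$ policy for discount factor $\alpha$ (such policies exist). For reals $s\le S$, an $(s,S)$ policy orders up to level $S$ (action $S-x$) if $x<s$ and does not order if $x\ge s$. A function is inf-compact if all its sublevel sets are compact. $\liminf_{n\to\infty,y\to x}u_{\alpha_n}(y)$ is the largest number $\le\liminf_nu_{\alpha_n}(y_n)$ for all $y_n\to x$. A function $f$ on $\mathbb{R}$ is quasiconvex if $f(\lambda x+(1-\lambda)y)\le\max\{f(x),f(y)\}$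 for all $x,y$ and $\lambda\in[0,1]$. *)

theory Defs
  imports "HOL-Probability.Probability"
begin

definition quasiconvex :: "(real \<Rightarrow> real) \<Rightarrow> bool" where
  "quasiconvex f \<longleftrightarrow>
     (\<forall>x y. \<forall>l\<in>{0..1}. f (l * x + (1 - l) * y) \<le> max (f x) (f y))"

definition inf_compact :: "(real \<Rightarrow> real) \<Rightarrow> bool" where
  "inf_compact f \<longleftrightarrow> (\<forall>r. compact {x. f x \<le> r})"

abbreviation minimizes :: "('a \<Rightarrow> 'b::order) \<Rightarrow> 'a \<Rightarrow> bool" where
  "minimizes f x \<equiv> is_arg_min f (\<lambda>_. True) x"

text \<open>A limit point of a sequence is the limit of one of its subsequences (not an accumulation
  point of its range).\<close>

definition seq_limit_point :: "(nat \<Rightarrow> 'a::topological_space) \<Rightarrow> 'a \<Rightarrow> bool" where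
  "seq_limit_point X l \<longleftrightarrow> (\<exists>r. strict_mono r \<and> (X \<circ> r) \<longlonglongrightarrow> l)"

text \<open>\<open>demand I t\<close> is the demand $D_t$ for $t \ge 1$; the index 0 is not used.\<close>

record 'w inventory =
  prob_sp :: "'w measure"
  demand :: "nat \<Rightarrow> 'w \<Rightarrow> real"
  fixed_cost :: real
  unit_cost :: real
  holding :: "real \<Rightarrow> real"

text \<open>The generic demand $D$ is $D_1$, so that \<open>ED I g\<close> is $E[g(D)]$.\<close>

definition ED :: "'w inventory \<Rightarrow> (real \<Rightarrow> real) \<Rightarrow> real" where
  "ED I g = (\<integral>\<omega>. g (demand I 1 \<omega>) \<partial>prob_sp I)"

definition demand_law :: "'w inventory \<Rightarrow> real measure" where
  "demand_law I = distr (prob_sp I) borel (demand I 1)"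

definition exp_holding :: "'w inventory \<Rightarrow> real \<Rightarrow> real" where
  "exp_holding I x = ED I (\<lambda>d. holding I (x - d))"

definition inventory_model :: "'w inventory \<Rightarrow> bool" where
  "inventory_model I \<longleftrightarrow>
     prob_space (prob_sp I) \<and>
     prob_space.indep_vars (prob_sp I) (\<lambda>_. borel) (demand I) {1..} \<and>
     (\<forall>t\<ge>1. distr (prob_sp I) borel (demand I t) = demand_law I) \<and>
     (\<forall>t\<ge>1. AE \<omega> in prob_sp I. 0 \<le> demand I t \<omega>) \<and>
     integrable (prob_sp I) (demand I 1) \<and>
     measure (prob_sp I) {\<omega> \<in> space (prob_sp I). 0 < demand I 1 \<omega>} > 0 \<and>
     0 < fixed_cost I \<and> 0 < unit_cost I \<and>
     (\<forall>x. integrable (prob_sp I) (\<lambda>\<omega>. holding I (x - demand I 1 \<omega>))) \<and>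
     continuous_on UNIV (exp_holding I) \<and>
     (\<forall>x. 0 \<le> exp_holding I x) \<and>
     filterlim (exp_holding I) at_top at_infinity"

definition cost :: "'w inventory \<Rightarrow> real \<Rightarrow> real \<Rightarrow> real" where
  "cost I x a = fixed_cost I * of_bool (0 < a) + unit_cost I * a + exp_holding I (x + a)"

definition action_space :: "real measure" where
  "action_space = restrict_space borel {0..}"

definition state_action :: "(real \<times> real) measure" where
  "state_action = borel \<Otimes>\<^sub>M action_space"

text \<open>A policy selects the law of $a_t$ given the past $(x_0,a_0,\ldots,x_{t-1},a_{t-1})$,
  represented as a function on \<open>{0..<t}\<close>, and the current state $x_t$.\<close>

type_synonym policy = "nat \<Rightarrow> (nat \<Rightarrow> real \<times> real) \<times> real \<Rightarrow> real measure"

definition policies :: "policy set" where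
  "policies = {\<pi>. \<forall>t. \<pi> t \<in> (PiM {0..<t} (\<lambda>_. state_action) \<Otimes>\<^sub>M borel)
                          \<rightarrow>\<^sub>M prob_algebra action_space}"

definition stationary_maps :: "(real \<Rightarrow> real) set" where
  "stationary_maps = {\<phi> \<in> borel_measurable borel. \<forall>x. 0 \<le> \<phi> x}"

definition stationary :: "(real \<Rightarrow> real) \<Rightarrow> policy" where
  "stationary \<phi> = (\<lambda>t (\<omega>, x). return action_space (\<phi> x))"

definition sS_map :: "real \<Rightarrow> real \<Rightarrow> real \<Rightarrow> real" where
  "sS_map s S x = (if x < s then S - x else 0)"

text \<open>The law of $x_t$ given the past: $x_t = x_{t-1} + a_{t-1} - D_t$, where $D_t$ is
  independent of the past and distributed as $D$.\<close>

definition state_law ::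
    "'w inventory \<Rightarrow> real \<Rightarrow> nat \<Rightarrow> (nat \<Rightarrow> real \<times> real) \<Rightarrow> real measure" where
  "state_law I x0 t \<omega> =
     (if t = 0 then return borel x0
      else distr (demand_law I) borel (\<lambda>d. fst (\<omega> (t - 1)) + snd (\<omega> (t - 1)) - d))"

definition step ::
    "'w inventory \<Rightarrow> policy \<Rightarrow> real \<Rightarrow> nat \<Rightarrow> (nat \<Rightarrow> real \<times> real) \<Rightarrow> (real \<times> real) measure" where
  "step I \<pi> x0 t \<omega> =
     state_law I x0 t \<omega> \<bind> (\<lambda>x. distr (\<pi> t (\<omega>, x)) state_action (Pair x))"

text \<open>The law of $(x_t, a_t)_{t \ge 0}$ is the Ionescu-Tulcea measure of these kernels.\<close>

definition process :: "'w inventory \<Rightarrow> policy \<Rightarrow> real \<Rightarrow> (nat \<Rightarrow> real \<times> real) measure" where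
  "process I \<pi> x0 =
     projective_family.lim UNIV
       (Ionescu_Tulcea.CI (step I \<pi> x0) (\<lambda>_. state_action)) (\<lambda>_. state_action)"

lemma Ionescu_Tulcea_step:
  assumes I: "inventory_model I" and pi: "\<pi> \<in> policies"
  shows "Ionescu_Tulcea (step I \<pi> x0) (\<lambda>_. state_action)"
proof -
  interpret prob_space "prob_sp I"
    using I by (simp add: inventory_model_def)
  have D: "demand I 1 \<in> borel_measurable (prob_sp I)"
    using I by (auto simp: inventory_model_def)
  interpret L: prob_space "demand_law I"
    unfolding demand_law_def using D by (rule prob_space_distr)
  have setsL[measurable_cong]: "sets (demand_law I) = sets borel"
    by (simp add: demand_law_def)
  have kernel: "step I \<pi> x0 t \<in> PiM {0..<t} (\<lambda>_. state_action) \<rightarrow>\<^sub>M prob_algebra state_action" for t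
  proof -
    let ?H = "PiM {0..<t} (\<lambda>_. state_action)"
    have [measurable]: "\<pi> t \<in> (?H \<Otimes>\<^sub>M borel) \<rightarrow>\<^sub>M prob_algebra action_space"
      using pi by (auto simp: policies_def)
    have state: "state_law I x0 t \<in> ?H \<rightarrow>\<^sub>M prob_algebra borel"
    proof (cases "t = 0")
      case True
      then show ?thesis
        by (simp add: state_law_def[abs_def] measurable_return_prob_space prob_space_return
            space_prob_algebra measurable_const)
    next
      case False
      then have [measurable]: "(\<lambda>\<omega>. \<omega> (t - Suc 0)) \<in> ?H \<rightarrow>\<^sub>M state_action"
        by (intro measurable_component_singleton) auto
      have [measurable]: "fst \<in> state_action \<rightarrow>\<^sub>M borel"
        by (simp add: state_action_def)
      have "snd \<in> state_action \<rightarrow>\<^sub>M action_space"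
        by (simp add: state_action_def)
      then have [measurable]: "snd \<in> state_action \<rightarrow>\<^sub>M borel"
        by (auto simp: action_space_def measurable_restrict_space2_iff)
      have "(\<lambda>\<omega>. distr (demand_law I) borel (\<lambda>d. fst (\<omega> (t - 1)) + snd (\<omega> (t - 1)) - d))
          \<in> ?H \<rightarrow>\<^sub>M prob_algebra borel"
        by (rule measurable_distr_prob_space2[where M = borel])
          (auto simp: space_prob_algebra L.prob_space_axioms setsL)
      with False show ?thesis
        by (simp add: state_law_def[abs_def])
    qed
    have pair: "(\<lambda>p. (snd (fst p), snd p)) \<in> (N \<Otimes>\<^sub>M borel) \<Otimes>\<^sub>M action_space \<rightarrow>\<^sub>M state_action"
      for N :: "(nat \<Rightarrow> real \<times> real) measure"
      unfolding state_action_def by measurable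
    have "(\<lambda>p. distr (\<pi> t p) state_action (Pair (snd p)))
        \<in> ?H \<Otimes>\<^sub>M borel \<rightarrow>\<^sub>M prob_algebra state_action"
      by (rule measurable_distr_prob_space2[where M = action_space])
        (use pair in \<open>auto simp: split_beta'\<close>)
    then have "(\<lambda>(\<omega>, x). distr (\<pi> t (\<omega>, x)) state_action (Pair x))
        \<in> ?H \<Otimes>\<^sub>M borel \<rightarrow>\<^sub>M prob_algebra state_action"
      by (simp add: split_beta')
    then show ?thesis
      unfolding step_def[abs_def]
      by (rule measurable_bind_prob_space2[OF state])
  qed
  show ?thesis
    using measurable_prob_algebraD[OF kernel] measurable_space[OF kernel]
    by (auto simp: Ionescu_Tulcea_def space_prob_algebra)
qed

text \<open>One-step costs are nonnegative, so total costs are taken in \<^typ>\<open>ennreal\<close>.\<close>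

definition disc_cost :: "'w inventory \<Rightarrow> real \<Rightarrow> policy \<Rightarrow> real \<Rightarrow> ennreal" where
  "disc_cost I \<alpha> \<pi> x =
     (\<integral>\<^sup>+\<omega>. (\<Sum>t. ennreal (\<alpha> ^ t * cost I (fst (\<omega> t)) (snd (\<omega> t)))) \<partial>process I \<pi> x)"

definition value_fn :: "'w inventory \<Rightarrow> real \<Rightarrow> real \<Rightarrow> ennreal" where
  "value_fn I \<alpha> x = (INF \<pi>\<in>policies. disc_cost I \<alpha> \<pi> x)"

definition disc_optimal :: "'w inventory \<Rightarrow> real \<Rightarrow> policy \<Rightarrow> bool" where
  "disc_optimal I \<alpha> \<pi> \<longleftrightarrow> \<pi> \<in> policies \<and> (\<forall>x. disc_cost I \<alpha> \<pi> x = value_fn I \<alpha> x)"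

definition avg_cost :: "'w inventory \<Rightarrow> policy \<Rightarrow> real \<Rightarrow> ennreal" where
  "avg_cost I \<pi> x =
     limsup (\<lambda>N. (\<integral>\<^sup>+\<omega>. (\<Sum>t<N. ennreal (cost I (fst (\<omega> t)) (snd (\<omega> t)))) \<partial>process I \<pi> x)
                  / of_nat N)"

definition avg_optimal :: "'w inventory \<Rightarrow> policy \<Rightarrow> bool" where
  "avg_optimal I \<pi> \<longleftrightarrow>
     \<pi> \<in> policies \<and> (\<forall>\<pi>'\<in>policies. \<forall>x. avg_cost I \<pi> x \<le> avg_cost I \<pi>' x)"

definition min_value :: "'w inventory \<Rightarrow> real \<Rightarrow> ennreal" where
  "min_value I \<alpha> = (INF x. value_fn I \<alpha> x)"

definition rel_value :: "'w inventory \<Rightarrow> real \<Rightarrow> real \<Rightarrow> ereal" where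
  "rel_value I \<alpha> x = enn2ereal (value_fn I \<alpha> x) - enn2ereal (min_value I \<alpha>)"

text \<open>The largest number below $\liminf_n u_{\alpha_n}(y_n)$ for all sequences $y_n \to x$.\<close>

definition liminf_rel_value :: "'w inventory \<Rightarrow> (nat \<Rightarrow> real) \<Rightarrow> real \<Rightarrow> ereal" where
  "liminf_rel_value I a x =
     (INF y\<in>{y. y \<longlonglongrightarrow> x}. liminf (\<lambda>n. rel_value I (a n) (y n)))"

definition h_disc :: "'w inventory \<Rightarrow> real \<Rightarrow> real \<Rightarrow> real" where
  "h_disc I \<alpha> x = holding I x + (1 - \<alpha>) * unit_cost I * x + unit_cost I * ED I (\<lambda>d. d)"

definition exp_h_disc :: "'w inventory \<Rightarrow> real \<Rightarrow> real \<Rightarrow> real" where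
  "exp_h_disc I \<alpha> x = ED I (\<lambda>d. h_disc I \<alpha> (x - d))"

definition x_min :: "'w inventory \<Rightarrow> real \<Rightarrow> real" where
  "x_min I \<alpha> = (LEAST x. minimizes (exp_h_disc I \<alpha>) x)"

definition G_fn :: "'w inventory \<Rightarrow> real \<Rightarrow> real \<Rightarrow> ereal" where
  "G_fn I \<alpha> x =
     ereal (unit_cost I * x + exp_holding I x)
     + ereal \<alpha> * enn2ereal (\<integral>\<^sup>+\<omega>. value_fn I \<alpha> (x - demand I 1 \<omega>) \<partial>prob_sp I)"

definition H_fn :: "'w inventory \<Rightarrow> (real \<Rightarrow> real) \<Rightarrow> real \<Rightarrow> real" where
  "H_fn I u x = unit_cost I * x + exp_holding I x + ED I (\<lambda>d. u (x - d))"

text \<open>Used with $g = G_\alpha$ (extended real) and with $g = H$ (real).\<close>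

definition lower_threshold :: "'b::{ord,plus} \<Rightarrow> (real \<Rightarrow> 'b) \<Rightarrow> real \<Rightarrow> real" where
  "lower_threshold k g S = Inf {x. x \<le> S \<and> g x \<le> k + g S}"

definition disc_thresholds ::
    "'w inventory \<Rightarrow> real \<Rightarrow> (real \<Rightarrow> real) \<Rightarrow> (real \<Rightarrow> real) \<Rightarrow> bool" where
  "disc_thresholds I \<alpha>s s' S' \<longleftrightarrow>
     (\<forall>\<alpha>\<in>{\<alpha>s<..<1}. s' \<alpha> \<le> S' \<alpha> \<and> disc_optimal I \<alpha> (stationary (sS_map (s' \<alpha>) (S' \<alpha>))))"

text \<open>The sequences $\alpha_n \uparrow 1$ with first element above $\alpha^*$; the sequence is
  indexed from 0, and nonnegativity follows from $\alpha^* \ge 0$.\<close>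

definition disc_seq :: "real \<Rightarrow> (nat \<Rightarrow> real) \<Rightarrow> bool" where
  "disc_seq \<alpha>s a \<longleftrightarrow> incseq a \<and> (\<forall>n. a n < 1) \<and> a \<longlonglongrightarrow> 1 \<and> \<alpha>s < a 0"

text \<open>The average-cost optimality equation for the map \<open>\<phi>\<close>, including the attainment of the
  minimum over $a \ge 0$.\<close>

definition avg_opt_equation ::
    "'w inventory \<Rightarrow> real \<Rightarrow> (real \<Rightarrow> real) \<Rightarrow> (real \<Rightarrow> real) \<Rightarrow> bool" where
  "avg_opt_equation I w u \<phi> \<longleftrightarrow>
     (\<forall>x. w + u x = fixed_cost I * of_bool (0 < \<phi> x) + H_fn I u (x + \<phi> x) - unit_cost I * x \<and>
          (\<exists>a. is_arg_min (\<lambda>a. fixed_cost I + H_fn I u (x + a)) (\<lambda>a. 0 \<le> a) a \<and>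
               w + u x = min (fixed_cost I + H_fn I u (x + a)) (H_fn I u x) - unit_cost I * x))"

end

theory Submission
  imports Defs
begin

text \<open>
  Write $g(x) = E[h(x-D)]$. After adding $\bar c x$ to the value function, the optimality equation
  for the discount factor $\alpha \in [0,1]$ has one-step cost $f_\alpha(y) = g(y) + (1-\alpha)\bar c y$
  (up to a constant) and no linear ordering cost. For $s$ to the left of the mode of $f_\alpha$ let
  $J_{\alpha,s}(y)$ be the expected discounted sum of $f_\alpha(y_t) - f_\alpha(s)$ while the level
  $y_t = y - D_1 - \cdots - D_t$ stays above $s$; it solves a renewal equation and is jointly continuous
  in $(\alpha,s,y)$, also at $\alpha = 1$. As $s$ decreases, $\min_y J_{\alpha,s}(y)$ decreases from 0
  to below $-K$, and for the $s$ at which it equals $-K$ (with minimizer $S$) an argument of Zheng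
  shows $J_{\alpha,s}(x) \le K + J_{\alpha,s}(y)$ for all $x \le y$. Hence $J_{\alpha,s}$ solves the
  optimality equation, with the $(s,S)$ policy attaining the minimum, for $\alpha < 1$ and $\alpha = 1$
  alike. For $\alpha < 1$ this identifies $v_\alpha$ and all optimal $(s,S)$ policies. Strict
  monotonicity of $f_1$ makes the critical $s$ for $\alpha = 1$ unique, so every critical $s$ for
  $\alpha < 1$ converges to it, and all limits follow from the continuity of $J$. Average-cost optimality
  follows from the optimality equation with $u \ge 0$ (upper bound) and from a Tauberian inequality
  (lower bound).
\<close>

section \<open>Renewal functions of the demand\<close>

text \<open>At \<alpha> = 1 discounting no longer makes the renewal series converge, and the costs
  are unbounded, so the sup norm is of no help. The weight exp(-y) replaces discounting: the
  iterated functions vanish below some level, the demand only lowers the level, and one step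
  therefore contracts the weighted norm on each half-line y \<le> B by \<rho> = E[exp(-D)], which is
  less than 1 because D is nonnegative and not almost surely 0. This factor does not involve
  \<alpha>, so one maximum principle yields estimates and limits uniform up to \<alpha> = 1, without
  extracting convergent subsequences of value functions. A second obstacle is that f_\<alpha> may
  have flat pieces for \<alpha> < 1, so that critical thresholds need not be unique; convergence is
  therefore proved for all of them at once. A third is that value functions are unbounded: comparing
  an arbitrary policy with the candidate requires a remainder that vanishes, and this comes from
  bounding the candidate by the holding cost and the expected backlog.\<close>

locale demand_distribution = prob_space M for M :: "real measure" +
  assumes sets_M [measurable_cong]: "sets M = sets borel"
    and demand_nonneg: "AE d in M. 0 \<le> d"
    and integrable_demand: "integrable M (\<lambda>d. d)"
    and demand_nontrivial: "\<not> (AE d in M. d = 0)"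
begin

section \<open>The one-step demand operator and its contraction factor\<close>

definition post :: "(real \<Rightarrow> real) \<Rightarrow> real \<Rightarrow> real" where
  "post f y = (\<integral>d. f (y - d) \<partial>M)"

definition \<rho> :: real where
  "\<rho> = (\<integral>d. exp (- d) \<partial>M)"

lemma space_M [simp]: "space M = UNIV"
  using sets_eq_imp_space_eq[OF sets_M] by simp

lemma integrable_exp: "integrable M (\<lambda>d. exp (- d))"
  by (rule integrable_const_bound[where B = 1]) (use demand_nonneg in auto)

lemma rho_nonneg: "0 \<le> \<rho>"
  unfolding \<rho>_def by (intro integral_nonneg_AE) auto

lemma rho_less_1: "\<rho> < 1"
proof (rule ccontr)
  assume "\<not> \<rho> < 1"
  moreover have int: "integrable M (\<lambda>d. 1 - exp (- d))"
    using integrable_exp by simp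
  moreover have nonneg: "AE d in M. 0 \<le> 1 - exp (- d)"
    using demand_nonneg by auto
  moreover have "(\<integral>d. 1 - exp (- d) \<partial>M) = 1 - \<rho>"
    unfolding \<rho>_def using integrable_exp by (simp add: prob_space[simplified])
  ultimately have "(\<integral>d. 1 - exp (- d) \<partial>M) = 0"
    using integral_nonneg_AE[OF nonneg] by linarith
  then have "AE d in M. 1 - exp (- d) = 0"
    using integral_nonneg_eq_0_iff_AE[OF int nonneg] by simp
  then have "AE d in M. d = 0"
    by auto
  then show False
    using demand_nontrivial by simp
qed

text \<open>Finiteness of the weighted norm, uniformly over the parameters: compactness bounds the
  family on a \<le> y \<le> B, where exp(y - a) is at least 1, and to the left of a the family is
  zero.\<close>

lemma family_bounded:
  fixes f :: "'p::metric_space \<Rightarrow> real \<Rightarrow> real"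
  assumes P: "compact P" and f: "continuous_on (P \<times> UNIV) (\<lambda>(p, y). f p y)"
    and a: "\<And>p y. p \<in> P \<Longrightarrow> y \<le> a \<Longrightarrow> f p y = 0"
  obtains C where "0 \<le> C" "\<And>p y. p \<in> P \<Longrightarrow> y \<le> B \<Longrightarrow> \<bar>f p y\<bar> \<le> C * exp (y - a)"
proof -
  have "compact ((\<lambda>(p, y). f p y) ` (P \<times> {a..B}))"
    using P by (intro compact_continuous_image continuous_on_subset[OF f] compact_Times) auto
  then obtain C where C: "\<forall>z\<in>(\<lambda>(p, y). f p y) ` (P \<times> {a..B}). \<bar>z\<bar> \<le> C"
    using compact_imp_bounded bounded_real by blast
  show thesis
  proof (rule that[of "max C 0"])
    fix p y assume p: "p \<in> P" and y: "y \<le> B"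
    show "\<bar>f p y\<bar> \<le> max C 0 * exp (y - a)"
    proof (cases "y \<le> a")
      case True
      then show ?thesis using a p by simp
    next
      case False
      then have "\<bar>f p y\<bar> \<le> C"
        using C p y by auto
      then have "\<bar>f p y\<bar> \<le> max C 0 * 1"
        by simp
      also have "\<dots> \<le> max C 0 * exp (y - a)"
        using False by (intro mult_left_mono) auto
      finally show ?thesis .
    qed
  qed simp
qed

text \<open>A one-point parameter space, through which the statements on single functions become
  instances of those on families.\<close>

lemma single_family:
  fixes f :: "real \<Rightarrow> real"
  assumes "continuous_on UNIV f"
  shows "continuous_on ({0::real} \<times> UNIV) (\<lambda>(p, y). f y)"
  unfolding split_beta
  by (rule continuous_on_compose2[OF assms continuous_on_snd[OF continuous_on_id]]) auto

lemma family_section: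
  assumes "continuous_on (P \<times> UNIV) (\<lambda>(p, y). f p y)" "p \<in> P"
  shows "continuous_on UNIV (f p)"
proof -
  have "continuous_on UNIV (\<lambda>y. (p, y))"
    by (intro continuous_intros)
  from continuous_on_compose2[OF assms(1) this] show ?thesis
    using assms(2) by auto
qed

lemma vanishing_bounded:
  fixes f :: "real \<Rightarrow> real"
  assumes "continuous_on UNIV f" "\<And>y. y \<le> a \<Longrightarrow> f y = 0"
  obtains C where "0 \<le> C" "\<And>y. y \<le> B \<Longrightarrow> \<bar>f y\<bar> \<le> C * exp (y - a)"
proof (rule family_bounded[OF _ single_family[OF assms(1)], of a B])
  fix C assume "0 \<le> C" "\<And>p y. p \<in> {0} \<Longrightarrow> y \<le> B \<Longrightarrow> \<bar>f y\<bar> \<le> C * exp (y - a)"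
  then show thesis by (intro that) auto
qed (use assms(2) in auto)

lemma integrable_vanishing:
  fixes f :: "real \<Rightarrow> real"
  assumes f: "continuous_on UNIV f" and "\<And>y. y \<le> a \<Longrightarrow> f y = 0"
  shows "integrable M (\<lambda>d. f (y - d))"
proof -
  obtain C where C: "0 \<le> C" "\<And>z. z \<le> y \<Longrightarrow> \<bar>f z\<bar> \<le> C * exp (z - a)"
    using vanishing_bounded[OF assms] by metis
  have [measurable]: "f \<in> borel_measurable borel"
    using f by (rule borel_measurable_continuous_onI)
  show ?thesis
  proof (rule integrable_const_bound[where B = "C * exp (y - a)"])
    show "AE d in M. norm (f (y - d)) \<le> C * exp (y - a)"
      using demand_nonneg
    proof eventually_elim
      case (elim d)
      then have "\<bar>f (y - d)\<bar> \<le> C * exp (y - d - a)"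
        using C(2)[of "y - d"] by simp
      also have "\<dots> \<le> C * exp (y - a)"
        using C(1) elim by (intro mult_left_mono) auto
      finally show ?case by simp
    qed
  qed measurable
qed

lemma post_vanishing:
  assumes "\<And>y. y \<le> a \<Longrightarrow> f y = 0" "y \<le> a"
  shows "post f y = 0"
  unfolding post_def
  by (rule integral_eq_zero_AE) (use demand_nonneg assms in \<open>auto elim!: eventually_mono\<close>)

lemma post_mono:
  assumes "integrable M (\<lambda>d. f (y - d))" "integrable M (\<lambda>d. g (y - d))"
    and "\<And>z. z \<le> y \<Longrightarrow> f z \<le> g z"
  shows "post f y \<le> post g y"
  unfolding post_def
  by (rule integral_mono_AE[OF assms(1,2)]) (use demand_nonneg assms(3) in auto)

text \<open>The weight factorizes: exp(y - d - a) = exp(y - a) * exp(-d), and integrating the second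
  factor over the demand produces \<rho>.\<close>

lemma post_exp_bound:
  assumes f: "continuous_on UNIV f" "\<And>y. y \<le> a \<Longrightarrow> f y = 0"
    and bound: "\<And>y. y \<le> B \<Longrightarrow> \<bar>f y\<bar> \<le> C * exp (y - a)" and y: "y \<le> B"
  shows "(\<integral>d. \<bar>f (y - d)\<bar> \<partial>M) \<le> C * \<rho> * exp (y - a)"
    and "\<bar>post f y\<bar> \<le> C * \<rho> * exp (y - a)"
proof -
  have int: "integrable M (\<lambda>d. f (y - d))"
    using f by (rule integrable_vanishing)
  have "(\<integral>d. \<bar>f (y - d)\<bar> \<partial>M) \<le> (\<integral>d. C * exp (y - a) * exp (- d) \<partial>M)"
  proof (rule integral_mono_AE)
    show "AE d in M. \<bar>f (y - d)\<bar> \<le> C * exp (y - a) * exp (- d)"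
      using demand_nonneg
    proof eventually_elim
      case (elim d)
      moreover have "exp (y - d - a) = exp (y - a) * exp (- d)"
        by (simp add: exp_add[symmetric])
      ultimately show ?case
        using bound[of "y - d"] y by (simp add: mult.assoc)
    qed
  qed (use int integrable_exp in auto)
  also have "\<dots> = C * \<rho> * exp (y - a)"
    by (simp add: \<rho>_def)
  finally show *: "(\<integral>d. \<bar>f (y - d)\<bar> \<partial>M) \<le> C * \<rho> * exp (y - a)" .
  show "\<bar>post f y\<bar> \<le> C * \<rho> * exp (y - a)"
    using * integral_abs_bound[of M "\<lambda>d. f (y - d)"] unfolding post_def by linarith
qed

text \<open>A maximum principle: one step of the demand contracts the norm with weight
  \<open>exp (- y)\<close> by the factor \<open>\<rho> < 1\<close>, even without discounting.\<close>

lemma comparison: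
  assumes F: "continuous_on UNIV F" "\<And>y. integrable M (\<lambda>d. F (y - d))"
    and \<alpha>: "0 \<le> \<alpha>" "\<alpha> \<le> 1" and \<epsilon>: "0 \<le> \<epsilon>"
    and low: "\<And>y. y \<le> a \<Longrightarrow> F y \<le> 0"
    and step: "\<And>y. a < y \<Longrightarrow> y \<le> B \<Longrightarrow> F y \<le> \<epsilon> + \<alpha> * post F y"
    and y: "y \<le> B"
  shows "F y \<le> \<epsilon> / (1 - \<rho>) * exp (y - a)"
proof -
  \<comment> \<open>The positive part vanishes up to a and so has a finite weighted norm on y \<le>
    B; F itself may be arbitrarily negative there.\<close>
  define G where "G y = max (F y) 0" for y
  have G: "continuous_on UNIV G" "\<And>y. y \<le> a \<Longrightarrow> G y = 0"
    using F(1) low unfolding G_def by (auto intro!: continuous_intros)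
  obtain C where C: "0 \<le> C" "\<And>y. y \<le> B \<Longrightarrow> \<bar>G y\<bar> \<le> C * exp (y - a)"
    using vanishing_bounded[OF G] by metis
  define X where "X = (\<lambda>y. G y * exp (a - y)) ` {..B}"
  define N where "N = Sup X"
  have bdd: "bdd_above X"
  proof (unfold X_def, rule bdd_aboveI2)
    fix z assume "z \<in> {..B}"
    then have "G z \<le> C * exp (z - a)"
      using C(2)[of z] by auto
    then have "G z * exp (a - z) \<le> C * exp (z - a) * exp (a - z)"
      by (intro mult_right_mono) auto
    then show "G z * exp (a - z) \<le> C"
      by (simp add: mult.assoc exp_add[symmetric])
  qed
  have le_N: "G z \<le> N * exp (z - a)" if "z \<le> B" for z
  proof -
    have "G z * exp (a - z) \<le> N"
      unfolding N_def by (rule cSup_upper[OF _ bdd]) (use that in \<open>auto simp: X_def\<close>)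
    then have "G z * exp (a - z) * exp (z - a) \<le> N * exp (z - a)"
      by (intro mult_right_mono) auto
    then show ?thesis
      by (simp add: mult.assoc exp_add[symmetric])
  qed
  have N0: "0 \<le> N"
    using le_N[OF y] by (metis G_def exp_gt_zero max.cobounded2 order_trans zero_le_mult_iff not_le)
  \<comment> \<open>N is the weighted supremum of the positive part. Bounding it by itself with the
    factor \<rho> < 1 and solving for N gives the claim.\<close>
  have "N \<le> \<epsilon> + N * \<rho>"
    unfolding N_def
  proof (rule cSup_least)
    show "X \<noteq> {}" by (auto simp: X_def)
    fix x assume "x \<in> X"
    then obtain z where z: "z \<le> B" "x = G z * exp (a - z)"
      by (auto simp: X_def)
    show "x \<le> \<epsilon> + Sup X * \<rho>"
    proof (cases "z \<le> a \<or> F z \<le> 0")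
      case True
      then have "x = 0" using z low by (auto simp: G_def)
      then show ?thesis
        using \<epsilon> N0 rho_nonneg unfolding N_def[symmetric] by simp
    next
      case False
      have intG: "integrable M (\<lambda>d. G (z - d))"
        using G by (rule integrable_vanishing)
      have "\<bar>post G z\<bar> \<le> N * \<rho> * exp (z - a)"
        by (rule post_exp_bound[OF G _ z(1)]) (use le_N in \<open>auto simp: G_def\<close>)
      then have pG: "post G z \<le> N * \<rho> * exp (z - a)" by simp
      have "0 \<le> post G z"
        unfolding post_def by (rule integral_nonneg_AE) (auto simp: G_def)
      moreover have "post F z \<le> post G z"
        by (rule post_mono[OF F(2) intG]) (simp add: G_def)
      ultimately have "\<alpha> * post F z \<le> post G z"
        using mult_left_mono[of "post F z" "post G z" \<alpha>] mult_right_mono[of \<alpha> 1 "post G z"] \<alpha>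
        by linarith
      then have "G z \<le> \<epsilon> + N * \<rho> * exp (z - a)"
        using step[of z] False z pG by (auto simp: G_def)
      then have "x \<le> (\<epsilon> + N * \<rho> * exp (z - a)) * exp (a - z)"
        unfolding z(2) by (intro mult_right_mono) auto
      also have "\<dots> = \<epsilon> * exp (a - z) + N * \<rho>"
        by (simp add: algebra_simps exp_add[symmetric])
      also have "\<dots> \<le> \<epsilon> * 1 + N * \<rho>"
        using False \<epsilon> by (intro add_right_mono mult_left_mono) auto
      finally show ?thesis by (simp add: N_def)
    qed
  qed
  then have "N \<le> \<epsilon> / (1 - \<rho>)"
    using rho_less_1 by (simp add: field_simps)
  then have "N * exp (y - a) \<le> \<epsilon> / (1 - \<rho>) * exp (y - a)"
    by (intro mult_right_mono) auto
  with le_N[OF y] show ?thesis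
    by (simp add: G_def)
qed

text \<open>The Neumann series of the inverse of 1 - \<alpha> * post: the expected discounted sum of
  f along the descent of the level when nothing is ordered.\<close>

definition renewal :: "real \<Rightarrow> (real \<Rightarrow> real) \<Rightarrow> real \<Rightarrow> real" where
  "renewal \<alpha> f y = (\<Sum>n. \<alpha> ^ n * (post ^^ n) f y)"

lemma post_continuous_family:
  fixes f :: "'p::metric_space \<Rightarrow> real \<Rightarrow> real"
  assumes P: "compact P" and f: "continuous_on (P \<times> UNIV) (\<lambda>(p, y). f p y)"
    and a: "\<And>p y. p \<in> P \<Longrightarrow> y \<le> a \<Longrightarrow> f p y = 0"
  shows "continuous_on (P \<times> UNIV) (\<lambda>(p, y). post (f p) y)"
proof (rule continuous_on_sequentiallyI)
  fix u :: "nat \<Rightarrow> 'p \<times> real" and x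
  assume u: "\<forall>n. u n \<in> P \<times> UNIV" and x: "x \<in> P \<times> UNIV" and lim: "u \<longlonglongrightarrow> x"
  \<comment> \<open>A convergent sequence of levels is bounded by some B, and nonnegative demand
    keeps all arguments y - d below B as well; this gives the constant majorant for dominated
    convergence.\<close>
  have "Bseq (\<lambda>n. snd (u n))"
    using tendsto_snd[OF lim] by (intro convergent_imp_Bseq) (auto simp: convergent_def)
  then obtain B where B: "\<And>n. snd (u n) \<le> B"
    by (auto simp: Bseq_def) (meson abs_le_D1)
  obtain C where C: "0 \<le> C" "\<And>p y. p \<in> P \<Longrightarrow> y \<le> B \<Longrightarrow> \<bar>f p y\<bar> \<le> C * exp (y - a)"
    using family_bounded[OF assms] by metis
  have meas: "(\<lambda>d. f p (y - d)) \<in> borel_measurable M" if "p \<in> P" for p y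
    using borel_measurable_continuous_onI[OF family_section[OF f that]] by measurable
  have "(\<lambda>n. \<integral>d. f (fst (u n)) (snd (u n) - d) \<partial>M) \<longlonglongrightarrow> (\<integral>d. f (fst x) (snd x - d) \<partial>M)"
  proof (rule integral_dominated_convergence[where w = "\<lambda>_. C * exp (B - a)"])
    show "AE d in M. (\<lambda>n. f (fst (u n)) (snd (u n) - d)) \<longlonglongrightarrow> f (fst x) (snd x - d)"
    proof (rule AE_I2)
      fix d
      have "(\<lambda>n. (\<lambda>(p, y). f p y) (fst (u n), snd (u n) - d))
          \<longlonglongrightarrow> (\<lambda>(p, y). f p y) (fst x, snd x - d)"
        using u x by (intro continuous_on_tendsto_compose[OF f] tendsto_intros lim)
          (auto simp: mem_Times_iff)
      then show "(\<lambda>n. f (fst (u n)) (snd (u n) - d)) \<longlonglongrightarrow> f (fst x) (snd x - d)"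
        by simp
    qed
    show "AE d in M. norm (f (fst (u n)) (snd (u n) - d)) \<le> C * exp (B - a)" for n
      using demand_nonneg
    proof eventually_elim
      case (elim d)
      then have d: "snd (u n) - d \<le> B"
        using B[of n] by simp
      then have "\<bar>f (fst (u n)) (snd (u n) - d)\<bar> \<le> C * exp (snd (u n) - d - a)"
        using C(2) u by (auto simp: mem_Times_iff)
      also have "\<dots> \<le> C * exp (B - a)"
        using C(1) d by (intro mult_left_mono) auto
      finally show ?case by simp
    qed
  qed (use u x meas in \<open>auto simp: mem_Times_iff\<close>)
  then show "(\<lambda>n. (\<lambda>(p, y). post (f p) y) (u n)) \<longlonglongrightarrow> (\<lambda>(p, y). post (f p) y) x"
    by (simp add: split_beta post_def)
qed

lemma post_continuous:
  fixes f :: "real \<Rightarrow> real"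
  assumes "continuous_on UNIV f" "\<And>y. y \<le> a \<Longrightarrow> f y = 0"
  shows "continuous_on UNIV (post f)"
  by (rule family_section[OF post_continuous_family[OF _ single_family[OF assms(1)]], of a 0])
    (use assms(2) in auto)

lemma iterate_vanishing: "(\<And>y. y \<le> a \<Longrightarrow> f y = 0) \<Longrightarrow> y \<le> a \<Longrightarrow> (post ^^ n) f y = 0"
proof (induction n arbitrary: y)
  case (Suc n)
  then show ?case using post_vanishing[of a "(post ^^ n) f" y] by simp
qed simp

lemma iterate_continuous_family:
  fixes f :: "'p::metric_space \<Rightarrow> real \<Rightarrow> real"
  assumes P: "compact P" and f: "continuous_on (P \<times> UNIV) (\<lambda>(p, y). f p y)"
    and a: "\<And>p y. p \<in> P \<Longrightarrow> y \<le> a \<Longrightarrow> f p y = 0"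
  shows "continuous_on (P \<times> UNIV) (\<lambda>(p, y). (post ^^ n) (f p) y)"
proof (induction n)
  case (Suc n)
  show ?case
    using post_continuous_family[OF P Suc, of a] iterate_vanishing[of a] a by simp
qed (use f in simp)

lemma iterate_continuous:
  fixes f :: "real \<Rightarrow> real"
  assumes "continuous_on UNIV f" "\<And>y. y \<le> a \<Longrightarrow> f y = 0"
  shows "continuous_on UNIV ((post ^^ n) f)"
  by (rule family_section[OF iterate_continuous_family[OF _ single_family[OF assms(1)]], of a 0])
    (use assms(2) in auto)

lemma iterate_bound:
  assumes f: "continuous_on UNIV f" "\<And>y. y \<le> a \<Longrightarrow> f y = 0"
    and bound: "\<And>y. y \<le> B \<Longrightarrow> \<bar>f y\<bar> \<le> C * exp (y - a)" and y: "y \<le> B"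
  shows "\<bar>(post ^^ n) f y\<bar> \<le> C * \<rho> ^ n * exp (y - a)"
  using y
proof (induction n arbitrary: y)
  case (Suc n)
  have "\<bar>post ((post ^^ n) f) y\<bar> \<le> C * \<rho> ^ n * \<rho> * exp (y - a)"
    by (rule post_exp_bound(2)[where B = B, OF iterate_continuous[OF f]])
      (use Suc iterate_vanishing[of a f] f(2) in auto)
  then show ?case by (simp add: ac_simps)
qed (use bound in simp)

lemma discounted_iterate_bound:
  assumes f: "continuous_on UNIV f" "\<And>y. y \<le> a \<Longrightarrow> f y = 0"
    and bound: "\<And>y. y \<le> B \<Longrightarrow> \<bar>f y\<bar> \<le> C * exp (y - a)" and y: "y \<le> B"
    and \<alpha>: "0 \<le> \<alpha>" "\<alpha> \<le> 1"
  shows "\<bar>\<alpha> ^ n * (post ^^ n) f y\<bar> \<le> C * \<rho> ^ n * exp (y - a)"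
proof -
  have "\<bar>\<alpha> ^ n * (post ^^ n) f y\<bar> \<le> 1 * \<bar>(post ^^ n) f y\<bar>"
    unfolding abs_mult using \<alpha> by (intro mult_right_mono) (auto simp: power_le_one)
  then show ?thesis
    using iterate_bound[OF f bound y, where n = n] by simp
qed

lemma summable_geometric_rho: "summable (\<lambda>n. C * \<rho> ^ n * D)"
  using rho_nonneg rho_less_1 by (intro summable_mult2 summable_mult summable_geometric) auto

lemma renewal_summable:
  assumes f: "continuous_on UNIV f" "\<And>y. y \<le> a \<Longrightarrow> f y = 0" and \<alpha>: "0 \<le> \<alpha>" "\<alpha> \<le> 1"
  shows "summable (\<lambda>n. \<bar>\<alpha> ^ n * (post ^^ n) f y\<bar>)"
proof -
  obtain C where C: "0 \<le> C" "\<And>z. z \<le> y \<Longrightarrow> \<bar>f z\<bar> \<le> C * exp (z - a)"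
    using vanishing_bounded[OF f] by metis
  show ?thesis
    by (rule summable_comparison_test'[OF summable_geometric_rho[of C "exp (y - a)"]])
      (use discounted_iterate_bound[OF f C(2) _ \<alpha>] in auto)
qed

lemma renewal_vanishing: "(\<And>y. y \<le> a \<Longrightarrow> f y = 0) \<Longrightarrow> y \<le> a \<Longrightarrow> renewal \<alpha> f y = 0"
  by (simp add: renewal_def iterate_vanishing[of a])

text \<open>The majorants C * \<rho>^n * exp(B - a) on y \<le> B do not depend on the discount
  factor, so the Weierstrass test also covers the value 1. Every convergent sequence of levels stays
  in one such half-line.\<close>

lemma renewal_continuous_family:
  fixes f :: "'p::metric_space \<Rightarrow> real \<Rightarrow> real"
  assumes P: "compact P" and f: "continuous_on (P \<times> UNIV) (\<lambda>(p, y). f p y)"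
    and a: "\<And>p y. p \<in> P \<Longrightarrow> y \<le> a \<Longrightarrow> f p y = 0"
    and \<beta>: "continuous_on P \<beta>" "\<And>p. p \<in> P \<Longrightarrow> 0 \<le> \<beta> p" "\<And>p. p \<in> P \<Longrightarrow> \<beta> p \<le> 1"
  shows "continuous_on (P \<times> UNIV) (\<lambda>(p, y). renewal (\<beta> p) (f p) y)"
proof -
  define F where "F n = (\<lambda>(p, y). \<beta> p ^ n * (post ^^ n) (f p) y)" for n
  have contF: "continuous_on (P \<times> UNIV) (F n)" for n
    unfolding F_def split_beta
    by (intro continuous_intros continuous_on_compose2[OF \<beta>(1)]
        iterate_continuous_family[OF P f, of a, unfolded split_beta]) (auto simp: a)
  have cont: "continuous_on (P \<times> {..B}) (\<lambda>x. \<Sum>n. F n x)" for B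
  proof -
    obtain C where C: "0 \<le> C" "\<And>p y. p \<in> P \<Longrightarrow> y \<le> B \<Longrightarrow> \<bar>f p y\<bar> \<le> C * exp (y - a)"
      using family_bounded[OF P f a] by metis
    have "uniform_limit (P \<times> {..B}) (\<lambda>n x. \<Sum>i<n. F i x) (\<lambda>x. \<Sum>i. F i x) sequentially"
    proof (rule Weierstrass_m_test[OF _ summable_geometric_rho[of C "exp (B - a)"]])
      fix n x assume x: "x \<in> P \<times> {..B}"
      have "norm (F n x) \<le> C * \<rho> ^ n * exp (snd x - a)"
        unfolding F_def split_beta real_norm_def
        by (rule discounted_iterate_bound[OF family_section[OF f], where B = B]) (use x a C \<beta> in auto)
      also have "\<dots> \<le> C * \<rho> ^ n * exp (B - a)"
        using x C(1) rho_nonneg by (intro mult_left_mono) auto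
      finally show "norm (F n x) \<le> C * \<rho> ^ n * exp (B - a)" .
    qed
    then show ?thesis
      by (rule uniform_limit_theorem[rotated])
        (auto intro!: always_eventually continuous_intros continuous_on_subset[OF contF])
  qed
  have "continuous_on (P \<times> UNIV) (\<lambda>x. \<Sum>n. F n x)"
  proof (rule continuous_on_sequentiallyI)
    fix u :: "nat \<Rightarrow> 'p \<times> real" and x
    assume u: "\<forall>n. u n \<in> P \<times> UNIV" and x: "x \<in> P \<times> UNIV" and lim: "u \<longlonglongrightarrow> x"
    have "Bseq (\<lambda>n. snd (u n))"
      using tendsto_snd[OF lim] by (intro convergent_imp_Bseq) (auto simp: convergent_def)
    then obtain B where B: "\<And>n. snd (u n) \<le> B"
      by (auto simp: Bseq_def) (meson abs_le_D1)
    then have "snd x \<le> B"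
      using LIMSEQ_le_const2[OF tendsto_snd[OF lim]] by auto
    then show "(\<lambda>n. \<Sum>i. F i (u n)) \<longlonglongrightarrow> (\<Sum>i. F i x)"
      using u x B by (intro continuous_on_tendsto_compose[OF cont[of B] lim]) (auto simp: mem_Times_iff)
  qed
  then show ?thesis
    by (simp add: F_def renewal_def split_beta)
qed

lemma renewal_continuous:
  fixes f :: "real \<Rightarrow> real"
  assumes "continuous_on UNIV f" "\<And>y. y \<le> a \<Longrightarrow> f y = 0" "0 \<le> \<alpha>" "\<alpha> \<le> 1"
  shows "continuous_on UNIV (renewal \<alpha> f)"
  by (rule family_section[OF renewal_continuous_family[OF _ single_family[OF assms(1)]], of a "\<lambda>_. \<alpha>" 0])
    (use assms in auto)

text \<open>Splitting off the first term of the series leaves \<alpha> * post of the series itself;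
  the geometric bound in \<rho> justifies exchanging sum and expectation.\<close>

lemma renewal_equation:
  assumes f: "continuous_on UNIV f" "\<And>y. y \<le> a \<Longrightarrow> f y = 0" and \<alpha>: "0 \<le> \<alpha>" "\<alpha> \<le> 1"
  shows "renewal \<alpha> f y = f y + \<alpha> * post (renewal \<alpha> f) y"
proof -
  define F where "F n z = \<alpha> ^ n * (post ^^ n) f z" for n z
  obtain C where C: "0 \<le> C" "\<And>z. z \<le> y \<Longrightarrow> \<bar>f z\<bar> \<le> C * exp (z - a)"
    using vanishing_bounded[OF f] by metis
  have F: "continuous_on UNIV (F n)" "\<And>y. y \<le> a \<Longrightarrow> F n y = 0" for n
    unfolding F_def using iterate_continuous[OF f] iterate_vanishing[of a f] f(2)
    by (auto intro!: continuous_intros)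
  have "summable (\<lambda>n. \<integral>d. norm (F n (y - d)) \<partial>M)"
  proof (rule summable_comparison_test'[OF summable_geometric_rho[of C "\<rho> * exp (y - a)"]])
    fix n
    have "(\<integral>d. \<bar>F n (y - d)\<bar> \<partial>M) \<le> C * \<rho> ^ n * \<rho> * exp (y - a)"
      unfolding F_def
      by (rule post_exp_bound(1)[OF F[unfolded F_def] discounted_iterate_bound[OF f C(2) _ \<alpha>]]) auto
    then show "norm (\<integral>d. norm (F n (y - d)) \<partial>M) \<le> C * \<rho> ^ n * (\<rho> * exp (y - a))"
      by (simp add: integral_nonneg_AE ac_simps)
  qed
  then have "post (\<lambda>z. \<Sum>n. F n z) y = (\<Sum>n. post (F n) y)"
    unfolding post_def
    by (intro integral_suminf integrable_vanishing[OF F] AE_I2)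
      (use renewal_summable[OF f \<alpha>] in \<open>auto simp: F_def\<close>)
  then have "\<alpha> * post (renewal \<alpha> f) y = \<alpha> * (\<Sum>n. post (F n) y)"
    by (simp add: renewal_def[abs_def] F_def)
  also have "\<dots> = (\<Sum>n. \<alpha> * post (F n) y)"
  proof (rule suminf_mult[symmetric])
    have "post (F n) y = \<alpha> ^ n * (post ^^ Suc n) f y" for n
      by (simp add: post_def F_def)
    moreover have "\<bar>\<alpha> ^ n * (post ^^ Suc n) f y\<bar> \<le> C * \<rho> ^ n * (\<rho> * exp (y - a))" for n
    proof -
      have "\<bar>\<alpha> ^ n * (post ^^ Suc n) f y\<bar> \<le> 1 * \<bar>(post ^^ Suc n) f y\<bar>"
        unfolding abs_mult using \<alpha> by (intro mult_right_mono) (auto simp: power_le_one)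
      also have "\<dots> \<le> C * \<rho> ^ Suc n * exp (y - a)"
        using iterate_bound[OF f C(2), where y = y and n = "Suc n"] by simp
      finally show ?thesis by (simp add: ac_simps)
    qed
    ultimately show "summable (\<lambda>n. post (F n) y)"
      by (intro summable_comparison_test'[OF summable_geometric_rho[of C "\<rho> * exp (y - a)"]]) auto
  qed
  also have "\<dots> = (\<Sum>n. F (Suc n) y)"
    by (simp add: F_def post_def ac_simps)
  also have "\<dots> = renewal \<alpha> f y - f y"
  proof -
    have "summable (\<lambda>n. F n y)"
      unfolding F_def using renewal_summable[OF f \<alpha>] by (rule summable_rabs_cancel)
    from suminf_split_head[OF this] show ?thesis
      by (simp add: F_def renewal_def)
  qed
  finally show ?thesis by simp
qed

end

section \<open>Excess costs of threshold policies\<close>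

lemma continuous_attains_min_outside:
  fixes f :: "real \<Rightarrow> real"
  assumes f: "continuous_on UNIV f" and out: "\<And>x. x < a \<or> b < x \<Longrightarrow> f z < f x"
  shows "\<exists>x. \<forall>y. f x \<le> f y"
proof -
  have z: "z \<in> {a..b}"
    using out[of z] by (cases "z \<in> {a..b}") auto
  obtain x where x: "x \<in> {a..b}" "\<forall>y\<in>{a..b}. f x \<le> f y"
    using continuous_attains_inf[of "{a..b}" f] z continuous_on_subset[OF f] by auto
  have "f x \<le> f y" for y
    using x z out[of y] by (cases "y \<in> {a..b}") (auto simp: not_le intro: order_trans[of _ "f z"] less_imp_le)
  then show ?thesis by blast
qed

locale inventory_costs = demand_distribution M for M :: "real measure" +
  fixes g :: "real \<Rightarrow> real" and c K :: real
  assumes g_continuous: "continuous_on UNIV g"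
    and g_nonneg: "\<And>x. 0 \<le> g x"
    and g_coercive: "filterlim g at_top at_infinity"
    and c_pos: "0 < c" and K_pos: "0 < K"
begin

definition mean :: real where
  "mean = (\<integral>d. d \<partial>M)"

definition f :: "real \<Rightarrow> real \<Rightarrow> real" where
  "f \<alpha> y = g y + (1 - \<alpha>) * c * y"

text \<open>Freezing the level at s encodes the stopping: demand is nonnegative, so a level that has
  fallen to s or below stays there and contributes nothing more. The truncation is also continuous
  across s.\<close>

definition excess :: "real \<Rightarrow> real \<Rightarrow> real \<Rightarrow> real" where
  "excess \<alpha> s y = f \<alpha> (max y s) - f \<alpha> s"

definition J :: "real \<Rightarrow> real \<Rightarrow> real \<Rightarrow> real" where
  "J \<alpha> s = renewal \<alpha> (excess \<alpha> s)"

text \<open>Up to an additive constant, \<open>W\<close> is the paper's $G_\alpha$ for \<open>\<alpha> < 1\<close> and its $H$ for \<open>\<alpha> = 1\<close>.\<close>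

definition W :: "real \<Rightarrow> real \<Rightarrow> real \<Rightarrow> real" where
  "W \<alpha> s y = f \<alpha> y - f \<alpha> s + \<alpha> * post (J \<alpha> s) y"

text \<open>The mode is an explicit argument because minimizers of \<open>f \<alpha>\<close> may
  form an interval, while the arguments below refer to positions left or right of one chosen
  minimizer.\<close>

definition unimodal :: "real \<Rightarrow> real \<Rightarrow> bool" where
  "unimodal \<alpha> x0 \<longleftrightarrow>
     (\<forall>y z. y \<le> z \<longrightarrow> z \<le> x0 \<longrightarrow> f \<alpha> z \<le> f \<alpha> y) \<and>
     (\<forall>y z. x0 \<le> y \<longrightarrow> y \<le> z \<longrightarrow> f \<alpha> y \<le> f \<alpha> z)"

text \<open>The indifference condition: descending from S saves exactly the K that an order costs,
  and no other level saves more. Keeping s left of a mode puts it on the branch where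
  \<open>f \<alpha>\<close> is nonincreasing.\<close>

definition critical :: "real \<Rightarrow> real \<Rightarrow> real \<Rightarrow> bool" where
  "critical \<alpha> s S \<longleftrightarrow>
     (\<exists>x0. unimodal \<alpha> x0 \<and> s \<le> x0) \<and> (\<forall>y. - K \<le> J \<alpha> s y) \<and> J \<alpha> s S = - K"

section \<open>Elementary properties, continuity and monotonicity of the excess costs\<close>

lemma mean_nonneg: "0 \<le> mean"
  unfolding mean_def using demand_nonneg by (rule integral_nonneg_AE)

lemma integrable_affine: "integrable M (\<lambda>d. p * (y - d) + q)"
  using integrable_demand by auto

lemma post_affine: "post (\<lambda>z. p * z + q) y = p * (y - mean) + q"
  unfolding post_def mean_def using integrable_demand
  by (simp add: prob_space[simplified] right_diff_distrib)

lemma f_continuous: "continuous_on UNIV (f \<alpha>)"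
  unfolding f_def by (intro continuous_intros g_continuous)

lemma excess_vanishing: "y \<le> s \<Longrightarrow> excess \<alpha> s y = 0"
  by (simp add: excess_def max_def)

lemma excess_continuous: "continuous_on UNIV (excess \<alpha> s)"
  unfolding excess_def
  by (intro continuous_intros continuous_on_compose2[OF f_continuous]) auto

lemma excess_above: "s \<le> y \<Longrightarrow> excess \<alpha> s y = f \<alpha> y - f \<alpha> s"
  by (simp add: excess_def max_def)

text \<open>The linear term (1 - \<alpha>) * c * y is nondecreasing, so dropping it leaves a lower
  bound that is free of \<alpha>.\<close>

lemma excess_lower:
  assumes "\<alpha> \<le> 1" shows "g (max y s) - g s \<le> excess \<alpha> s y"
proof -
  have "0 \<le> (1 - \<alpha>) * c * (max y s - s)"
    using assms c_pos by simp
  then show ?thesis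
    by (simp add: excess_def f_def algebra_simps)
qed

lemma J_vanishing: "y \<le> s \<Longrightarrow> J \<alpha> s y = 0"
  unfolding J_def by (rule renewal_vanishing[of s]) (auto simp: excess_vanishing)

lemma J_continuous: "0 \<le> \<alpha> \<Longrightarrow> \<alpha> \<le> 1 \<Longrightarrow> continuous_on UNIV (J \<alpha> s)"
  unfolding J_def by (rule renewal_continuous[OF excess_continuous, of s]) (auto simp: excess_vanishing)

lemma J_integrable: "0 \<le> \<alpha> \<Longrightarrow> \<alpha> \<le> 1 \<Longrightarrow> integrable M (\<lambda>d. J \<alpha> s (y - d))"
  by (rule integrable_vanishing[OF J_continuous, of \<alpha> s]) (auto simp: J_vanishing)

lemma J_equation:
  "0 \<le> \<alpha> \<Longrightarrow> \<alpha> \<le> 1 \<Longrightarrow> J \<alpha> s y = excess \<alpha> s y + \<alpha> * post (J \<alpha> s) y"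
  unfolding J_def by (rule renewal_equation[OF excess_continuous, of s]) (auto simp: excess_vanishing)

lemma post_J_continuous: "0 \<le> \<alpha> \<Longrightarrow> \<alpha> \<le> 1 \<Longrightarrow> continuous_on UNIV (post (J \<alpha> s))"
  by (rule post_continuous[OF J_continuous, of \<alpha> s]) (auto simp: J_vanishing)

lemma post_J_vanishing: "y \<le> s \<Longrightarrow> post (J \<alpha> s) y = 0"
  by (rule post_vanishing[of s]) (auto simp: J_vanishing)

text \<open>Discount factor and threshold together form the parameter of the family. The endpoint a
  is the common level below which all excesses with s \<ge> a vanish.\<close>

lemma J_jointly_continuous:
  assumes P: "P = {0..1::real} \<times> {a..b}"
  shows "continuous_on (P \<times> UNIV) (\<lambda>(p, y). J (fst p) (snd p) y)"
proof -
  have f: "continuous_on (P \<times> UNIV) (\<lambda>(p, y). excess (fst p) (snd p) y)"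
    unfolding excess_def f_def split_beta
    by (intro continuous_intros continuous_on_compose2[OF g_continuous]) auto
  show ?thesis
    unfolding J_def
    by (rule renewal_continuous_family[OF _ f, of a fst])
      (auto simp: P excess_vanishing intro!: compact_Times continuous_intros)
qed

text \<open>Joint continuity on a compact set is uniform. The uniformity is what allows minima over
  compact sets of levels to pass to the limit.\<close>

lemma J_uniform_limit:
  assumes Y: "compact Y" and \<beta>: "(\<beta> \<longlongrightarrow> \<alpha>) F" "eventually (\<lambda>i. 0 \<le> \<beta> i \<and> \<beta> i \<le> 1) F"
    and \<alpha>: "0 \<le> \<alpha>" "\<alpha> \<le> 1" and \<sigma>: "(\<sigma> \<longlongrightarrow> s) F"
  shows "uniform_limit Y (\<lambda>i. J (\<beta> i) (\<sigma> i)) (J \<alpha> s) F"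
proof (rule uniform_limitI)
  fix e :: real assume e: "0 < e"
  define P where "P = {0..1::real} \<times> {s - 1..s + 1}"
  have "uniformly_continuous_on (P \<times> Y) (\<lambda>(p, y). J (fst p) (snd p) y)"
    using Y by (intro compact_uniformly_continuous continuous_on_subset[OF J_jointly_continuous[OF P_def]])
      (auto simp: P_def intro!: compact_Times)
  from this[unfolded uniformly_continuous_on_def, rule_format, OF e]
  obtain d where d: "0 < d" "\<And>x x'. x \<in> P \<times> Y \<Longrightarrow> x' \<in> P \<times> Y \<Longrightarrow> dist x' x < d \<Longrightarrow>
      dist ((\<lambda>(p, y). J (fst p) (snd p) y) x') ((\<lambda>(p, y). J (fst p) (snd p) y) x) < e"
    by blast
  have "eventually (\<lambda>i. s - 1 < \<sigma> i \<and> \<sigma> i < s + 1) F"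
    using order_tendstoD[OF \<sigma>] by (simp add: eventually_conj)
  moreover have "eventually (\<lambda>i. dist (\<beta> i, \<sigma> i) (\<alpha>, s) < d) F"
    using d(1) by (intro tendstoD tendsto_Pair \<beta> \<sigma>)
  ultimately show "eventually (\<lambda>i. \<forall>y\<in>Y. dist (J (\<beta> i) (\<sigma> i) y) (J \<alpha> s y) < e) F"
    using \<beta>(2)
  proof eventually_elim
    case (elim i)
    show ?case
    proof
      fix y assume "y \<in> Y"
      then have "((\<alpha>, s), y) \<in> P \<times> Y" "((\<beta> i, \<sigma> i), y) \<in> P \<times> Y"
        using elim \<alpha> by (auto simp: P_def)
      moreover have "dist ((\<beta> i, \<sigma> i), y) ((\<alpha>, s), y) < d"
        using elim(2) by (simp add: dist_prod_def)
      ultimately show "dist (J (\<beta> i) (\<sigma> i) y) (J \<alpha> s y) < e"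
        using d(2)[of "((\<alpha>, s), y)" "((\<beta> i, \<sigma> i), y)"] by simp
    qed
  qed
qed

lemma J_tendsto:
  assumes \<beta>: "(\<beta> \<longlongrightarrow> \<alpha>) F" "eventually (\<lambda>i. 0 \<le> \<beta> i \<and> \<beta> i \<le> 1) F" "0 \<le> \<alpha>" "\<alpha> \<le> 1"
    and \<sigma>: "(\<sigma> \<longlongrightarrow> s) F" and \<eta>: "(\<eta> \<longlongrightarrow> y) F"
  shows "((\<lambda>i. J (\<beta> i) (\<sigma> i) (\<eta> i)) \<longlongrightarrow> J \<alpha> s y) F"
proof -
  define P where "P = {0..1::real} \<times> {s - 1..s + 1}"
  have \<sigma>': "eventually (\<lambda>i. s - 1 < \<sigma> i \<and> \<sigma> i < s + 1) F"
    using order_tendstoD[OF \<sigma>] by (simp add: eventually_conj)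
  have "((\<lambda>i. (\<lambda>(p, y). J (fst p) (snd p) y) ((\<beta> i, \<sigma> i), \<eta> i)) \<longlongrightarrow>
      (\<lambda>(p, y). J (fst p) (snd p) y) ((\<alpha>, s), y)) F"
  proof (rule continuous_on_tendsto_compose[OF J_jointly_continuous[OF P_def]])
    show "\<forall>\<^sub>F i in F. ((\<beta> i, \<sigma> i), \<eta> i) \<in> P \<times> UNIV"
      using \<beta>(2) \<sigma>' by eventually_elim (auto simp: P_def)
  qed (use assms in \<open>auto simp: P_def intro!: tendsto_intros\<close>)
  then show ?thesis by simp
qed

text \<open>Raising the threshold removes nonpositive excesses between s and s' and raises those
  above s' by the constant f s - f s' \<ge> 0. In the second claim that constant is collected in the
  first period; the later periods are compared by the first claim.\<close>

lemma J_mono_threshold: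
  assumes \<alpha>: "0 \<le> \<alpha>" "\<alpha> \<le> 1" and s: "s \<le> s'"
    and f: "\<And>z. s \<le> z \<Longrightarrow> z \<le> s' \<Longrightarrow> f \<alpha> z \<le> f \<alpha> s \<and> f \<alpha> s' \<le> f \<alpha> z"
  shows "J \<alpha> s y \<le> J \<alpha> s' y"
    and "s' \<le> y \<Longrightarrow> J \<alpha> s y + (f \<alpha> s - f \<alpha> s') \<le> J \<alpha> s' y"
proof -
  have phi: "excess \<alpha> s y \<le> excess \<alpha> s' y" for y
    using s f[of "max y s"] f[of s] by (auto simp: excess_def max_def split: if_splits)
  have le: "J \<alpha> s y \<le> J \<alpha> s' y" for y
  proof -
    \<comment> \<open>This is \<open>comparison\<close> with \<epsilon> = 0, whose right-hand side
      is simply 0. The same form recurs below.\<close>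
    have "J \<alpha> s y - J \<alpha> s' y \<le> 0 / (1 - \<rho>) * exp (y - s)"
    proof (rule comparison[where \<alpha> = \<alpha> and B = y])
      fix z
      have "post (\<lambda>y. J \<alpha> s y - J \<alpha> s' y) z = post (J \<alpha> s) z - post (J \<alpha> s') z"
        using J_integrable[OF \<alpha>] by (simp add: post_def)
      then show "J \<alpha> s z - J \<alpha> s' z \<le> 0 + \<alpha> * post (\<lambda>y. J \<alpha> s y - J \<alpha> s' y) z"
        using phi[of z] J_equation[OF \<alpha>, of s z] J_equation[OF \<alpha>, of s' z]
        by (simp add: right_diff_distrib)
    qed (use \<alpha> s in \<open>auto simp: J_vanishing intro!: continuous_intros J_continuous J_integrable\<close>)
    then show ?thesis by simp
  qed
  show "J \<alpha> s y \<le> J \<alpha> s' y" by (rule le)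
  assume y: "s' \<le> y"
  have "post (J \<alpha> s) y \<le> post (J \<alpha> s') y"
    using le by (intro post_mono J_integrable \<alpha>)
  then have "\<alpha> * post (J \<alpha> s) y \<le> \<alpha> * post (J \<alpha> s') y"
    using \<alpha> by (intro mult_left_mono)
  then show "J \<alpha> s y + (f \<alpha> s - f \<alpha> s') \<le> J \<alpha> s' y"
    using J_equation[OF \<alpha>, of s y] J_equation[OF \<alpha>, of s' y] y s by (simp add: excess_above)
qed

text \<open>From y \<le> b the level never rises above b, so all later excesses are nonpositive;
  dropping them leaves the first one.\<close>

lemma J_le_excess:
  assumes \<alpha>: "0 \<le> \<alpha>" "\<alpha> \<le> 1" and b: "\<And>z. z \<le> b \<Longrightarrow> excess \<alpha> s z \<le> 0" and y: "y \<le> b"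
  shows "J \<alpha> s y \<le> excess \<alpha> s y"
proof -
  have le: "J \<alpha> s y \<le> 0" if "y \<le> b" for y
  proof -
    have "J \<alpha> s y \<le> 0 / (1 - \<rho>) * exp (y - s)"
    proof (rule comparison[where \<alpha> = \<alpha> and B = y])
      fix z assume "z \<le> y"
      then show "J \<alpha> s z \<le> 0 + \<alpha> * post (J \<alpha> s) z"
        using J_equation[OF \<alpha>, of s z] b[of z] that by simp
    qed (use \<alpha> in \<open>auto simp: J_vanishing intro!: J_continuous J_integrable\<close>)
    then show ?thesis by simp
  qed
  have "post (J \<alpha> s) y \<le> post (\<lambda>_. 0) y"
    using le y by (intro post_mono J_integrable \<alpha>) auto
  then have "\<alpha> * post (J \<alpha> s) y \<le> 0"
    using \<alpha> by (simp add: post_def mult_nonneg_nonpos)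
  then show ?thesis
    using J_equation[OF \<alpha>, of s y] by simp
qed

section \<open>Bounds uniform in the discount factor and the threshold\<close>

lemma g_eventually_ge: "\<exists>b\<ge>b0. \<forall>y\<ge>b. R \<le> g y"
proof -
  have "filterlim g at_top at_top"
    using g_coercive by (rule filterlim_mono) (auto simp: at_top_le_at_infinity)
  then have "eventually (\<lambda>y. R \<le> g y) at_top"
    by (simp add: filterlim_at_top)
  then obtain b where "\<forall>y\<ge>b. R \<le> g y"
    by (auto simp: eventually_at_top_linorder)
  then show ?thesis
    by (intro exI[of _ "max b b0"]) auto
qed

text \<open>An excess is never below -A and is negative only below b. Starts below b lose at most L
  by the weighted bound; starts above b first collect nonnegative excesses and then enter the region
  below b.\<close>

lemma J_lower_bound:
  obtains L where "0 \<le> L"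
    "\<And>\<alpha> s y. 0 \<le> \<alpha> \<Longrightarrow> \<alpha> \<le> 1 \<Longrightarrow> a1 \<le> s \<Longrightarrow> s \<le> a2 \<Longrightarrow> - L \<le> J \<alpha> s y"
proof -
  have "compact (g ` {a1..a2})"
    by (intro compact_continuous_image continuous_on_subset[OF g_continuous]) auto
  then obtain A0 where A0: "\<forall>z\<in>g ` {a1..a2}. \<bar>z\<bar> \<le> A0"
    using compact_imp_bounded bounded_real by blast
  define A where "A = max A0 0"
  have A: "0 \<le> A" "\<And>s. a1 \<le> s \<Longrightarrow> s \<le> a2 \<Longrightarrow> g s \<le> A"
    using A0 by (force simp: A_def)+
  obtain b where b: "max a1 a2 \<le> b" "\<And>y. b \<le> y \<Longrightarrow> A \<le> g y"
    using g_eventually_ge by metis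
  \<comment> \<open>The value at b of the bound that \<open>comparison\<close> gives with \<epsilon>
    = A.\<close>
  define L where "L = A / (1 - \<rho>) * exp (b - a1)"
  have L: "0 \<le> L"
    using A(1) rho_less_1 by (simp add: L_def)
  show thesis
  proof (rule that[OF L])
    fix \<alpha> s y :: real assume \<alpha>: "0 \<le> \<alpha>" "\<alpha> \<le> 1" and s: "a1 \<le> s" "s \<le> a2"
    define F where "F y = - J \<alpha> s y" for y
    have contF: "continuous_on UNIV F"
      unfolding F_def by (intro continuous_intros J_continuous \<alpha>)
    have intF: "integrable M (\<lambda>d. F (y - d))" for y
      unfolding F_def using J_integrable[OF \<alpha>] by simp
    have postF: "post F y = - post (J \<alpha> s) y" for y
      by (simp add: F_def post_def)
    have F_eq: "F y = - excess \<alpha> s y + \<alpha> * post F y" for y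
      unfolding postF unfolding F_def using J_equation[OF \<alpha>, of s y] by simp
    have phi: "- excess \<alpha> s y \<le> A" for y
      using excess_lower[OF \<alpha>(2), of y s] A(2)[OF s] g_nonneg[of "max y s"] by linarith
    have phi': "0 \<le> excess \<alpha> s y" if "b \<le> y" for y
    proof -
      have "max y s = y" using that s b(1) by auto
      then show ?thesis
        using excess_lower[OF \<alpha>(2), of y s] A(2)[OF s] b(2)[OF that] by simp
    qed
    have low: "F z \<le> L" if "z \<le> b" for z
    proof -
      have "F z \<le> A / (1 - \<rho>) * exp (z - a1)"
      proof (rule comparison[OF contF intF \<alpha> A(1), where B = z])
        show "F y \<le> 0" if "y \<le> a1" for y
          using that s by (simp add: F_def J_vanishing)
        show "F y \<le> A + \<alpha> * post F y" for y
          using phi[of y] F_eq[of y] by linarith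
      qed simp
      also have "\<dots> \<le> L"
        unfolding L_def using that A(1) rho_less_1 by (intro mult_left_mono) auto
      finally show ?thesis .
    qed
    \<comment> \<open>Second use of the maximum principle, now above b: the excess is nonnegative
      there, and discounting can only shrink the constant L.\<close>
    have "F y - L \<le> 0 / (1 - \<rho>) * exp (y - b)"
    proof (rule comparison[where \<alpha> = \<alpha> and B = y])
      fix z assume z: "b < z"
      have "post (\<lambda>y. F y - L) z = post F z - L"
        using intF by (simp add: post_def prob_space[simplified])
      moreover have "\<alpha> * L \<le> 1 * L"
        using \<alpha> L by (intro mult_right_mono)
      ultimately show "F z - L \<le> 0 + \<alpha> * post (\<lambda>y. F y - L) z"
        using F_eq[of z] phi'[of z] z by (simp add: right_diff_distrib)
    qed (use \<alpha> low intF in \<open>auto intro!: continuous_intros contF\<close>)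
    then show "- L \<le> J \<alpha> s y"
      by (simp add: F_def)
  qed
qed

text \<open>The sum of the excess costs over the descent from \<open>y\<close> takes about \<open>y / mean\<close> steps of
  unbounded cost, so it dominates every linear function; the slope \<open>c\<close> is the one needed.\<close>

lemma J_coercive:
  obtains B where "0 \<le> B"
    "\<And>\<alpha> s y. 0 \<le> \<alpha> \<Longrightarrow> \<alpha> \<le> 1 \<Longrightarrow> a1 \<le> s \<Longrightarrow> s \<le> a2 \<Longrightarrow> B \<le> y \<Longrightarrow> R \<le> J \<alpha> s y - c * y"
proof -
  obtain L where L: "0 \<le> L"
    "\<And>\<alpha> s y. 0 \<le> \<alpha> \<Longrightarrow> \<alpha> \<le> 1 \<Longrightarrow> a1 \<le> s \<Longrightarrow> s \<le> a2 \<Longrightarrow> - L \<le> J \<alpha> s y"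
    using J_lower_bound by metis
  have "compact (g ` {a1..a2})"
    by (intro compact_continuous_image continuous_on_subset[OF g_continuous]) auto
  then obtain A where A: "\<And>s. a1 \<le> s \<Longrightarrow> s \<le> a2 \<Longrightarrow> g s \<le> A"
    using compact_imp_bounded bounded_real by (metis abs_le_D1 atLeastAtMost_iff image_eqI)
  \<comment> \<open>Above b the excess of one period is at least c * mean, which pays for the mean
    decrease of c * y in that period.\<close>
  obtain b where b: "max 0 a2 \<le> b" "\<And>y. b \<le> y \<Longrightarrow> A + c * mean \<le> g y"
    using g_eventually_ge by metis
  \<comment> \<open>C collects the losses of the final estimate: A for f at s, c * b for the slope
    taken from b, and the constants of the linear minorant after one demand.\<close>
  define C where "C = A + c * b + c * (mean + b) + L"
  obtain B where B: "b \<le> B" "\<And>y. B \<le> y \<Longrightarrow> R + C \<le> g y"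
    using g_eventually_ge by metis
  show thesis
  proof (rule that[of B])
    show "0 \<le> B" using b B by simp
    fix \<alpha> s y :: real assume \<alpha>: "0 \<le> \<alpha>" "\<alpha> \<le> 1" and s: "a1 \<le> s" "s \<le> a2" and y: "B \<le> y"
    have phi: "g y - A + (1 - \<alpha>) * c * (y - b) \<le> excess \<alpha> s y" if "b \<le> y" for y
    proof -
      have "(1 - \<alpha>) * c * (y - b) \<le> (1 - \<alpha>) * c * (y - s)"
        using \<alpha> c_pos s b by (intro mult_left_mono) auto
      then show ?thesis
        using A[OF s] that s b by (simp add: excess_above f_def algebra_simps)
    qed
    \<comment> \<open>The difference between a linear minorant of slope c and J. Its constant makes
      it at most -L for y \<le> b, where only the lower bound on J is available.\<close>
    define F where "F y = c * y + (- c * b - L) - J \<alpha> s y" for y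
    have intF: "integrable M (\<lambda>d. F (y - d))" for y
      unfolding F_def using integrable_affine[of c y "- c * b - L"] J_integrable[OF \<alpha>] by simp
    have postF: "post F y = c * (y - mean) + (- c * b - L) - post (J \<alpha> s) y" for y
      using integrable_affine[of c y "- c * b - L"] J_integrable[OF \<alpha>, of s y]
        post_affine[of c "- c * b - L" y]
      by (simp add: F_def post_def)
    have F_le: "F z \<le> 0" for z
    proof -
      have "F z \<le> 0 / (1 - \<rho>) * exp (z - b)"
      proof (rule comparison[where \<alpha> = \<alpha> and B = z])
        fix y assume "y \<le> b"
        then have "c * y \<le> c * b" using c_pos by simp
        then show "F y \<le> 0"
          using L(2)[OF \<alpha> s, of y] by (simp add: F_def)
      next
        fix y assume "b < y"
        then have y: "b \<le> y" by simp
        have "\<alpha> * (c * mean) \<le> 1 * (c * mean)"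
          using \<alpha> c_pos mean_nonneg by (intro mult_right_mono) auto
        moreover have "\<alpha> * L \<le> 1 * L"
          using \<alpha> L by (intro mult_right_mono)
        moreover have "F y = c * y + (- c * b - L) - excess \<alpha> s y - \<alpha> * post (J \<alpha> s) y"
          unfolding F_def using J_equation[OF \<alpha>, of s y] by simp
        ultimately show "F y \<le> 0 + \<alpha> * post F y"
          unfolding postF using phi[OF y] b(2)[OF y] by (simp add: algebra_simps)
      qed (use \<alpha> intF in \<open>auto simp: F_def intro!: continuous_intros J_continuous\<close>)
      then show ?thesis by simp
    qed
    \<comment> \<open>The minorant is applied only from the second period on. Its slope \<alpha> * c
      and the slope (1 - \<alpha>) * c of the first excess add up to c, which leaves the unbounded g
      y to exceed R + C.\<close>
    have "post (\<lambda>z. c * z + (- c * b - L)) y \<le> post (J \<alpha> s) y"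
      using F_le integrable_affine[of c y "- c * b - L"]
      by (intro post_mono J_integrable[OF \<alpha>]) (auto simp: F_def)
    then have "\<alpha> * (c * (y - mean) + (- c * b - L)) \<le> \<alpha> * post (J \<alpha> s) y"
      unfolding post_affine using \<alpha> by (intro mult_left_mono)
    moreover have "\<alpha> * (c * mean + c * b + L) \<le> 1 * (c * mean + c * b + L)"
      using \<alpha> c_pos mean_nonneg b L by (intro mult_right_mono) auto
    moreover have "(1 - \<alpha>) * (c * b) \<le> 1 * (c * b)"
      using \<alpha> c_pos b by (intro mult_right_mono) auto
    moreover have "b \<le> y" using B y by simp
    ultimately show "R \<le> J \<alpha> s y - c * y"
      using J_equation[OF \<alpha>, of s y] phi[of y] B(2)[OF y] unfolding C_def
      by (simp add: algebra_simps)
  qed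
qed

section \<open>Existence of critical thresholds\<close>

lemma J_nonneg:
  assumes \<alpha>: "0 \<le> \<alpha>" "\<alpha> \<le> 1" and phi: "\<And>z. 0 \<le> excess \<alpha> s z"
  shows "0 \<le> J \<alpha> s y"
proof -
  have "- J \<alpha> s y \<le> 0 / (1 - \<rho>) * exp (y - s)"
  proof (rule comparison[where \<alpha> = \<alpha> and B = y])
    fix z
    have "post (\<lambda>y. - J \<alpha> s y) z = - post (J \<alpha> s) z"
      by (simp add: post_def)
    then show "- J \<alpha> s z \<le> 0 + \<alpha> * post (\<lambda>y. - J \<alpha> s y) z"
      using J_equation[OF \<alpha>, of s z] phi[of z] by simp
  qed (use \<alpha> J_integrable[OF \<alpha>] in \<open>auto simp: J_vanishing intro!: continuous_intros J_continuous\<close>)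
  then show ?thesis by simp
qed

lemma J_below_mode:
  assumes \<alpha>: "0 \<le> \<alpha>" "\<alpha> \<le> 1" and "unimodal \<alpha> x0" "s \<le> x0" "y \<le> x0"
  shows "J \<alpha> s y \<le> excess \<alpha> s y" "excess \<alpha> s y \<le> 0"
proof -
  have *: "excess \<alpha> s z \<le> 0" if "z \<le> x0" for z
    using assms(3,4) that by (auto simp: excess_def unimodal_def max_def)
  show "J \<alpha> s y \<le> excess \<alpha> s y" "excess \<alpha> s y \<le> 0"
    using J_le_excess[OF \<alpha> *] * assms(5) by auto
qed

lemma J_mono_below_mode:
  assumes "0 \<le> \<alpha>" "\<alpha> \<le> 1" "unimodal \<alpha> x0" "s \<le> s'" "s' \<le> x0"
  shows "J \<alpha> s y \<le> J \<alpha> s' y"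
  using assms by (intro J_mono_threshold) (auto simp: unimodal_def)

text \<open>J vanishes up to s and is at least c * y \<ge> 0 from B on. With B uniform in the
  parameters, this confinement is the source of compactness for sequences of minimizers.\<close>

lemma J_attains_minus_K_bounds:
  assumes B: "\<And>y. B \<le> y \<Longrightarrow> 0 \<le> J \<alpha> s y - c * y" "0 \<le> B" and J: "J \<alpha> s y \<le> - K"
  shows "s < y" "y < B"
proof -
  show "s < y"
    using J_vanishing[of y s \<alpha>] J K_pos by (cases "y \<le> s") auto
  show "y < B"
  proof (rule ccontr)
    assume "\<not> y < B"
    then have "0 \<le> J \<alpha> s y - c * y" "0 \<le> c * y"
      using B c_pos by auto
    with J K_pos show False by linarith
  qed
qed

text \<open>The thresholds at which J reaches -K form a set closed downward and bounded by the mode.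
  Its supremum is critical: approximation from below gives a point with J \<le> -K, approximation
  from above gives J \<ge> -K.\<close>

lemma critical_exists:
  assumes \<alpha>: "0 \<le> \<alpha>" "\<alpha> \<le> 1" and uni: "unimodal \<alpha> x0"
    and far: "a \<le> x0" "K + f \<alpha> x0 \<le> f \<alpha> a"
  shows "\<exists>s S. critical \<alpha> s S"
proof -
  define T where "T = {s. s \<le> x0 \<and> (\<exists>y. J \<alpha> s y \<le> - K)}"
  \<comment> \<open>Descending from the mode with threshold a saves at least f a - f x0 in the first
    period alone, and this is at least K.\<close>
  have "J \<alpha> a x0 \<le> - K"
    using J_below_mode(1)[OF \<alpha> uni far(1), of x0] far by (simp add: excess_above)
  then have aT: "a \<in> T"
    using far by (auto simp: T_def)
  have bdd: "bdd_above T"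
    by (auto simp: T_def bdd_above_def)
  have down: "s \<in> T" if "t \<in> T" "s \<le> t" for s t
    using that J_mono_below_mode[OF \<alpha> uni that(2)] unfolding T_def
    by (auto intro: order_trans)
  define s0 where "s0 = Sup T"
  have s0: "s0 \<le> x0"
    unfolding s0_def using aT by (intro cSup_least) (auto simp: T_def)
  define t where "t n = s0 - inverse (real (Suc n))" for n
  have t_lim: "t \<longlonglongrightarrow> s0"
    unfolding t_def using tendsto_diff[OF tendsto_const LIMSEQ_inverse_real_of_nat] by simp
  have t_bounds: "s0 - 1 \<le> t n" "t n \<le> s0" for n
    by (auto simp: t_def field_simps)
  have "t n \<in> T" for n
  proof -
    have "t n < Sup T"
      unfolding s0_def[symmetric] by (simp add: t_def)
    then obtain u where "u \<in> T" "t n < u"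
      using less_cSup_iff[OF _ bdd] aT by auto
    then show ?thesis
      using down by auto
  qed
  then have "\<forall>n. \<exists>y. J \<alpha> (t n) y \<le> - K"
    by (auto simp: T_def)
  then obtain y where y: "\<And>n. J \<alpha> (t n) (y n) \<le> - K"
    by metis
  \<comment> \<open>One B for all thresholds in [s0 - 1, s0], so that the points y n lie in a fixed
    compact interval.\<close>
  obtain B where B: "0 \<le> B"
    "\<And>\<alpha> s y. 0 \<le> \<alpha> \<Longrightarrow> \<alpha> \<le> 1 \<Longrightarrow> s0 - 1 \<le> s \<Longrightarrow> s \<le> s0 \<Longrightarrow> B \<le> y \<Longrightarrow> 0 \<le> J \<alpha> s y - c * y"
    using J_coercive[of "s0 - 1" s0 0] by blast
  have y_in: "y n \<in> {s0 - 1..B}" for n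
  proof -
    have "t n < y n" "y n < B"
      using B(2)[OF \<alpha> t_bounds(1,2)[of n]] B(1) y[of n]
      by (blast intro: J_attains_minus_K_bounds)+
    then show ?thesis
      using t_bounds(1)[of n] by simp
  qed
  obtain S r where r: "strict_mono r" "(y \<circ> r) \<longlonglongrightarrow> S"
    using compact_imp_seq_compact[OF compact_Icc] y_in by (metis seq_compactE)
  have "(\<lambda>n. J \<alpha> (t (r n)) (y (r n))) \<longlonglongrightarrow> J \<alpha> s0 S"
    using LIMSEQ_subseq_LIMSEQ[OF t_lim r(1)] r(2) \<alpha>
    by (intro J_tendsto) (auto simp: comp_def)
  then have upper: "J \<alpha> s0 S \<le> - K"
    using y by (intro LIMSEQ_le_const2) auto
  \<comment> \<open>If s0 < x0, thresholds decreasing to s0 lie outside T. If s0 = x0 there are none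
    left of the mode, but then \<open>f \<alpha>\<close> is minimal at s0 and J is
    nonnegative.\<close>
  have lower: "- K \<le> J \<alpha> s0 z" for z
  proof (cases "s0 = x0")
    case True
    have "0 \<le> J \<alpha> s0 z"
      using uni True by (intro J_nonneg[OF \<alpha>]) (auto simp: excess_def unimodal_def)
    then show ?thesis using K_pos by simp
  next
    case False
    define q where "q n = s0 + (x0 - s0) * inverse (real (Suc n))" for n
    have "q \<longlonglongrightarrow> s0 + (x0 - s0) * 0"
      unfolding q_def by (intro tendsto_intros LIMSEQ_inverse_real_of_nat)
    then have "(\<lambda>n. J \<alpha> (q n) z) \<longlonglongrightarrow> J \<alpha> s0 z"
      using \<alpha> by (intro J_tendsto) auto
    moreover have "- K \<le> J \<alpha> (q n) z" for n
    proof -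
      have "s0 < q n"
        using False s0 by (simp add: q_def)
      then have "q n \<notin> T"
        using cSup_upper[OF _ bdd] s0_def by force
      moreover have "q n \<le> x0"
      proof -
        have "(x0 - s0) * inverse (real (Suc n)) \<le> (x0 - s0) * 1"
          using s0 by (intro mult_left_mono) (auto simp: field_simps)
        then show ?thesis by (simp add: q_def)
      qed
      ultimately show ?thesis
        unfolding T_def by (auto simp: not_le intro: less_imp_le)
    qed
    ultimately show ?thesis
      by (intro LIMSEQ_le_const) auto
  qed
  have "critical \<alpha> s0 S"
    unfolding critical_def using uni s0 lower upper by (auto intro: antisym)
  then show ?thesis by blast
qed

text \<open>Zheng's argument: above the mode, shifting the starting level up cannot decrease the
  excess costs until the lower path enters the region where \<open>J\<close> is nonpositive, and there
  the two values differ by at most \<open>K\<close>.\<close>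

lemma J_le_K_plus:
  assumes \<alpha>: "0 \<le> \<alpha>" "\<alpha> \<le> 1" and crit: "critical \<alpha> s S" and xy: "x \<le> y"
  shows "J \<alpha> s x \<le> K + J \<alpha> s y"
proof -
  obtain x0 where uni: "unimodal \<alpha> x0" and s: "s \<le> x0"
    using crit by (auto simp: critical_def)
  define \<delta> where "\<delta> = y - x"
  define F where "F z = J \<alpha> s z - J \<alpha> s (z + \<delta>) - K" for z
  have \<delta>: "0 \<le> \<delta>" using xy by (simp add: \<delta>_def)
  have int': "integrable M (\<lambda>d. J \<alpha> s (z - d + \<delta>))" for z
    using J_integrable[OF \<alpha>, of s "z + \<delta>"] by (simp add: algebra_simps)
  have "F x \<le> 0 / (1 - \<rho>) * exp (x - x0)"
  proof (rule comparison[where \<alpha> = \<alpha> and B = x])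
    show "continuous_on UNIV F"
      unfolding F_def
      by (intro continuous_intros J_continuous \<alpha> continuous_on_compose2[OF J_continuous[OF \<alpha>]]) auto
    show "integrable M (\<lambda>d. F (z - d))" for z
      unfolding F_def using int' J_integrable[OF \<alpha>] by simp
    \<comment> \<open>Below the mode the lower path has J \<le> 0 while the shifted one has J \<ge>
      -K; this is where criticality enters.\<close>
    show "F z \<le> 0" if "z \<le> x0" for z
    proof -
      have "- K \<le> J \<alpha> s (z + \<delta>)"
        using crit by (simp add: critical_def)
      then show ?thesis
        using J_below_mode[OF \<alpha> uni s that] by (simp add: F_def)
    qed
    fix z assume z: "x0 < z"
    have "post F z = (\<integral>d. J \<alpha> s (z - d) \<partial>M) - (\<integral>d. J \<alpha> s (z - d + \<delta>) \<partial>M) - K"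
      unfolding post_def F_def using int' J_integrable[OF \<alpha>] by (simp add: prob_space[simplified])
    also have "(\<integral>d. J \<alpha> s (z - d + \<delta>) \<partial>M) = post (J \<alpha> s) (z + \<delta>)"
      unfolding post_def by (simp add: algebra_simps)
    finally have postF: "post F z = post (J \<alpha> s) z - post (J \<alpha> s) (z + \<delta>) - K"
      by (simp add: post_def)
    have "excess \<alpha> s z \<le> excess \<alpha> s (z + \<delta>)"
      using uni z s \<delta> by (auto simp: excess_above unimodal_def)
    moreover have "\<alpha> * K \<le> 1 * K"
      using \<alpha> K_pos by (intro mult_right_mono) auto
    ultimately show "F z \<le> 0 + \<alpha> * post F z"
      unfolding postF F_def
      using J_equation[OF \<alpha>, of s z] J_equation[OF \<alpha>, of s "z + \<delta>"]
      by (simp add: right_diff_distrib)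
  qed (use \<alpha> in auto)
  then show ?thesis
    by (simp add: F_def \<delta>_def)
qed

section \<open>The optimality equation at a critical threshold\<close>

lemma W_above: "0 \<le> \<alpha> \<Longrightarrow> \<alpha> \<le> 1 \<Longrightarrow> s \<le> y \<Longrightarrow> W \<alpha> s y = J \<alpha> s y"
  using J_equation[of \<alpha> s y] by (simp add: W_def excess_above)

lemma W_below: "y \<le> s \<Longrightarrow> W \<alpha> s y = f \<alpha> y - f \<alpha> s"
  by (simp add: W_def post_J_vanishing)

lemma W_continuous: "0 \<le> \<alpha> \<Longrightarrow> \<alpha> \<le> 1 \<Longrightarrow> continuous_on UNIV (W \<alpha> s)"
  unfolding W_def by (intro continuous_intros f_continuous post_J_continuous)

lemma critical_less: "critical \<alpha> s S \<Longrightarrow> s < S"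
  using J_vanishing[of S s \<alpha>] K_pos by (cases "S \<le> s") (auto simp: critical_def)

lemma critical_f_ge: "critical \<alpha> s S \<Longrightarrow> y \<le> s \<Longrightarrow> f \<alpha> s \<le> f \<alpha> y"
  by (auto simp: critical_def unimodal_def)

lemma W_ge:
  assumes "0 \<le> \<alpha>" "\<alpha> \<le> 1" "critical \<alpha> s S"
  shows "- K \<le> W \<alpha> s y"
proof (cases "s \<le> y")
  case True
  then show ?thesis using assms by (simp add: W_above critical_def)
next
  case False
  then have "0 \<le> W \<alpha> s y"
    using W_below[of y s \<alpha>] critical_f_ge[OF assms(3), of y] by simp
  then show ?thesis using K_pos by simp
qed

lemma W_minimum:
  assumes "0 \<le> \<alpha>" "\<alpha> \<le> 1" "critical \<alpha> s S"
  shows "W \<alpha> s S = - K"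
  using assms critical_less[OF assms(3)] by (simp add: W_above critical_def)

text \<open>The inequality half of the optimality equation, for an order from x up to y. For y above
  s it is the estimate with K; below s, J is zero and W is nonnegative because
  \<open>f \<alpha>\<close> is nonincreasing there.\<close>

lemma J_le_W:
  assumes \<alpha>: "0 \<le> \<alpha>" "\<alpha> \<le> 1" and crit: "critical \<alpha> s S" and xy: "x \<le> y"
  shows "J \<alpha> s x \<le> K * of_bool (x < y) + W \<alpha> s y"
proof (cases "s \<le> y")
  case True
  then show ?thesis
    using J_le_K_plus[OF \<alpha> crit xy] xy \<alpha> by (auto simp: W_above)
next
  case False
  then show ?thesis
    using critical_f_ge[OF crit, of y] xy K_pos by (auto simp: W_below J_vanishing)
qed

text \<open>The equality half: below s an order costs K + W(S) = 0, which is the value of J there;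
  from s on, W and J agree.\<close>

lemma J_eq_W_policy:
  assumes \<alpha>: "0 \<le> \<alpha>" "\<alpha> \<le> 1" and crit: "critical \<alpha> s S"
  shows "J \<alpha> s x = K * of_bool (0 < sS_map s S x) + W \<alpha> s (x + sS_map s S x)"
  using critical_less[OF crit] W_minimum[OF assms] \<alpha>
  by (auto simp: sS_map_def J_vanishing W_above)

text \<open>Left of the mode, equal values of \<open>f \<alpha>\<close> force a flat piece between s
  and s'. Moving the threshold within it leaves the excess function, and hence J, unchanged; this
  describes the whole ambiguity of critical thresholds.\<close>

lemma critical_shift:
  assumes "0 \<le> \<alpha>" "\<alpha> \<le> 1" and crit: "critical \<alpha> s S" and uni: "unimodal \<alpha> x0" "s \<le> x0"
    and s': "s' \<le> x0" "f \<alpha> s' = f \<alpha> s" and S': "J \<alpha> s S' = - K"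
  shows "critical \<alpha> s' S'"
proof -
  have const: "f \<alpha> z = f \<alpha> s" if "min s s' \<le> z" "z \<le> max s s'" for z
  proof (rule antisym)
    show "f \<alpha> z \<le> f \<alpha> s"
    proof -
      have "f \<alpha> z \<le> f \<alpha> (min s s')"
        using uni s' that unfolding unimodal_def by (metis max.bounded_iff order_trans)
      then show ?thesis using s' by (auto simp: min_def split: if_splits)
    qed
    show "f \<alpha> s \<le> f \<alpha> z"
    proof -
      have "f \<alpha> (max s s') \<le> f \<alpha> z"
        using uni s' that unfolding unimodal_def by (metis max.bounded_iff)
      then show ?thesis using s' by (auto simp: max_def split: if_splits)
    qed
  qed
  have "excess \<alpha> s' = excess \<alpha> s"
  proof
    fix y
    show "excess \<alpha> s' y = excess \<alpha> s y"
      using const[of "max y s"] const[of "max y s'"] s'(2) unfolding excess_def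
      by (cases "y \<le> max s s'") (auto simp: max_def min_def split: if_splits)
  qed
  then have "J \<alpha> s' = J \<alpha> s"
    by (simp add: J_def)
  then show ?thesis
    using crit uni s' S' by (auto simp: critical_def)
qed

end

section \<open>Optimal thresholds and the discounted value function\<close>

lemma inf_compactI:
  assumes f: "continuous_on UNIV f" and "\<And>r. \<exists>a b. \<forall>x. f x \<le> r \<longrightarrow> a \<le> x \<and> x \<le> b"
  shows "inf_compact f"
  unfolding inf_compact_def
proof
  fix r
  obtain a b where "\<forall>x. f x \<le> r \<longrightarrow> a \<le> x \<and> x \<le> b"
    using assms(2) by blast
  then have "{x. f x \<le> r} \<subseteq> {a..b}" by auto
  moreover have "closed {x. f x \<le> r}"
    using f by (intro closed_Collect_le continuous_intros) auto
  ultimately show "compact {x. f x \<le> r}"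
    using compact_Int_closed[OF compact_Icc] by (metis inf.absorb_iff2)
qed

context inventory_costs
begin

text \<open>At the mode, J is at most the first excess and at least -K. Combined with the growth of
  \<open>f \<alpha>\<close> on the left by more than K, this bounds the order region's threshold
  from below.\<close>

lemma critical_f_le:
  assumes \<alpha>: "0 \<le> \<alpha>" "\<alpha> \<le> 1" and crit: "critical \<alpha> s S"
  shows "f \<alpha> s \<le> K + f \<alpha> z"
proof -
  obtain x0 where uni: "unimodal \<alpha> x0" and s: "s \<le> x0"
    using crit by (auto simp: critical_def)
  have "- K \<le> J \<alpha> s x0" using crit by (simp add: critical_def)
  then have "f \<alpha> s \<le> K + f \<alpha> x0"
    using J_below_mode(1)[OF \<alpha> uni s, of x0] s by (simp add: excess_above)
  moreover have "f \<alpha> x0 \<le> f \<alpha> z"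
    using uni unfolding unimodal_def by (cases "z \<le> x0") auto
  ultimately show ?thesis by simp
qed

lemma W_minimizer:
  assumes \<alpha>: "0 \<le> \<alpha>" "\<alpha> \<le> 1" and crit: "critical \<alpha> s S0" and S: "\<And>y. W \<alpha> s S \<le> W \<alpha> s y"
  shows "W \<alpha> s S = - K" "s \<le> S" "J \<alpha> s S = - K"
proof -
  show W: "W \<alpha> s S = - K"
    using S[of S0] W_minimum[OF \<alpha> crit] W_ge[OF \<alpha> crit, of S] by simp
  show "s \<le> S"
  proof (rule ccontr)
    assume "\<not> s \<le> S"
    then have "0 \<le> W \<alpha> s S"
      using critical_f_ge[OF crit, of S] by (simp add: W_below)
    with W K_pos show False by simp
  qed
  with W show "J \<alpha> s S = - K"
    using \<alpha> by (simp add: W_above)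
qed

text \<open>The converse of \<open>J_eq_W_policy\<close>: only critical pairs attain the minimum
  everywhere. The equation on the order region forces W(S') = -K and J = 0 up to s', and J can
  vanish there only if s' lies on the same flat piece of \<open>f \<alpha>\<close> as s.\<close>

lemma critical_of_policy:
  assumes \<alpha>: "0 \<le> \<alpha>" "\<alpha> \<le> 1" and crit: "critical \<alpha> s S" and s'S': "s' \<le> S'"
    and eq: "\<And>x. J \<alpha> s x = K * of_bool (0 < sS_map s' S' x) + W \<alpha> s (x + sS_map s' S' x)"
  shows "critical \<alpha> s' S'"
proof -
  obtain x0 where uni: "unimodal \<alpha> x0" and s: "s \<le> x0"
    using crit by (auto simp: critical_def)
  have order: "J \<alpha> s x = K + W \<alpha> s S'" if "x < s'" for x
    using eq[of x] that s'S' by (simp add: sS_map_def)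
  \<comment> \<open>A level at which the given policy orders and which also lies below s.\<close>
  have "J \<alpha> s (min s s' - 1) = 0"
    by (simp add: J_vanishing)
  then have W: "W \<alpha> s S' = - K"
    using order[of "min s s' - 1"] by simp
  then have S': "J \<alpha> s S' = - K"
    using W_minimizer[OF \<alpha> crit, of S'] W_ge[OF \<alpha> crit] by simp
  have zero: "J \<alpha> s x = 0" if "x < s'" for x
    using order[OF that] W by simp
  \<comment> \<open>At s' itself the policy does not order, so the value comes from the left by
    continuity.\<close>
  have Js': "J \<alpha> s s' = 0"
  proof -
    have "(J \<alpha> s \<longlongrightarrow> J \<alpha> s s') (at_left s')"
      using J_continuous[OF \<alpha>, of s] by (simp add: continuous_on_def) (metis tendsto_within_subset subset_UNIV)
    moreover have "eventually (\<lambda>x. J \<alpha> s x = 0) (at_left s')"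
      using zero by (auto simp: eventually_at_filter)
    then have "(J \<alpha> s \<longlongrightarrow> 0) (at_left s')"
      by (rule tendsto_eventually)
    ultimately show ?thesis
      by (intro tendsto_unique[OF trivial_limit_at_left_real])
  qed
  have "s' \<le> x0 \<and> f \<alpha> s' = f \<alpha> s"
  proof (cases "s' \<le> s")
    case True
    have "J \<alpha> s s' = W \<alpha> s s'"
      using eq[of s'] by (simp add: sS_map_def)
    then show ?thesis
      using True s Js' by (simp add: W_below)
  next
    case False
    \<comment> \<open>Capped at the mode so that J is at most the excess, which is nonpositive; J =
      0 then forces f z = f s. A threshold beyond the mode would make f s minimal and J nonnegative,
      contradicting J = -K at S.\<close>
    define z where "z = min s' x0"
    have "J \<alpha> s z = 0"
      using zero[of z] Js' by (cases "z < s'") (auto simp: z_def min_def split: if_splits)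
    then have fz: "f \<alpha> z = f \<alpha> s"
      using J_below_mode[OF \<alpha> uni s, of z] False s by (auto simp: excess_above z_def)
    moreover have "s' \<le> x0"
    proof (rule ccontr)
      assume "\<not> s' \<le> x0"
      with fz have "f \<alpha> x0 = f \<alpha> s" by (simp add: z_def)
      moreover have "f \<alpha> x0 \<le> f \<alpha> y" for y
        using uni unfolding unimodal_def by (cases "y \<le> x0") auto
      ultimately have "0 \<le> J \<alpha> s S"
        by (intro J_nonneg \<alpha>) (simp add: excess_def)
      then show False
        using crit K_pos by (simp add: critical_def)
    qed
    ultimately show ?thesis by (simp add: z_def)
  qed
  then show ?thesis
    using critical_shift[OF \<alpha> crit uni s _ _ S'] by blast
qed

text \<open>The infimum may lie strictly left of s, at the start of a flat piece of
  \<open>f \<alpha>\<close>, so it is recognized as critical by a shift. The assumption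
  \<open>far\<close> keeps the infimum finite.\<close>

lemma critical_lower_threshold:
  assumes \<alpha>: "0 \<le> \<alpha>" "\<alpha> \<le> 1" and crit: "critical \<alpha> s S0" and S: "\<And>y. W \<alpha> s S \<le> W \<alpha> s y"
    and far: "\<And>x. x \<le> a \<Longrightarrow> f \<alpha> s < f \<alpha> x"
  shows "critical \<alpha> (lower_threshold K (W \<alpha> s) S) S" "lower_threshold K (W \<alpha> s) S \<le> S"
proof -
  define T where "T = {x. x \<le> S \<and> W \<alpha> s x \<le> K + W \<alpha> s S}"
  note WS = W_minimizer[OF \<alpha> crit S]
  obtain x0 where uni: "unimodal \<alpha> x0" and s: "s \<le> x0"
    using crit by (auto simp: critical_def)
  have sT: "s \<in> T"
    using WS by (simp add: T_def W_below)
  have bdd: "bdd_below T"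
  proof (rule bdd_belowI[of _ "min a s"])
    fix x assume x: "x \<in> T"
    show "min a s \<le> x"
    proof (rule ccontr)
      assume "\<not> min a s \<le> x"
      then have "x < a" "x < s" by auto
      then show False
        using x far[of x] WS by (simp add: T_def W_below)
    qed
  qed
  have "closed {x. x \<le> S \<and> W \<alpha> s x \<le> K + W \<alpha> s S}"
    by (intro closed_Collect_conj closed_Collect_le continuous_intros W_continuous \<alpha>)
  then have mem: "Inf T \<in> T"
    using closed_contains_Inf[of T] sT bdd by (auto simp: T_def)
  have le: "Inf T \<le> s"
    using sT bdd by (rule cInf_lower)
  \<comment> \<open>At most 0 by closedness of T, at least 0 because \<open>f \<alpha>\<close> is no
    smaller below s than at s.\<close>
  have "W \<alpha> s (Inf T) = 0"
    using mem WS critical_f_ge[OF crit le] le by (simp add: T_def W_below)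
  then have "f \<alpha> (Inf T) = f \<alpha> s"
    using le by (simp add: W_below)
  then have "critical \<alpha> (Inf T) S"
    using critical_shift[OF \<alpha> crit uni s _ _ WS(3), of "Inf T"] le s by simp
  moreover have "lower_threshold K (W \<alpha> s) S = Inf T"
    by (simp add: lower_threshold_def T_def)
  ultimately show "critical \<alpha> (lower_threshold K (W \<alpha> s) S) S" "lower_threshold K (W \<alpha> s) S \<le> S"
    using mem by (auto simp: T_def)
qed

section \<open>The value function up to a constant, with the shift by c * x undone\<close>

definition \<psi> :: "real \<Rightarrow> real \<Rightarrow> real \<Rightarrow> real" where
  "\<psi> \<alpha> s x = J \<alpha> s x - c * x"

definition inf_\<psi> :: "real \<Rightarrow> real \<Rightarrow> real" where
  "inf_\<psi> \<alpha> s = Inf (range (\<psi> \<alpha> s))"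

lemma psi_continuous: "0 \<le> \<alpha> \<Longrightarrow> \<alpha> \<le> 1 \<Longrightarrow> continuous_on UNIV (\<psi> \<alpha> s)"
  unfolding \<psi>_def by (intro continuous_intros J_continuous)

lemma psi_integrable: "0 \<le> \<alpha> \<Longrightarrow> \<alpha> \<le> 1 \<Longrightarrow> integrable M (\<lambda>d. \<psi> \<alpha> s (y - d))"
  unfolding \<psi>_def using J_integrable[of \<alpha> s y] integrable_affine[of c y 0] by simp

lemma post_psi: "0 \<le> \<alpha> \<Longrightarrow> \<alpha> \<le> 1 \<Longrightarrow> post (\<psi> \<alpha> s) y = post (J \<alpha> s) y - c * (y - mean)"
  using J_integrable[of \<alpha> s y] integrable_affine[of c y 0] post_affine[of c 0 y]
  by (simp add: post_def \<psi>_def)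

lemma psi_below: "x \<le> s \<Longrightarrow> \<psi> \<alpha> s x = - c * x"
  by (simp add: \<psi>_def J_vanishing)

lemma psi_coercive:
  obtains B where "0 \<le> B"
    "\<And>\<alpha> s y. 0 \<le> \<alpha> \<Longrightarrow> \<alpha> \<le> 1 \<Longrightarrow> a1 \<le> s \<Longrightarrow> s \<le> a2 \<Longrightarrow> B \<le> y \<Longrightarrow> R \<le> \<psi> \<alpha> s y"
  using J_coercive[of a1 a2 R] unfolding \<psi>_def by metis

text \<open>The level 1 - c * a1 exceeds \<open>\<psi> \<alpha> s s\<close> = -c * s, so s beats
  every point from B on; it also beats every point to its left, where \<psi> is -c * x. Minimizers
  for all thresholds in [a1, a2] thus lie in one compact interval.\<close>

lemma psi_minimum:
  assumes \<alpha>: "0 \<le> \<alpha>" "\<alpha> \<le> 1" and s: "a1 \<le> s" "s \<le> a2"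
    and B: "\<And>y. B \<le> y \<Longrightarrow> 1 - c * a1 \<le> \<psi> \<alpha> s y"
  obtains x where "s \<le> x" "x < B" "\<And>y. \<psi> \<alpha> s x \<le> \<psi> \<alpha> s y" "inf_\<psi> \<alpha> s = \<psi> \<alpha> s x"
proof -
  have B': "\<psi> \<alpha> s s < \<psi> \<alpha> s y" if "B \<le> y" for y
  proof -
    have "c * a1 \<le> c * s" using s c_pos by simp
    then show ?thesis using B[OF that] by (simp add: psi_below)
  qed
  have low: "\<psi> \<alpha> s s < \<psi> \<alpha> s y" if "y < s" for y
    using that c_pos by (simp add: psi_below)
  have "\<exists>x. \<forall>y. \<psi> \<alpha> s x \<le> \<psi> \<alpha> s y"
    by (rule continuous_attains_min_outside[OF psi_continuous[OF \<alpha>], of s B s]) (use low B' in auto)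
  then obtain x where x: "\<And>y. \<psi> \<alpha> s x \<le> \<psi> \<alpha> s y"
    by blast
  have "inf_\<psi> \<alpha> s = \<psi> \<alpha> s x"
    unfolding inf_\<psi>_def using x by (intro cInf_eq_minimum) auto
  moreover have "s \<le> x" "x < B"
    using x[of s] low[of x] B'[of x] by linarith+
  ultimately show thesis
    using that x by blast
qed

lemma inf_psi_attained:
  assumes \<alpha>: "0 \<le> \<alpha>" "\<alpha> \<le> 1"
  obtains x where "inf_\<psi> \<alpha> s = \<psi> \<alpha> s x" "\<And>y. \<psi> \<alpha> s x \<le> \<psi> \<alpha> s y"
proof (rule psi_coercive[of s s "1 - c * s"])
  fix B assume B: "\<And>\<alpha> t y. 0 \<le> \<alpha> \<Longrightarrow> \<alpha> \<le> 1 \<Longrightarrow> s \<le> t \<Longrightarrow> t \<le> s \<Longrightarrow> B \<le> y \<Longrightarrow> 1 - c * s \<le> \<psi> \<alpha> t y"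
  show thesis
    by (rule psi_minimum[where s = s and B = B, OF \<alpha> order_refl order_refl])
      (blast intro: B[OF \<alpha> order_refl order_refl] that)+
qed

lemma inf_psi_le: "0 \<le> \<alpha> \<Longrightarrow> \<alpha> \<le> 1 \<Longrightarrow> inf_\<psi> \<alpha> s \<le> \<psi> \<alpha> s x"
  by (rule inf_psi_attained[of \<alpha> s]) auto

text \<open>For parameters near the limit all minimizers lie in [s - 1, B], where J converges
  uniformly; evaluating each function at the other's minimizer compares the two infima.\<close>

lemma inf_psi_tendsto:
  assumes \<beta>: "(\<beta> \<longlongrightarrow> \<alpha>) F" "eventually (\<lambda>i. 0 \<le> \<beta> i \<and> \<beta> i \<le> 1) F"
    and \<alpha>: "0 \<le> \<alpha>" "\<alpha> \<le> 1" and \<sigma>: "(\<sigma> \<longlongrightarrow> s) F"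
  shows "((\<lambda>i. inf_\<psi> (\<beta> i) (\<sigma> i)) \<longlongrightarrow> inf_\<psi> \<alpha> s) F"
proof (rule tendstoI)
  fix e :: real assume e: "0 < e"
  obtain B where B: "0 \<le> B" "\<And>\<alpha> t y. 0 \<le> \<alpha> \<Longrightarrow> \<alpha> \<le> 1 \<Longrightarrow> s - 1 \<le> t \<Longrightarrow> t \<le> s + 1 \<Longrightarrow>
      B \<le> y \<Longrightarrow> 1 - c * (s - 1) \<le> \<psi> \<alpha> t y"
    using psi_coercive[of "s - 1" "s + 1" "1 - c * (s - 1)"] by metis
  have s1: "s - 1 \<le> s" "s \<le> s + 1" by auto
  obtain x where x: "s \<le> x" "x < B" "\<And>y. \<psi> \<alpha> s x \<le> \<psi> \<alpha> s y" "inf_\<psi> \<alpha> s = \<psi> \<alpha> s x"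
    by (rule psi_minimum[OF \<alpha> s1, of B]) (blast intro: B(2)[OF \<alpha> s1])+
  have "eventually (\<lambda>i. \<forall>y\<in>{s - 1..B}. dist (J (\<beta> i) (\<sigma> i) y) (J \<alpha> s y) < e) F"
    by (rule uniform_limitD[OF J_uniform_limit[OF compact_Icc \<beta> \<alpha> \<sigma>] e])
  moreover have "eventually (\<lambda>i. s - 1 < \<sigma> i \<and> \<sigma> i < s + 1) F"
    using order_tendstoD[OF \<sigma>] by (simp add: eventually_conj)
  ultimately show "eventually (\<lambda>i. dist (inf_\<psi> (\<beta> i) (\<sigma> i)) (inf_\<psi> \<alpha> s) < e) F"
    using \<beta>(2)
  proof eventually_elim
    case (elim i)
    have i: "0 \<le> \<beta> i" "\<beta> i \<le> 1" "s - 1 \<le> \<sigma> i" "\<sigma> i \<le> s + 1"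
      using elim by auto
    obtain z where z: "\<sigma> i \<le> z" "z < B" "\<And>y. \<psi> (\<beta> i) (\<sigma> i) z \<le> \<psi> (\<beta> i) (\<sigma> i) y"
        "inf_\<psi> (\<beta> i) (\<sigma> i) = \<psi> (\<beta> i) (\<sigma> i) z"
      by (rule psi_minimum[OF i, of B]) (blast intro: B(2)[OF i])+
    have "\<bar>J (\<beta> i) (\<sigma> i) z - J \<alpha> s z\<bar> < e" "\<bar>J (\<beta> i) (\<sigma> i) x - J \<alpha> s x\<bar> < e"
      using elim x z by (auto simp: dist_real_def)
    then show ?case
      using x(3)[of z] z(3)[of x] unfolding x(4) z(4) \<psi>_def dist_real_def by linarith
  qed
qed

text \<open>The constant is the total discounted cost of paying \<open>f \<alpha> s + \<alpha> * c * mean\<close> in every period.\<close>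

definition v :: "real \<Rightarrow> real \<Rightarrow> real \<Rightarrow> real" where
  "v \<alpha> s x = \<psi> \<alpha> s x + (f \<alpha> s + \<alpha> * c * mean) / (1 - \<alpha>)"

section \<open>The candidate for the discounted value function\<close>

lemma v_continuous: "0 \<le> \<alpha> \<Longrightarrow> \<alpha> \<le> 1 \<Longrightarrow> continuous_on UNIV (v \<alpha> s)"
  unfolding v_def by (intro continuous_intros psi_continuous)

lemma v_integrable: "0 \<le> \<alpha> \<Longrightarrow> \<alpha> \<le> 1 \<Longrightarrow> integrable M (\<lambda>d. v \<alpha> s (y - d))"
  unfolding v_def using psi_integrable[of \<alpha> s y] by simp

text \<open>Undoing the shift produces the drift \<alpha> * c * mean, and taking differences removed
  f s; the additive constant restores both, being their sum divided by 1 - \<alpha>.\<close>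

lemma post_v:
  assumes "0 \<le> \<alpha>" "\<alpha> < 1"
  shows "c * y + g y + \<alpha> * post (v \<alpha> s) y = W \<alpha> s y + (f \<alpha> s + \<alpha> * c * mean) / (1 - \<alpha>)"
proof -
  define \<Gamma> where "\<Gamma> = (f \<alpha> s + \<alpha> * c * mean) / (1 - \<alpha>)"
  have \<Gamma>: "f \<alpha> s + \<alpha> * c * mean = (1 - \<alpha>) * \<Gamma>"
    using assms by (simp add: \<Gamma>_def)
  have "post (v \<alpha> s) y = post (\<psi> \<alpha> s) y + \<Gamma>"
    unfolding post_def v_def \<Gamma>_def using psi_integrable[of \<alpha> s y] assms
    by (simp add: prob_space[simplified])
  also have "\<dots> = post (J \<alpha> s) y - c * (y - mean) + \<Gamma>"
    using assms by (simp add: post_psi)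
  finally have *: "post (v \<alpha> s) y = post (J \<alpha> s) y - c * (y - mean) + \<Gamma>" .
  have "c * y + g y + \<alpha> * post (v \<alpha> s) y =
      f \<alpha> y + \<alpha> * post (J \<alpha> s) y + \<alpha> * c * mean + \<alpha> * \<Gamma>"
    unfolding * by (simp add: f_def algebra_simps)
  also have "\<dots> = W \<alpha> s y + \<Gamma>"
    unfolding W_def using \<Gamma> by (simp add: algebra_simps)
  finally show ?thesis by (simp add: \<Gamma>_def)
qed

lemma v_le:
  assumes \<alpha>: "0 \<le> \<alpha>" "\<alpha> < 1" and crit: "critical \<alpha> s S" and a: "0 \<le> a"
  shows "v \<alpha> s x \<le> K * of_bool (0 < a) + c * a + g (x + a) + \<alpha> * post (v \<alpha> s) (x + a)"
  using post_v[OF \<alpha>, of "x + a" s] J_le_W[OF _ _ crit, of x "x + a"] \<alpha> a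
  by (simp add: v_def \<psi>_def algebra_simps)

lemma v_eq_iff:
  assumes \<alpha>: "0 \<le> \<alpha>" "\<alpha> < 1"
  shows "v \<alpha> s x = K * of_bool (0 < a) + c * a + g (x + a) + \<alpha> * post (v \<alpha> s) (x + a) \<longleftrightarrow>
    J \<alpha> s x = K * of_bool (0 < a) + W \<alpha> s (x + a)"
  using post_v[OF \<alpha>, of "x + a" s] by (simp add: v_def \<psi>_def algebra_simps)

text \<open>At a minimizer z the optimality equation with nonnegative costs gives v z \<ge> \<alpha>
  * v z, and \<alpha> < 1.\<close>

lemma v_nonneg:
  assumes \<alpha>: "0 \<le> \<alpha>" "\<alpha> < 1" and crit: "critical \<alpha> s S"
  shows "0 \<le> v \<alpha> s x"
proof -
  have \<alpha>1: "\<alpha> \<le> 1" using \<alpha> by simp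
  obtain z where z: "\<And>x. v \<alpha> s z \<le> v \<alpha> s x"
    by (rule inf_psi_attained[OF \<alpha>(1) \<alpha>1, of s]) (auto simp: v_def)
  define a where "a = sS_map s S z"
  have a: "0 \<le> a"
    using critical_less[OF crit] by (auto simp: a_def sS_map_def)
  have "v \<alpha> s z = K * of_bool (0 < a) + c * a + g (z + a) + \<alpha> * post (v \<alpha> s) (z + a)"
    unfolding v_eq_iff[OF \<alpha>] a_def by (rule J_eq_W_policy[OF \<alpha>(1) \<alpha>1 crit])
  moreover have "post (\<lambda>_. v \<alpha> s z) (z + a) \<le> post (v \<alpha> s) (z + a)"
    using z \<alpha> by (intro post_mono v_integrable) auto
  then have "\<alpha> * v \<alpha> s z \<le> \<alpha> * post (v \<alpha> s) (z + a)"
    using \<alpha> by (intro mult_left_mono) (auto simp: post_def prob_space[simplified])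
  moreover have "0 \<le> K * of_bool (0 < a) + c * a + g (z + a)"
    using K_pos c_pos a g_nonneg by (intro add_nonneg_nonneg) auto
  ultimately have "\<alpha> * v \<alpha> s z \<le> v \<alpha> s z" by simp
  then have "0 \<le> (1 - \<alpha>) * v \<alpha> s z"
    by (simp add: algebra_simps)
  then have "0 \<le> v \<alpha> s z"
    using \<alpha> by (simp add: zero_le_mult_iff)
  then show ?thesis using z order_trans by blast
qed

lemma v_admissible:
  assumes "0 \<le> \<alpha>" "\<alpha> < 1" "critical \<alpha> s S"
  shows "continuous_on UNIV (v \<alpha> s)" "integrable M (\<lambda>d. v \<alpha> s (y - d))" "0 \<le> v \<alpha> s y"
  using assms v_continuous v_integrable v_nonneg by auto

text \<open>Prepares the vanishing of the remainder in the verification. The positive part P of the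
  excess is nondecreasing, so the descent never increases it in expectation and J is at most the
  geometric sum P / (1 - \<alpha>); P in turn is controlled by the holding cost.\<close>

lemma post_J_growth:
  assumes \<alpha>: "0 \<le> \<alpha>" "\<alpha> < 1" and crit: "critical \<alpha> s S"
  shows "post (J \<alpha> s) y \<le> g y / (1 - \<alpha>) + c * (max y s - s)"
proof -
  have \<alpha>1: "\<alpha> \<le> 1" using \<alpha> by simp
  obtain x0 where uni: "unimodal \<alpha> x0" and s: "s \<le> x0"
    using crit by (auto simp: critical_def)
  define P where "P y = max (excess \<alpha> s y) 0" for y
  have P: "continuous_on UNIV P" "\<And>y. y \<le> s \<Longrightarrow> P y = 0" "\<And>y. 0 \<le> P y"
    unfolding P_def by (auto simp: excess_vanishing intro!: continuous_intros excess_continuous)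
  have intP: "integrable M (\<lambda>d. P (y - d))" for y
    using P by (intro integrable_vanishing) auto
  have mono: "P z \<le> P y" if "z \<le> y" for z y
  proof (cases "z \<le> x0")
    case True
    then show ?thesis
      using J_below_mode(2)[OF \<alpha>(1) \<alpha>1 uni s, of z] P(3)[of y] by (simp add: P_def)
  next
    case False
    then have "f \<alpha> z \<le> f \<alpha> y"
      using uni that by (auto simp: unimodal_def)
    then have "excess \<alpha> s z \<le> excess \<alpha> s y"
      using False that s by (simp add: excess_above)
    then show ?thesis
      unfolding P_def by (intro max.mono) auto
  qed
  have postP: "post P y \<le> P y" for y
  proof -
    have "post P y \<le> post (\<lambda>_. P y) y"
      using mono intP by (intro post_mono) auto
    then show ?thesis by (simp add: post_def prob_space[simplified])
  qed
  have J_le: "J \<alpha> s y \<le> P y / (1 - \<alpha>)" for y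
  proof -
    define F where "F y = J \<alpha> s y - P y / (1 - \<alpha>)" for y
    have postF: "post F z = post (J \<alpha> s) z - post P z / (1 - \<alpha>)" for z
      unfolding post_def F_def using J_integrable[OF \<alpha>(1) \<alpha>1] intP by simp
    have "F y \<le> 0 / (1 - \<rho>) * exp (y - s)"
    proof (rule comparison[where \<alpha> = \<alpha> and B = y])
      fix z
      have "\<alpha> * (post P z / (1 - \<alpha>)) \<le> \<alpha> * (P z / (1 - \<alpha>))"
        using postP \<alpha> by (intro mult_left_mono divide_right_mono) auto
      moreover have "P z + \<alpha> * (P z / (1 - \<alpha>)) = P z / (1 - \<alpha>)"
        using \<alpha> by (simp add: field_simps)
      moreover have "excess \<alpha> s z \<le> P z" by (simp add: P_def)
      ultimately show "F z \<le> 0 + \<alpha> * post F z"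
        unfolding postF unfolding F_def using J_equation[OF \<alpha>(1) \<alpha>1, of s z]
        by (simp add: right_diff_distrib)
    next
      show "F z \<le> 0" if "z \<le> s" for z
        using that P(2)[of z] by (simp add: F_def J_vanishing)
      show "integrable M (\<lambda>d. F (z - d))" for z
        unfolding F_def using J_integrable[OF \<alpha>(1) \<alpha>1] intP by simp
    qed (use \<alpha> in \<open>auto simp: F_def intro!: continuous_intros J_continuous P\<close>)
    then show ?thesis by (simp add: F_def)
  qed
  have "post (J \<alpha> s) y \<le> post (\<lambda>y. P y / (1 - \<alpha>)) y"
    using J_le intP \<alpha> by (intro post_mono J_integrable) auto
  also have "\<dots> = post P y / (1 - \<alpha>)"
    by (simp add: post_def)
  also have "\<dots> \<le> P y / (1 - \<alpha>)"
    using postP \<alpha> by (intro divide_right_mono) auto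
  also have "\<dots> \<le> (g y + (1 - \<alpha>) * (c * (max y s - s))) / (1 - \<alpha>)"
  proof (intro divide_right_mono)
    have "0 \<le> (1 - \<alpha>) * (c * (max y s - s))"
      using \<alpha> c_pos by simp
    then show "P y \<le> g y + (1 - \<alpha>) * (c * (max y s - s))"
      using g_nonneg[of s] g_nonneg[of y] P(2)[of y]
      by (cases "y \<le> s") (auto simp: P_def excess_above f_def algebra_simps max_def)
  qed (use \<alpha> in auto)
  also have "\<dots> = g y / (1 - \<alpha>) + c * (max y s - s)"
    using \<alpha> by (simp add: add_divide_distrib)
  finally show ?thesis .
qed

lemma post_v_growth:
  assumes \<alpha>: "0 \<le> \<alpha>" "\<alpha> < 1" and crit: "critical \<alpha> s S"
  obtains C where "0 \<le> C"
    "\<And>y. post (v \<alpha> s) y \<le> g y / (1 - \<alpha>) + c * max 0 (- y) + C"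
proof -
  define \<Gamma> where "\<Gamma> = (f \<alpha> s + \<alpha> * c * mean) / (1 - \<alpha>)"
  have *: "post (v \<alpha> s) y \<le> g y / (1 - \<alpha>) + c * max 0 (- y) + (c * \<bar>s\<bar> + c * mean + \<bar>\<Gamma>\<bar>)" for y
  proof -
    have "post (v \<alpha> s) y = post (\<psi> \<alpha> s) y + \<Gamma>"
      unfolding post_def v_def \<Gamma>_def using psi_integrable[of \<alpha> s y] \<alpha>
      by (simp add: prob_space[simplified])
    also have "\<dots> = post (J \<alpha> s) y - c * y + c * mean + \<Gamma>"
      using \<alpha> by (simp add: post_psi algebra_simps)
    also have "\<dots> \<le> g y / (1 - \<alpha>) + c * (max y s - s - y) + c * mean + \<Gamma>"
      using post_J_growth[OF assms, of y] by (simp add: algebra_simps)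
    also have "c * (max y s - s - y) \<le> c * (max 0 (- y) + \<bar>s\<bar>)"
      using c_pos by (intro mult_left_mono) auto
    finally show ?thesis by (simp add: algebra_simps)
  qed
  show thesis
    by (rule that[OF _ *]) (use c_pos mean_nonneg in auto)
qed

end

section \<open>Vanishing discount\<close>

context inventory_costs
begin

definition strict_mode :: "real \<Rightarrow> bool" where
  "strict_mode x1 \<longleftrightarrow> unimodal 1 x1 \<and> (\<forall>y z. y < z \<longrightarrow> z \<le> x1 \<longrightarrow> f 1 z < f 1 y)"

lemma critical_less_mode:
  assumes crit: "critical 1 s S" and x1: "strict_mode x1"
  shows "s < x1"
proof (rule ccontr)
  assume "\<not> s < x1"
  then have "0 \<le> excess 1 s z" for z
    using x1 by (auto simp: excess_def strict_mode_def unimodal_def)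
  then have "0 \<le> J 1 s S"
    by (intro J_nonneg) auto
  then show False
    using crit K_pos by (simp add: critical_def)
qed

lemma J_strict_mono_threshold:
  assumes x1: "strict_mode x1" and s: "s < s'" "s' \<le> x1" and y: "s' \<le> y"
  shows "J 1 s y < J 1 s' y"
proof -
  have "J 1 s y + (f 1 s - f 1 s') \<le> J 1 s' y"
    using x1 s y by (intro J_mono_threshold(2)) (auto simp: strict_mode_def unimodal_def)
  moreover have "f 1 s' < f 1 s"
    using x1 s by (simp add: strict_mode_def)
  ultimately show ?thesis by simp
qed

text \<open>Of two critical thresholds the smaller would give a strictly smaller J at the minimizer
  of the larger, hence a value below -K.\<close>

lemma critical_unique:
  assumes x1: "strict_mode x1" and crit: "critical 1 s S" "critical 1 s' S'"
  shows "s = s'"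
proof -
  have *: "\<not> t < t'" if c: "critical 1 t T" "critical 1 t' T'" for t t' T T'
  proof
    assume "t < t'"
    then have "J 1 t T' < J 1 t' T'"
      using critical_less_mode[OF c(2) x1] critical_less[OF c(2)]
      by (intro J_strict_mono_threshold[OF x1]) auto
    then show False
      using c by (auto simp: critical_def) (meson not_le)
  qed
  show ?thesis
    using *[OF crit] *[OF crit(2,1)] by simp
qed

lemma eventually_at_left_1: "eventually (\<lambda>\<alpha>::real. 0 \<le> \<alpha> \<and> \<alpha> \<le> 1) (at_left 1)"
  unfolding eventually_at_left_field by (intro exI[of _ 0]) auto

lemma f_tendsto: "((\<lambda>\<alpha>. f \<alpha> y) \<longlongrightarrow> f 1 y) (at_left 1)"
  unfolding f_def by (intro tendsto_intros)

text \<open>Brackets s1 between sm and sp, where at \<alpha> = 1 the minimum of J is strictly below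
  and strictly above -K. Both strict inequalities persist for \<alpha> near 1, and monotonicity in
  the threshold excludes critical values outside the bracket.\<close>

lemma critical_eventually_close:
  assumes crit: "critical 1 s1 S1" and x1: "strict_mode x1" and e: "0 < e"
    and uni: "eventually (\<lambda>\<alpha>. \<exists>x0. unimodal \<alpha> x0) (at_left 1)"
  shows "eventually (\<lambda>\<alpha>. \<forall>s S. critical \<alpha> s S \<longrightarrow> \<bar>s - s1\<bar> < e) (at_left 1)"
proof -
  have s1: "s1 < x1"
    by (rule critical_less_mode[OF crit x1])
  note at1 = tendsto_ident_at eventually_at_left_1
  define sm where "sm = s1 - e"
  \<comment> \<open>Capped at x1 because strict monotonicity in the threshold is available only up
    to the strict mode.\<close>
  define sp where "sp = min (s1 + e / 2) x1"
  have sm: "sm < s1" and sp: "s1 < sp" "sp \<le> x1" "sp < s1 + e"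
    using e s1 by (auto simp: sm_def sp_def)
  have lower: "eventually (\<lambda>\<alpha>. \<forall>s S. critical \<alpha> s S \<longrightarrow> sm < s) (at_left 1)"
  proof -
    have "J 1 sm S1 < J 1 s1 S1"
      using critical_less[OF crit] sm s1 by (intro J_strict_mono_threshold[OF x1]) auto
    then have "J 1 sm S1 < - K"
      using crit by (simp add: critical_def)
    moreover have "((\<lambda>\<alpha>. J \<alpha> sm S1) \<longlongrightarrow> J 1 sm S1) (at_left 1)"
      by (intro J_tendsto at1 tendsto_const) auto
    ultimately have "eventually (\<lambda>\<alpha>. J \<alpha> sm S1 < - K) (at_left 1)"
      by (rule order_tendstoD(2)[rotated])
    \<comment> \<open>The modes of \<open>f \<alpha>\<close> need not converge. A value at sm above
      that at x1 > sm still forces every mode to be at least sm, so that J is monotone in the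
      threshold up to sm.\<close>
    moreover have "eventually (\<lambda>\<alpha>. 0 < f \<alpha> sm - f \<alpha> x1) (at_left 1)"
    proof (rule order_tendstoD(1))
      show "((\<lambda>\<alpha>. f \<alpha> sm - f \<alpha> x1) \<longlongrightarrow> f 1 sm - f 1 x1) (at_left 1)"
        by (intro tendsto_diff f_tendsto)
      show "0 < f 1 sm - f 1 x1"
        using x1 sm s1 by (simp add: strict_mode_def)
    qed
    ultimately show ?thesis
      using eventually_at_left_1 uni
    proof eventually_elim
      case (elim \<alpha>)
      then obtain x0 where x0: "unimodal \<alpha> x0" by blast
      have "sm \<le> x0"
      proof (rule ccontr)
        assume "\<not> sm \<le> x0"
        then have "f \<alpha> sm \<le> f \<alpha> x1"
          using x0 sm s1 by (auto simp: unimodal_def)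
        then show False using elim by simp
      qed
      then have "J \<alpha> s S1 \<le> J \<alpha> sm S1" if "s \<le> sm" for s
        using J_mono_below_mode[OF _ _ x0 that] elim by simp
      then show ?case
        using elim(1) unfolding critical_def by (meson not_le order.trans order.strict_trans1)
    qed
  qed
  have upper: "eventually (\<lambda>\<alpha>. \<forall>s S. critical \<alpha> s S \<longrightarrow> s < sp) (at_left 1)"
  proof -
    have above: "- K < J 1 sp y" for y
    proof (cases "y \<le> sp")
      case True
      then show ?thesis using K_pos by (simp add: J_vanishing)
    next
      case False
      then have "J 1 s1 y < J 1 sp y"
        using sp by (intro J_strict_mono_threshold[OF x1]) auto
      moreover have "- K \<le> J 1 s1 y"
        using crit by (simp add: critical_def)
      ultimately show ?thesis by simp
    qed
    obtain B where B: "0 \<le> B"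
      "\<And>\<alpha> s y. 0 \<le> \<alpha> \<Longrightarrow> \<alpha> \<le> 1 \<Longrightarrow> sp \<le> s \<Longrightarrow> s \<le> sp \<Longrightarrow> B \<le> y \<Longrightarrow> 0 \<le> J \<alpha> s y - c * y"
      using J_coercive[of sp sp 0] by metis
    define Y where "Y = {sp..max B sp}"
    obtain y0 where y0: "y0 \<in> Y" "\<And>y. y \<in> Y \<Longrightarrow> J 1 sp y0 \<le> J 1 sp y"
      using continuous_attains_inf[of Y "J 1 sp"] continuous_on_subset[OF J_continuous[of 1 sp]]
      by (auto simp: Y_def)
    \<comment> \<open>The strict bound must hold for all levels at once: uniform convergence covers
      the compact Y with the gap J + K at its minimizer as tolerance, coercivity covers y \<ge> B,
      and J is zero below sp.\<close>
    have "eventually (\<lambda>\<alpha>. \<forall>y\<in>Y. dist (J \<alpha> sp y) (J 1 sp y) < J 1 sp y0 + K) (at_left 1)"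
      using above[of y0]
      by (intro uniform_limitD[OF J_uniform_limit] at1 tendsto_const) (auto simp: Y_def)
    then show ?thesis
      using eventually_at_left_1
    proof eventually_elim
      case (elim \<alpha>)
      then have \<alpha>: "0 \<le> \<alpha>" "\<alpha> \<le> 1" by auto
      have large: "- K < J \<alpha> sp y" for y
      proof -
        consider "y \<le> sp" | "y \<in> Y" | "B \<le> y"
          by (cases "y \<le> sp"; cases "B \<le> y") (auto simp: Y_def)
        then show ?thesis
        proof cases
          case 1
          then show ?thesis using K_pos by (simp add: J_vanishing)
        next
          case 2
          then have "\<bar>J \<alpha> sp y - J 1 sp y\<bar> < J 1 sp y0 + K"
            using elim(1) by (auto simp: dist_real_def)
          then show ?thesis using y0(2)[OF 2] by linarith
        next
          case 3
          then have "0 \<le> J \<alpha> sp y - c * y" "0 \<le> c * y"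
            using B(2)[OF \<alpha>, of sp y] B(1) c_pos by auto
          then show ?thesis using K_pos by linarith
        qed
      qed
      show ?case
      proof (intro allI impI)
        fix s S assume cr: "critical \<alpha> s S"
        then obtain x0 where x0: "unimodal \<alpha> x0" "s \<le> x0"
          by (auto simp: critical_def)
        show "s < sp"
        proof (rule ccontr)
          assume "\<not> s < sp"
          then have "J \<alpha> sp S \<le> J \<alpha> s S"
            using x0 \<alpha> by (intro J_mono_below_mode) auto
          then show False
            using large[of S] cr by (simp add: critical_def)
        qed
      qed
    qed
  qed
  from lower upper show ?thesis
  proof eventually_elim
    case (elim \<alpha>)
    show ?case
    proof (intro allI impI)
      fix s S assume "critical \<alpha> s S"
      then have "sm < s" "s < sp" using elim by blast+
      then show "\<bar>s - s1\<bar> < e" using sp by (simp add: sm_def)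
    qed
  qed
qed

lemma critical_tendsto:
  assumes crit: "critical 1 s1 S1" and x1: "strict_mode x1"
    and uni: "eventually (\<lambda>\<alpha>. \<exists>x0. unimodal \<alpha> x0) (at_left 1)"
    and \<sigma>: "eventually (\<lambda>\<alpha>. \<exists>S. critical \<alpha> (\<sigma> \<alpha>) S) (at_left 1)"
  shows "(\<sigma> \<longlongrightarrow> s1) (at_left 1)"
proof (rule tendstoI)
  fix e :: real assume "0 < e"
  from critical_eventually_close[OF crit x1 this uni] \<sigma>
  show "eventually (\<lambda>\<alpha>. dist (\<sigma> \<alpha>) s1 < e) (at_left 1)"
    by eventually_elim (auto simp: dist_real_def)
qed

lemma critical_sequence_bounded:
  assumes a: "\<And>n. 0 \<le> a n" "\<And>n. a n \<le> 1" and crit: "\<And>n. critical (a n) (s n) (S n)"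
    and s: "s \<longlonglongrightarrow> s1"
  shows "Bseq S"
proof -
  obtain B where B: "0 \<le> B" "\<And>\<alpha> t y. 0 \<le> \<alpha> \<Longrightarrow> \<alpha> \<le> 1 \<Longrightarrow> s1 - 1 \<le> t \<Longrightarrow> t \<le> s1 + 1 \<Longrightarrow>
      B \<le> y \<Longrightarrow> 0 \<le> J \<alpha> t y - c * y"
    using J_coercive[of "s1 - 1" "s1 + 1" 0] by metis
  have "eventually (\<lambda>n. s1 - 1 < s n \<and> s n < s1 + 1) sequentially"
    using order_tendstoD[OF s] by (simp add: eventually_conj)
  then have "eventually (\<lambda>n. norm (S n) \<le> norm (\<bar>s1\<bar> + 1 + B)) sequentially"
  proof eventually_elim
    case (elim n)
    have "s n < S n" "S n < B"
      using B(2)[OF a(1)[of n] a(2)[of n], of "s n"] B(1) elim crit[of n]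
      by (auto intro!: J_attains_minus_K_bounds[of B "a n" "s n"] simp: critical_def)
    then show ?case using elim B(1) by auto
  qed
  then show ?thesis
    by (rule Bseq_eventually_mono) simp
qed

lemma critical_limit:
  assumes a: "a \<longlonglongrightarrow> 1" "\<And>n. 0 \<le> a n" "\<And>n. a n \<le> 1" and crit: "\<And>n. critical (a n) (s n) (S n)"
    and s: "s \<longlonglongrightarrow> s1" and S: "S \<longlonglongrightarrow> S0" and s1: "critical 1 s1 S1"
  shows "critical 1 s1 S0"
proof -
  have "(\<lambda>n. J (a n) (s n) (S n)) \<longlonglongrightarrow> J 1 s1 S0"
    using a by (intro J_tendsto s S) auto
  moreover have "(\<lambda>n. J (a n) (s n) (S n)) = (\<lambda>n. - K)"
    using crit by (simp add: critical_def)
  ultimately have "J 1 s1 S0 = - K"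
    using LIMSEQ_const_iff by metis
  then show ?thesis
    using s1 by (simp add: critical_def)
qed

section \<open>Relative value function and optimality equation at \<alpha> = 1\<close>

definition u :: "real \<Rightarrow> real \<Rightarrow> real" where
  "u s x = \<psi> 1 s x - inf_\<psi> 1 s"

lemma u_nonneg: "0 \<le> u s x"
  using inf_psi_le[of 1 s x] by (simp add: u_def)

lemma u_continuous: "continuous_on UNIV (u s)"
  unfolding u_def by (intro continuous_intros psi_continuous) auto

lemma u_integrable: "integrable M (\<lambda>d. u s (y - d))"
  unfolding u_def using psi_integrable[of 1 s y] by simp

lemma post_u: "c * y + g y + post (u s) y = W 1 s y + (f 1 s + c * mean - inf_\<psi> 1 s)"
proof -
  have "post (u s) y = post (\<psi> 1 s) y - inf_\<psi> 1 s"
    unfolding post_def u_def using psi_integrable[of 1 s y] by (simp add: prob_space[simplified])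
  also have "\<dots> = post (J 1 s) y - c * (y - mean) - inf_\<psi> 1 s"
    by (simp add: post_psi)
  finally have *: "post (u s) y = post (J 1 s) y - c * (y - mean) - inf_\<psi> 1 s" .
  show ?thesis
    unfolding * by (simp add: W_def f_def algebra_simps)
qed

lemma inf_compact_u: "inf_compact (u s)"
proof (rule inf_compactI[OF u_continuous])
  fix r
  obtain B where B: "\<And>y. B \<le> y \<Longrightarrow> r + inf_\<psi> 1 s + 1 \<le> \<psi> 1 s y"
    using psi_coercive[of s s "r + inf_\<psi> 1 s + 1"] by (metis order_refl zero_le_one)
  define A where "A = min s (- (r + inf_\<psi> 1 s + 1) / c)"
  have "A \<le> x \<and> x \<le> B" if "u s x \<le> r" for x
  proof
    show "x \<le> B"
      using B[of x] that by (cases "x \<le> B") (auto simp: u_def)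
    show "A \<le> x"
    proof (rule ccontr)
      assume "\<not> A \<le> x"
      then have "x \<le> s" "x < - (r + inf_\<psi> 1 s + 1) / c"
        by (auto simp: A_def)
      then have "c * x < - (r + inf_\<psi> 1 s + 1)"
        using c_pos by (simp add: field_simps)
      then show False
        using that \<open>x \<le> s\<close> by (simp add: u_def psi_below)
    qed
  qed
  then show "\<exists>a b. \<forall>x. u s x \<le> r \<longrightarrow> a \<le> x \<and> x \<le> b"
    by blast
qed

lemma W_bounds:
  assumes "critical 1 s S"
  shows "\<exists>a b. \<forall>x. W 1 s x \<le> r \<longrightarrow> a \<le> x \<and> x \<le> b"
proof -
  obtain B where B: "0 \<le> B" "\<And>y. B \<le> y \<Longrightarrow> r + 1 \<le> J 1 s y - c * y"
    using J_coercive[of s s "r + 1"] by (metis order_refl zero_le_one)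
  have "filterlim g at_top at_bot"
    using g_coercive by (rule filterlim_mono) (auto simp: at_bot_le_at_infinity)
  then have "eventually (\<lambda>x. r + g s + 1 \<le> g x) at_bot"
    by (simp add: filterlim_at_top)
  then obtain A where A: "\<And>x. x \<le> A \<Longrightarrow> r + g s + 1 \<le> g x"
    by (auto simp: eventually_at_bot_linorder)
  have "min A s \<le> x \<and> x \<le> max B s" if W: "W 1 s x \<le> r" for x
  proof
    show "x \<le> max B s"
    proof (rule ccontr)
      assume "\<not> x \<le> max B s"
      then have "r + 1 \<le> J 1 s x - c * x" "0 \<le> c * x" "s \<le> x"
        using B c_pos by auto
      then show False using W by (simp add: W_above)
    qed
    show "min A s \<le> x"
    proof (rule ccontr)
      assume "\<not> min A s \<le> x"
      then have "x \<le> A" "x \<le> s" by auto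
      then show False using W A[of x] by (simp add: W_below f_def)
    qed
  qed
  then show ?thesis by blast
qed

text \<open>Sublevel sets of W are bounded above, so the minimum over all nonnegative orders reduces
  to one over a compact interval.\<close>

lemma W_argmin_above:
  assumes crit: "critical 1 s S"
  shows "\<exists>y\<ge>x. \<forall>z\<ge>x. W 1 s y \<le> W 1 s z"
proof -
  obtain b where b: "\<And>z. W 1 s z \<le> W 1 s x \<Longrightarrow> z \<le> b"
    using W_bounds[OF crit, of "W 1 s x"] by blast
  obtain y where y: "y \<in> {x..b}" "\<forall>z\<in>{x..b}. W 1 s y \<le> W 1 s z"
    using continuous_attains_inf[of "{x..b}" "W 1 s"] b[of x]
      continuous_on_subset[OF W_continuous[of 1 s]] by auto
  have "W 1 s y \<le> W 1 s z" if "x \<le> z" for z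
  proof (cases "z \<le> b")
    case False
    then have "W 1 s x < W 1 s z" using b[of z] by force
    moreover have "W 1 s y \<le> W 1 s x" using y by auto
    ultimately show ?thesis by simp
  qed (use y that in auto)
  then show ?thesis using y by auto
qed

text \<open>Here the order of size 0 is also charged K. Since K > 0 and W(x) appears separately in
  the minimum, this does not change its value.\<close>

lemma J_eq_min_W:
  assumes crit: "critical 1 s S" and y: "x \<le> y" "\<And>z. x \<le> z \<Longrightarrow> W 1 s y \<le> W 1 s z"
  shows "J 1 s x = min (K + W 1 s y) (W 1 s x)"
proof (rule antisym)
  have "K * of_bool (x < y) \<le> K" using K_pos by (cases "x < y") auto
  then show "J 1 s x \<le> min (K + W 1 s y) (W 1 s x)"
    using J_le_W[OF _ _ crit, of x y] J_le_W[OF _ _ crit, of x x] y(1) by simp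
  have "0 \<le> sS_map s S x"
    using critical_less[OF crit] by (simp add: sS_map_def)
  then show "min (K + W 1 s y) (W 1 s x) \<le> J 1 s x"
    using J_eq_W_policy[OF _ _ crit, of x] y(2)[of "x + sS_map s S x"]
    by (cases "0 < sS_map s S x") auto
qed

end

section \<open>The controlled process\<close>

lemma space_action_space: "space action_space = {0..}"
  by (simp add: action_space_def)

lemma fst_state_action [measurable]: "fst \<in> state_action \<rightarrow>\<^sub>M borel"
  by (simp add: state_action_def)

lemma snd_state_action [measurable]: "snd \<in> state_action \<rightarrow>\<^sub>M borel"
proof -
  have "snd \<in> state_action \<rightarrow>\<^sub>M action_space"
    by (simp add: state_action_def)
  then show ?thesis
    by (auto simp: action_space_def measurable_restrict_space2_iff)
qed

lemma measurable_Pair_state_action: "Pair x \<in> action_space \<rightarrow>\<^sub>M state_action"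
  by (simp add: state_action_def)

lemma space_state_action: "space state_action = UNIV \<times> {0..}"
  by (simp add: state_action_def space_pair_measure space_action_space)

lemma measurable_coordinate:
  assumes "F \<in> N \<rightarrow>\<^sub>M L" "t \<in> T"
  shows "(\<lambda>\<omega>. F (\<omega> t)) \<in> PiM T (\<lambda>_. N) \<rightarrow>\<^sub>M L"
proof -
  have "(\<lambda>\<omega>. \<omega> t) \<in> PiM T (\<lambda>_. N) \<rightarrow>\<^sub>M N"
    using assms(2) by (rule measurable_component_singleton)
  then show ?thesis
    using assms(1) by (rule measurable_compose)
qed

lemma stationary_in_policies:
  assumes \<phi>: "\<phi> \<in> stationary_maps"
  shows "stationary \<phi> \<in> policies"
proof -
  have [measurable]: "\<phi> \<in> borel \<rightarrow>\<^sub>M action_space"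
    using \<phi> by (auto simp: stationary_maps_def action_space_def measurable_restrict_space2_iff)
  have "(\<lambda>p. return action_space (\<phi> (snd p))) \<in> N \<Otimes>\<^sub>M borel \<rightarrow>\<^sub>M prob_algebra action_space"
    for N :: "(nat \<Rightarrow> real \<times> real) measure"
    by (rule measurable_compose[OF _ measurable_return_prob_space]) measurable
  then show ?thesis
    by (simp add: policies_def stationary_def split_beta')
qed

locale inventory_path =
  fixes I :: "'w inventory" and \<pi> :: policy and x0 :: real
  assumes model: "inventory_model I" and policy: "\<pi> \<in> policies"
begin

sublocale IT: Ionescu_Tulcea "step I \<pi> x0" "\<lambda>_. state_action"
  by (rule Ionescu_Tulcea_step[OF model policy])

abbreviation hist :: "nat \<Rightarrow> (nat \<Rightarrow> real \<times> real) measure" where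
  "hist t \<equiv> IT.C 0 t (\<lambda>_. undefined)"

lemma process_eq_lim: "process I \<pi> x0 = IT.PF.lim"
  by (simp add: process_def)

lemma sets_process [measurable_cong]: "sets (process I \<pi> x0) = sets (PiM UNIV (\<lambda>_. state_action))"
  by (simp add: process_eq_lim)

lemma space_process: "space (process I \<pi> x0) = space (PiM UNIV (\<lambda>_. state_action))"
  by (simp add: process_eq_lim)

lemma space_hist: "space (hist t) = space (PiM {0..<t} (\<lambda>_. state_action))"
  by (simp add: IT.space_C)

lemma sets_hist [measurable_cong]: "sets (hist t) = sets (PiM {0..<t} (\<lambda>_. state_action))"
  by (simp add: IT.sets_C)

lemma action_nonneg: "\<omega> \<in> space (process I \<pi> x0) \<Longrightarrow> 0 \<le> snd (\<omega> t)"
  unfolding space_process by (auto simp: space_PiM PiE_iff space_state_action mem_Times_iff)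

text \<open>A function of period t depends on finitely many coordinates, so the Ionescu-Tulcea limit
  may be replaced by the finite-horizon measure it projects to.\<close>

lemma nn_integral_process_hist:
  assumes F: "F \<in> borel_measurable state_action"
  shows "(\<integral>\<^sup>+\<omega>. F (\<omega> t) \<partial>process I \<pi> x0) = (\<integral>\<^sup>+\<omega>. F (\<omega> t) \<partial>hist (Suc t))"
proof -
  let ?J = "{0..<Suc t}"
  let ?N = "PiM ?J (\<lambda>_. state_action)"
  \<comment> \<open>The coordinates 0 to t require t + 1 kernel steps; the projection on them is
    therefore the measure after \<open>Suc t\<close> steps, restricted to its own index set.\<close>
  have up_to: "IT.up_to ?J = Suc t"
  proof (rule antisym)
    show "IT.up_to ?J \<le> Suc t" by (simp add: IT.up_to_iff)
    show "Suc t \<le> IT.up_to ?J" using IT.up_to_less[of ?J t] by simp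
  qed
  have Ft: "(\<lambda>\<omega>. F (\<omega> t)) \<in> borel_measurable ?N"
    using F by (rule measurable_coordinate) simp
  have restr: "(\<lambda>\<omega>. restrict \<omega> ?J) \<in> IT.PF.lim \<rightarrow>\<^sub>M ?N"
    by (simp add: measurable_cong_sets[OF IT.PF.sets_lim refl] measurable_restrict_subset)
  have "(\<integral>\<^sup>+\<omega>. F (\<omega> t) \<partial>process I \<pi> x0) = (\<integral>\<^sup>+\<omega>. F (restrict \<omega> ?J t) \<partial>IT.PF.lim)"
    by (simp add: process_eq_lim)
  also have "\<dots> = (\<integral>\<^sup>+\<omega>. F (\<omega> t) \<partial>distr IT.PF.lim ?N (\<lambda>\<omega>. restrict \<omega> ?J))"
    using restr Ft by (subst nn_integral_distr) auto
  also have "distr IT.PF.lim ?N (\<lambda>\<omega>. restrict \<omega> ?J) = IT.CI ?J"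
    by (rule IT.distr_lim) simp
  also have "\<dots> = distr (hist (Suc t)) ?N (\<lambda>\<omega>. restrict \<omega> ?J)"
    by (simp only: IT.CI_def up_to)
  also have "(\<integral>\<^sup>+\<omega>. F (\<omega> t) \<partial>\<dots>) = (\<integral>\<^sup>+\<omega>. F (restrict \<omega> ?J t) \<partial>hist (Suc t))"
  proof (rule nn_integral_distr)
    show "(\<lambda>\<omega>. restrict \<omega> ?J) \<in> hist (Suc t) \<rightarrow>\<^sub>M ?N"
      unfolding measurable_cong_sets[OF sets_hist refl] by (rule measurable_restrict_subset) simp
  qed (use Ft in simp)
  finally show ?thesis by simp
qed

lemma nn_integral_process_step:
  assumes F: "F \<in> borel_measurable state_action"
  shows "(\<integral>\<^sup>+\<omega>. F (\<omega> t) \<partial>process I \<pi> x0) = (\<integral>\<^sup>+\<omega>. (\<integral>\<^sup>+p. F p \<partial>step I \<pi> x0 t \<omega>) \<partial>hist t)"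
proof -
  let ?N = "PiM {0..<Suc t} (\<lambda>_. state_action)"
  have Ft: "(\<lambda>\<omega>. F (\<omega> t)) \<in> borel_measurable ?N"
    using F by (rule measurable_coordinate) simp
  have "(\<integral>\<^sup>+\<omega>. F (\<omega> t) \<partial>hist (Suc t)) = (\<integral>\<^sup>+\<omega>. (\<integral>\<^sup>+\<omega>'. F (\<omega>' t) \<partial>IT.eP t \<omega>) \<partial>hist t)"
    using IT.measurable_eP[of t]
    by (simp add: nn_integral_bind[OF Ft] measurable_cong_sets[OF sets_hist refl])
  also have "\<dots> = (\<integral>\<^sup>+\<omega>. (\<integral>\<^sup>+p. F p \<partial>step I \<pi> x0 t \<omega>) \<partial>hist t)"
    by (rule nn_integral_cong) (simp add: space_hist IT.nn_integral_eP[OF _ Ft])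
  finally show ?thesis
    using nn_integral_process_hist[OF F, of t] by simp
qed

lemma nn_integral_step:
  assumes F: "F \<in> borel_measurable state_action" and \<omega>: "\<omega> \<in> space (hist t)"
  shows "(\<integral>\<^sup>+p. F p \<partial>step I \<pi> x0 t \<omega>) =
    (\<integral>\<^sup>+x. (\<integral>\<^sup>+a. F (x, a) \<partial>\<pi> t (\<omega>, x)) \<partial>state_law I x0 t \<omega>)"
proof -
  let ?H = "PiM {0..<t} (\<lambda>_. state_action)"
  have \<pi>t: "\<pi> t \<in> (?H \<Otimes>\<^sub>M borel) \<rightarrow>\<^sub>M prob_algebra action_space"
    using policy by (simp add: policies_def)
  have "Pair \<omega> \<in> borel \<rightarrow>\<^sub>M ?H \<Otimes>\<^sub>M borel"
    using \<omega> by (intro measurable_Pair1') (simp add: space_hist)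
  then have \<pi>: "(\<lambda>x. \<pi> t (\<omega>, x)) \<in> borel \<rightarrow>\<^sub>M prob_algebra action_space"
    using \<pi>t by (rule measurable_compose)
  have sets_state: "sets (state_law I x0 t \<omega>) = sets borel"
    by (simp add: state_law_def)
  have sets_\<pi>: "sets (\<pi> t (\<omega>, x)) = sets action_space" for x
    using measurable_space[OF \<pi>, of x] by (simp add: space_prob_algebra)
  have "(\<lambda>x. distr (\<pi> t (\<omega>, x)) state_action (Pair x)) \<in> borel \<rightarrow>\<^sub>M prob_algebra state_action"
    by (rule measurable_distr_prob_space2[OF \<pi>]) (simp add: state_action_def split_beta')
  then have kernel: "(\<lambda>x. distr (\<pi> t (\<omega>, x)) state_action (Pair x))
      \<in> state_law I x0 t \<omega> \<rightarrow>\<^sub>M subprob_algebra state_action"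
    by (simp add: measurable_cong_sets[OF sets_state refl] measurable_prob_algebraD)
  show ?thesis
    unfolding step_def nn_integral_bind[OF F kernel]
  proof (rule nn_integral_cong)
    fix x
    have "Pair x \<in> \<pi> t (\<omega>, x) \<rightarrow>\<^sub>M state_action"
      by (simp add: measurable_cong_sets[OF sets_\<pi> refl] measurable_Pair_state_action)
    then show "(\<integral>\<^sup>+p. F p \<partial>distr (\<pi> t (\<omega>, x)) state_action (Pair x)) =
        (\<integral>\<^sup>+a. F (x, a) \<partial>\<pi> t (\<omega>, x))"
      using F by (simp add: nn_integral_distr)
  qed
qed

text \<open>The policy chooses a probability law on actions, so the action integrates out.\<close>

lemma nn_integral_step_state:
  assumes G: "G \<in> borel_measurable borel" and \<omega>: "\<omega> \<in> space (hist t)"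
  shows "(\<integral>\<^sup>+p. G (fst p) \<partial>step I \<pi> x0 t \<omega>) = (\<integral>\<^sup>+x. G x \<partial>state_law I x0 t \<omega>)"
proof -
  have "\<pi> t \<in> (PiM {0..<t} (\<lambda>_. state_action) \<Otimes>\<^sub>M borel) \<rightarrow>\<^sub>M prob_algebra action_space"
    using policy by (simp add: policies_def)
  from measurable_space[OF this] \<omega>
  have "\<pi> t (\<omega>, x) \<in> space (prob_algebra action_space)" for x
    by (simp add: space_hist space_pair_measure)
  then have "emeasure (\<pi> t (\<omega>, x)) (space (\<pi> t (\<omega>, x))) = 1" for x
    by (simp add: space_prob_algebra prob_space.emeasure_space_1)
  then show ?thesis
    using G by (simp add: nn_integral_step[OF _ \<omega>])
qed

lemma nn_integral_state_0:
  assumes G: "G \<in> borel_measurable borel"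
  shows "(\<integral>\<^sup>+\<omega>. G (fst (\<omega> 0)) \<partial>process I \<pi> x0) = G x0"
proof -
  have "(\<integral>\<^sup>+\<omega>. G (fst (\<omega> 0)) \<partial>process I \<pi> x0)
      = (\<integral>\<^sup>+\<omega>. (\<integral>\<^sup>+p. G (fst p) \<partial>step I \<pi> x0 0 \<omega>) \<partial>hist 0)"
    by (rule nn_integral_process_step[OF measurable_compose[OF fst_state_action G]])
  also have "\<dots> = (\<integral>\<^sup>+\<omega>. G x0 \<partial>hist 0)"
    using G by (intro nn_integral_cong) (simp add: nn_integral_step_state state_law_def nn_integral_return)
  also have "\<dots> = G x0"
    using prob_space.emeasure_space_1[OF IT.prob_space_C[of "\<lambda>_. undefined" 0 0]]
    by (simp del: IT.C.simps)
  finally show ?thesis .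
qed

lemma nn_integral_state_Suc:
  assumes G: "G \<in> borel_measurable borel"
  shows "(\<integral>\<^sup>+\<omega>. G (fst (\<omega> (Suc t))) \<partial>process I \<pi> x0) =
    (\<integral>\<^sup>+\<omega>. (\<integral>\<^sup>+d. G (fst (\<omega> t) + snd (\<omega> t) - d) \<partial>demand_law I) \<partial>process I \<pi> x0)"
proof -
  have [measurable_cong]: "sets (demand_law I) = sets borel"
    by (simp add: demand_law_def)
  have D: "demand I 1 \<in> borel_measurable (prob_sp I)"
    using model by (auto simp: inventory_model_def)
  interpret L: prob_space "demand_law I"
    unfolding demand_law_def using model D
    by (intro prob_space.prob_space_distr) (auto simp: inventory_model_def)
  have H: "(\<lambda>p. \<integral>\<^sup>+d. G (fst p + snd p - d) \<partial>demand_law I) \<in> borel_measurable state_action"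
    using G by measurable
  have "(\<integral>\<^sup>+\<omega>. G (fst (\<omega> (Suc t))) \<partial>process I \<pi> x0)
      = (\<integral>\<^sup>+\<omega>. (\<integral>\<^sup>+p. G (fst p) \<partial>step I \<pi> x0 (Suc t) \<omega>) \<partial>hist (Suc t))"
    by (rule nn_integral_process_step[OF measurable_compose[OF fst_state_action G]])
  also have "\<dots> = (\<integral>\<^sup>+\<omega>. (\<integral>\<^sup>+d. G (fst (\<omega> t) + snd (\<omega> t) - d) \<partial>demand_law I) \<partial>hist (Suc t))"
  proof (rule nn_integral_cong)
    fix \<omega> assume "\<omega> \<in> space (hist (Suc t))"
    then show "(\<integral>\<^sup>+p. G (fst p) \<partial>step I \<pi> x0 (Suc t) \<omega>)
        = (\<integral>\<^sup>+d. G (fst (\<omega> t) + snd (\<omega> t) - d) \<partial>demand_law I)"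
      using G by (simp add: nn_integral_step_state state_law_def nn_integral_distr del: IT.C.simps)
  qed
  also have "\<dots> = (\<integral>\<^sup>+\<omega>. (\<integral>\<^sup>+d. G (fst (\<omega> t) + snd (\<omega> t) - d) \<partial>demand_law I) \<partial>process I \<pi> x0)"
    by (rule nn_integral_process_hist[OF H, symmetric])
  finally show ?thesis .
qed

text \<open>The action law is a point mass at \<phi>(x), so the recorded action may be replaced by
  \<phi> of the recorded state under the integral.\<close>

lemma nn_integral_stationary:
  assumes F: "F \<in> borel_measurable state_action"
    and \<pi>: "\<pi> = stationary \<phi>" and \<phi>: "\<phi> \<in> stationary_maps"
  shows "(\<integral>\<^sup>+\<omega>. F (\<omega> t) \<partial>process I \<pi> x0) =
    (\<integral>\<^sup>+\<omega>. F (fst (\<omega> t), \<phi> (fst (\<omega> t))) \<partial>process I \<pi> x0)"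
proof -
  have \<phi>': "\<phi> \<in> borel \<rightarrow>\<^sub>M action_space"
    using \<phi> by (auto simp: stationary_maps_def action_space_def measurable_restrict_space2_iff)
  have "(\<lambda>x. (x, \<phi> x)) \<in> borel \<rightarrow>\<^sub>M state_action"
    using \<phi>' by (simp add: state_action_def)
  then have G: "(\<lambda>x. F (x, \<phi> x)) \<in> borel_measurable borel"
    using F by (rule measurable_compose)
  have F': "(\<lambda>a. F (x, a)) \<in> borel_measurable action_space" for x
    using measurable_Pair_state_action F by (rule measurable_compose)
  have "(\<integral>\<^sup>+\<omega>. F (\<omega> t) \<partial>process I \<pi> x0) = (\<integral>\<^sup>+\<omega>. (\<integral>\<^sup>+p. F p \<partial>step I \<pi> x0 t \<omega>) \<partial>hist t)"
    by (rule nn_integral_process_step[OF F])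
  also have "\<dots> = (\<integral>\<^sup>+\<omega>. (\<integral>\<^sup>+p. F (fst p, \<phi> (fst p)) \<partial>step I \<pi> x0 t \<omega>) \<partial>hist t)"
  proof (rule nn_integral_cong)
    fix \<omega> assume \<omega>: "\<omega> \<in> space (hist t)"
    have "(\<integral>\<^sup>+p. F p \<partial>step I \<pi> x0 t \<omega>) = (\<integral>\<^sup>+x. F (x, \<phi> x) \<partial>state_law I x0 t \<omega>)"
      unfolding nn_integral_step[OF F \<omega>] unfolding \<pi> stationary_def
      using measurable_space[OF \<phi>'] by (simp add: nn_integral_return[OF _ F'])
    then show "(\<integral>\<^sup>+p. F p \<partial>step I \<pi> x0 t \<omega>) = (\<integral>\<^sup>+p. F (fst p, \<phi> (fst p)) \<partial>step I \<pi> x0 t \<omega>)"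
      by (simp add: nn_integral_step_state[OF G \<omega>])
  qed
  also have "\<dots> = (\<integral>\<^sup>+\<omega>. F (fst (\<omega> t), \<phi> (fst (\<omega> t))) \<partial>process I \<pi> x0)"
    by (rule nn_integral_process_step[OF measurable_compose[OF fst_state_action G], symmetric])
  finally show ?thesis .
qed

end

section \<open>Verification\<close>

lemma inventory_costs_of_model:
  assumes model: "inventory_model I"
  shows "inventory_costs (demand_law I) (exp_holding I) (unit_cost I) (fixed_cost I)"
proof -
  interpret prob_space "prob_sp I"
    using model by (simp add: inventory_model_def)
  have int: "integrable (prob_sp I) (demand I 1)"
    using model by (simp add: inventory_model_def)
  then have D [measurable]: "demand I 1 \<in> borel_measurable (prob_sp I)"
    by (rule borel_measurable_integrable)
  then have [measurable]: "demand I (Suc 0) \<in> borel_measurable (prob_sp I)"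
    by simp
  interpret L: prob_space "demand_law I"
    unfolding demand_law_def using D by (rule prob_space_distr)
  show ?thesis
  proof unfold_locales
    show "sets (demand_law I) = sets borel"
      by (simp add: demand_law_def)
    show "AE d in demand_law I. 0 \<le> d"
      unfolding demand_law_def using model by (subst AE_distr_iff) (auto simp: inventory_model_def)
    show "integrable (demand_law I) (\<lambda>d. d)"
      unfolding demand_law_def using int by (subst integrable_distr_eq) auto
    show "\<not> (AE d in demand_law I. d = 0)"
    proof
      assume "AE d in demand_law I. d = 0"
      then have "AE \<omega> in prob_sp I. demand I 1 \<omega> = 0"
        unfolding demand_law_def by (subst (asm) AE_distr_iff) auto
      then have "AE \<omega> in prob_sp I. \<not> 0 < demand I 1 \<omega>"
        by eventually_elim simp
      then have "measure (prob_sp I) {\<omega> \<in> space (prob_sp I). 0 < demand I 1 \<omega>} = 0"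
        by (subst prob_eq_0) (auto simp: prob_Collect_eq_0)
      then show False
        using model by (simp add: inventory_model_def)
    qed
  qed (use model in \<open>auto simp: inventory_model_def\<close>)
qed

text \<open>The subtracted term is nonnegative and only serves the induction.\<close>

lemma weighted_sum_le:
  fixes e :: "nat \<Rightarrow> real"
  assumes \<alpha>: "0 \<le> \<alpha>" "\<alpha> \<le> 1" and E: "\<And>n. (\<Sum>t<n. e t) \<le> B"
  shows "(\<Sum>t<n. \<alpha> ^ t * e t) \<le> B - \<alpha> ^ n * (B - (\<Sum>t<n. e t))"
proof (induction n)
  case (Suc n)
  have "\<alpha> ^ Suc n * (B - (\<Sum>t<Suc n. e t)) \<le> \<alpha> ^ n * (B - (\<Sum>t<Suc n. e t))"
    using E[of "Suc n"] \<alpha> by (intro mult_right_mono) (auto simp: mult_left_le_one_le)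
  then show ?case
    using Suc by (simp add: algebra_simps)
qed simp

text \<open>If the averages were eventually below some w' < w, the partial sums of C t - w' would be
  bounded above by a constant B, hence so would their discounted sums. Then (1 - \<alpha>) * m
  \<alpha> \<le> (1 - \<alpha>) * B + w', and \<alpha> -> 1 gives w \<le> w'.\<close>

lemma tauberian_limsup:
  fixes C :: "nat \<Rightarrow> ennreal" and m :: "real \<Rightarrow> real"
  assumes le: "eventually (\<lambda>\<alpha>. ennreal (m \<alpha>) \<le> (\<Sum>t. ennreal (\<alpha> ^ t) * C t)) (at_left 1)"
    and lim: "((\<lambda>\<alpha>. (1 - \<alpha>) * m \<alpha>) \<longlongrightarrow> w) (at_left 1)"
  shows "ennreal w \<le> limsup (\<lambda>N. (\<Sum>t<N. C t) / of_nat N)"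
proof (rule ccontr)
  assume "\<not> ennreal w \<le> limsup (\<lambda>N. (\<Sum>t<N. C t) / of_nat N)"
  then obtain b where b: "limsup (\<lambda>N. (\<Sum>t<N. C t) / of_nat N) < b" "b < ennreal w"
    using dense by (metis not_le)
  define w' where "w' = enn2real b"
  have b': "b = ennreal w'" and w': "0 \<le> w'" "w' < w"
    using b(2) by (auto simp: w'_def less_top[symmetric] ennreal_enn2real_if dest: order.strict_trans2[OF _ top_greatest]
        intro!: ennreal_less_iff[THEN iffD1])
  have "eventually (\<lambda>N. (\<Sum>t<N. C t) / of_nat N < b) sequentially"
    by (rule Limsup_lessD[OF b(1)])
  then obtain N0 where N0: "\<And>N. N0 \<le> N \<Longrightarrow> (\<Sum>t<N. C t) / of_nat N < b"
    by (auto simp: eventually_sequentially)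
  have S: "(\<Sum>t<N. C t) \<le> ennreal (w' * real N)" if "N0 \<le> N" "0 < N" for N
  proof -
    have "(\<Sum>t<N. C t) = (\<Sum>t<N. C t) / of_nat N * of_nat N"
      using that mult_divide_eq_ennreal[of "of_nat N" "\<Sum>t<N. C t"]
      by (simp add: ennreal_times_divide mult.commute)
    also have "\<dots> \<le> b * of_nat N"
      using N0[OF that(1)] by (intro mult_right_mono) auto
    also have "\<dots> = ennreal (w' * real N)"
      using w' by (simp add: b' ennreal_mult ennreal_of_nat_eq_real_of_nat)
    finally show ?thesis .
  qed
  \<comment> \<open>One infinite term would make all later averages infinite; finiteness lets the
    rest be done with real numbers.\<close>
  have fin: "C t \<noteq> \<top>" for t
  proof -
    have "C t \<le> (\<Sum>t<Suc (max N0 t). C t)"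
      by (rule member_le_sum) auto
    also have "\<dots> \<le> ennreal (w' * real (Suc (max N0 t)))"
      by (rule S) auto
    finally show ?thesis by (auto simp: top_unique)
  qed
  define c where "c t = enn2real (C t)" for t
  have c: "C t = ennreal (c t)" "0 \<le> c t" for t
    using fin[of t] by (auto simp: c_def less_top)
  \<comment> \<open>For N > N0 the sum of c t - w' is at most 0; up to N0 the averages are not
    controlled, and B simply adds up the costs.\<close>
  define B where "B = (\<Sum>t<Suc N0. c t)"
  have B: "(\<Sum>t<N. c t - w') \<le> B" for N
  proof (cases "N0 < N")
    case True
    have "ennreal (\<Sum>t<N. c t) \<le> ennreal (w' * real N)"
      using S[of N] True c by (simp add: sum_ennreal)
    then have "(\<Sum>t<N. c t) \<le> w' * real N"
      using w' by (subst (asm) ennreal_le_iff) auto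
    moreover have "0 \<le> B"
      unfolding B_def using c by (intro sum_nonneg)
    ultimately show ?thesis
      by (simp add: sum_subtractf mult.commute)
  next
    case False
    have "(\<Sum>t<N. c t - w') \<le> (\<Sum>t<N. c t)"
      using w' by (intro sum_mono) auto
    also have "\<dots> \<le> B"
      unfolding B_def using False c by (intro sum_mono2) auto
    finally show ?thesis .
  qed
  have bound: "(\<Sum>t. ennreal (\<alpha> ^ t) * C t) \<le> ennreal (B + w' / (1 - \<alpha>))" if \<alpha>: "0 \<le> \<alpha>" "\<alpha> < 1" for \<alpha>
  proof (rule suminf_le_const)
    fix n
    have "(\<Sum>t<n. \<alpha> ^ t * (c t - w')) \<le> B - \<alpha> ^ n * (B - (\<Sum>t<n. c t - w'))"
      using \<alpha> B by (intro weighted_sum_le) auto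
    also have "\<dots> \<le> B"
      using B[of n] \<alpha> by simp
    finally have "(\<Sum>t<n. \<alpha> ^ t * c t) \<le> B + w' * (\<Sum>t<n. \<alpha> ^ t)"
      by (simp add: right_diff_distrib sum_subtractf sum_distrib_left mult.commute)
    also have "(\<Sum>t<n. \<alpha> ^ t) \<le> 1 / (1 - \<alpha>)"
    proof -
      have "(\<Sum>t<n. \<alpha> ^ t) \<le> (\<Sum>t. \<alpha> ^ t)"
        using \<alpha> by (intro sum_le_suminf summable_geometric) auto
      then show ?thesis using \<alpha> by (simp add: suminf_geometric)
    qed
    finally have "(\<Sum>t<n. \<alpha> ^ t * c t) \<le> B + w' / (1 - \<alpha>)"
      using w' by (simp add: mult_left_mono)
    moreover have "(\<Sum>t<n. ennreal (\<alpha> ^ t) * C t) = ennreal (\<Sum>t<n. \<alpha> ^ t * c t)"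
      using \<alpha> c by (simp add: ennreal_mult[symmetric] sum_ennreal)
    ultimately show "(\<Sum>t<n. ennreal (\<alpha> ^ t) * C t) \<le> ennreal (B + w' / (1 - \<alpha>))"
      by (simp add: ennreal_leI)
  qed (rule summableI)
  have B0: "0 \<le> B"
    unfolding B_def using c by (intro sum_nonneg)
  have "eventually (\<lambda>\<alpha>. 0 \<le> \<alpha> \<and> \<alpha> < (1::real)) (at_left 1)"
    unfolding eventually_at_left_field by (intro exI[of _ 0]) auto
  with le have "eventually (\<lambda>\<alpha>. (1 - \<alpha>) * m \<alpha> \<le> (1 - \<alpha>) * B + w') (at_left 1)"
  proof eventually_elim
    case (elim \<alpha>)
    then have "ennreal (m \<alpha>) \<le> ennreal (B + w' / (1 - \<alpha>))"
      using bound[of \<alpha>] by auto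
    then have "m \<alpha> \<le> B + w' / (1 - \<alpha>)"
      using B0 w' elim by (subst (asm) ennreal_le_iff) auto
    then have "(1 - \<alpha>) * m \<alpha> \<le> (1 - \<alpha>) * (B + w' / (1 - \<alpha>))"
      using elim by (intro mult_left_mono) auto
    also have "\<dots> = (1 - \<alpha>) * B + w'"
      using elim by (simp add: distrib_left)
    finally show ?case .
  qed
  moreover have "((\<lambda>\<alpha>. (1 - \<alpha>) * B + w') \<longlongrightarrow> (1 - 1) * B + w') (at_left 1)"
    by (intro tendsto_intros)
  ultimately have "w \<le> (1 - 1) * B + w'"
    using lim by (intro tendsto_le[of "at_left 1"]) auto
  then show False using w' by simp
qed

locale inventory =
  fixes I :: "'w inventory"
  assumes model: "inventory_model I"
begin

sublocale inventory_costs "demand_law I" "exp_holding I" "unit_cost I" "fixed_cost I"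
  by (rule inventory_costs_of_model[OF model])

abbreviation K where "K \<equiv> fixed_cost I"
abbreviation c where "c \<equiv> unit_cost I"
abbreviation g where "g \<equiv> exp_holding I"

lemma cost_nonneg: "0 \<le> a \<Longrightarrow> 0 \<le> cost I x a"
  unfolding cost_def using K_pos c_pos g_nonneg by (intro add_nonneg_nonneg) auto

lemma g_measurable [measurable]: "g \<in> borel_measurable borel"
  by (rule borel_measurable_continuous_onI[OF g_continuous])

lemma cost_measurable [measurable]:
  "(\<lambda>p. cost I (fst p) (snd p)) \<in> borel_measurable state_action"
proof -
  have "(\<lambda>p. of_bool (0 < snd p) :: real) = (\<lambda>p. if 0 < snd p then 1 else 0)"
    by auto
  then have [measurable]: "(\<lambda>p. of_bool (0 < snd p) :: real) \<in> borel_measurable state_action"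
    by simp
  show ?thesis
    unfolding cost_def by measurable
qed

lemma post_nonneg: "(\<And>y. 0 \<le> V y) \<Longrightarrow> 0 \<le> post V y"
  unfolding post_def by (intro integral_nonneg_AE) auto

lemma post_measurable:
  assumes "continuous_on UNIV V"
  shows "(\<lambda>p. post V (fst p + snd p)) \<in> borel_measurable state_action"
proof -
  have [measurable]: "V \<in> borel_measurable borel"
    using assms by (rule borel_measurable_continuous_onI)
  show ?thesis
    unfolding post_def by measurable
qed

section \<open>Expected costs and states along an arbitrary policy\<close>

definition exp_cost :: "policy \<Rightarrow> real \<Rightarrow> nat \<Rightarrow> ennreal" where
  "exp_cost \<pi> x t = (\<integral>\<^sup>+\<omega>. ennreal (cost I (fst (\<omega> t)) (snd (\<omega> t))) \<partial>process I \<pi> x)"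

definition exp_state :: "(real \<Rightarrow> real) \<Rightarrow> policy \<Rightarrow> real \<Rightarrow> nat \<Rightarrow> ennreal" where
  "exp_state V \<pi> x t = (\<integral>\<^sup>+\<omega>. ennreal (V (fst (\<omega> t))) \<partial>process I \<pi> x)"

context
  fixes \<pi> :: policy and x :: real
  assumes \<pi>: "\<pi> \<in> policies"
begin

interpretation path: inventory_path I \<pi> x
  using model \<pi> by unfold_locales

lemma path_measurable:
  "F \<in> state_action \<rightarrow>\<^sub>M N \<Longrightarrow> (\<lambda>\<omega>. F (\<omega> t)) \<in> process I \<pi> x \<rightarrow>\<^sub>M N"
  unfolding measurable_cong_sets[OF path.sets_process refl] by (rule measurable_coordinate) simp_all

lemma nn_integral_const_process: "(\<integral>\<^sup>+\<omega>. k \<partial>process I \<pi> x) = k"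
  using path.nn_integral_state_0[of "\<lambda>_. k"] by simp

lemma disc_cost_eq:
  assumes \<alpha>: "0 \<le> \<alpha>"
  shows "disc_cost I \<alpha> \<pi> x = (\<Sum>t. ennreal (\<alpha> ^ t) * exp_cost \<pi> x t)"
proof -
  have m: "(\<lambda>\<omega>. cost I (fst (\<omega> t)) (snd (\<omega> t))) \<in> borel_measurable (process I \<pi> x)" for t
    using path_measurable[OF cost_measurable] .
  have "disc_cost I \<alpha> \<pi> x =
      (\<integral>\<^sup>+\<omega>. (\<Sum>t. ennreal (\<alpha> ^ t) * ennreal (cost I (fst (\<omega> t)) (snd (\<omega> t)))) \<partial>process I \<pi> x)"
    unfolding disc_cost_def using \<alpha> path.action_nonneg cost_nonneg
    by (intro nn_integral_cong suminf_cong) (simp add: ennreal_mult)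
  also have "\<dots> = (\<Sum>t. ennreal (\<alpha> ^ t) * exp_cost \<pi> x t)"
    unfolding exp_cost_def using m by (subst nn_integral_suminf) (auto simp: nn_integral_cmult)
  finally show ?thesis .
qed

lemma avg_cost_eq: "avg_cost I \<pi> x = limsup (\<lambda>N. (\<Sum>t<N. exp_cost \<pi> x t) / of_nat N)"
proof -
  have m: "(\<lambda>\<omega>. cost I (fst (\<omega> t)) (snd (\<omega> t))) \<in> borel_measurable (process I \<pi> x)" for t
    using path_measurable[OF cost_measurable] .
  show ?thesis
    unfolding avg_cost_def exp_cost_def using m by (subst nn_integral_sum) auto
qed

lemma exp_state_0: "continuous_on UNIV V \<Longrightarrow> exp_state V \<pi> x 0 = ennreal (V x)"
  unfolding exp_state_def
  using path.nn_integral_state_0[of "\<lambda>x. ennreal (V x)"] borel_measurable_continuous_onI[of V]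
  by simp

context
  fixes V :: "real \<Rightarrow> real"
  assumes V: "continuous_on UNIV V" "\<And>y. integrable (demand_law I) (\<lambda>d. V (y - d))" "\<And>y. 0 \<le> V y"
begin

lemma exp_state_Suc:
  "exp_state V \<pi> x (Suc t) = (\<integral>\<^sup>+\<omega>. ennreal (post V (fst (\<omega> t) + snd (\<omega> t))) \<partial>process I \<pi> x)"
proof -
  have m: "(\<lambda>x. ennreal (V x)) \<in> borel_measurable borel"
    using borel_measurable_continuous_onI[OF V(1)] by measurable
  have "(\<integral>\<^sup>+d. ennreal (V (y - d)) \<partial>demand_law I) = ennreal (post V y)" for y
    unfolding post_def using V by (intro nn_integral_eq_integral) auto
  then show ?thesis
    unfolding exp_state_def path.nn_integral_state_Suc[OF m] by simp
qed

lemma exp_cost_plus_state: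
  assumes \<alpha>: "0 \<le> \<alpha>"
  shows "exp_cost \<pi> x t + ennreal \<alpha> * exp_state V \<pi> x (Suc t) =
    (\<integral>\<^sup>+\<omega>. ennreal (cost I (fst (\<omega> t)) (snd (\<omega> t)) + \<alpha> * post V (fst (\<omega> t) + snd (\<omega> t)))
      \<partial>process I \<pi> x)"
proof -
  have m: "(\<lambda>\<omega>. cost I (fst (\<omega> t)) (snd (\<omega> t))) \<in> borel_measurable (process I \<pi> x)"
    "(\<lambda>\<omega>. post V (fst (\<omega> t) + snd (\<omega> t))) \<in> borel_measurable (process I \<pi> x)"
    using path_measurable[OF cost_measurable] path_measurable[OF post_measurable[OF V(1)]] .
  have "exp_cost \<pi> x t + ennreal \<alpha> * exp_state V \<pi> x (Suc t) =
      (\<integral>\<^sup>+\<omega>. ennreal (cost I (fst (\<omega> t)) (snd (\<omega> t))) +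
        ennreal \<alpha> * ennreal (post V (fst (\<omega> t) + snd (\<omega> t))) \<partial>process I \<pi> x)"
    unfolding exp_state_Suc exp_cost_def using m
    by (subst nn_integral_add) (auto simp: nn_integral_cmult)
  also have "\<dots> = (\<integral>\<^sup>+\<omega>. ennreal (cost I (fst (\<omega> t)) (snd (\<omega> t)) +
      \<alpha> * post V (fst (\<omega> t) + snd (\<omega> t))) \<partial>process I \<pi> x)"
    using \<alpha> path.action_nonneg cost_nonneg post_nonneg[OF V(3)]
    by (intro nn_integral_cong) (simp add: ennreal_mult)
  finally show ?thesis .
qed

lemma exp_cost_plus_state_stationary:
  assumes \<alpha>: "0 \<le> \<alpha>" and \<phi>: "\<pi> = stationary \<phi>" "\<phi> \<in> stationary_maps"
  shows "exp_cost \<pi> x t + ennreal \<alpha> * exp_state V \<pi> x (Suc t) =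
    (\<integral>\<^sup>+\<omega>. ennreal (cost I (fst (\<omega> t)) (\<phi> (fst (\<omega> t))) +
      \<alpha> * post V (fst (\<omega> t) + \<phi> (fst (\<omega> t)))) \<partial>process I \<pi> x)"
proof -
  have "(\<lambda>p. ennreal (cost I (fst p) (snd p) + \<alpha> * post V (fst p + snd p))) \<in> borel_measurable state_action"
    using post_measurable[OF V(1)] cost_measurable by measurable
  from path.nn_integral_stationary[OF this \<phi>] show ?thesis
    unfolding exp_cost_plus_state[OF \<alpha>] by simp
qed

text \<open>The initial state is deterministic, so at time 0 the expectation is the right-hand side
  of the optimality equation at the single point x; this pointwise form later identifies optimal
  policies.\<close>

lemma exp_cost_plus_state_0:
  assumes \<alpha>: "0 \<le> \<alpha>" and \<phi>: "\<pi> = stationary \<phi>" "\<phi> \<in> stationary_maps"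
  shows "exp_cost \<pi> x 0 + ennreal \<alpha> * exp_state V \<pi> x 1 =
    ennreal (cost I x (\<phi> x) + \<alpha> * post V (x + \<phi> x))"
proof -
  have [measurable]: "\<phi> \<in> borel_measurable borel"
    using \<phi> by (simp add: stationary_maps_def)
  have [measurable]: "V \<in> borel_measurable borel"
    by (rule borel_measurable_continuous_onI[OF V(1)])
  have "(\<lambda>x. of_bool (0 < \<phi> x) :: real) = (\<lambda>x. if 0 < \<phi> x then 1 else 0)"
    by auto
  then have [measurable]: "(\<lambda>x. of_bool (0 < \<phi> x) :: real) \<in> borel_measurable borel"
    by simp
  have "(\<lambda>x. ennreal (cost I x (\<phi> x) + \<alpha> * post V (x + \<phi> x))) \<in> borel_measurable borel"
    unfolding cost_def post_def by measurable
  from path.nn_integral_state_0[OF this] show ?thesis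
    using exp_cost_plus_state_stationary[OF \<alpha> \<phi>, of 0] by simp
qed

lemma exp_state_le:
  assumes \<alpha>: "0 \<le> \<alpha>" and le: "\<And>x a. 0 \<le> a \<Longrightarrow> V x \<le> cost I x a + \<alpha> * post V (x + a)"
  shows "exp_state V \<pi> x t \<le> exp_cost \<pi> x t + ennreal \<alpha> * exp_state V \<pi> x (Suc t)"
  unfolding exp_cost_plus_state[OF \<alpha>] unfolding exp_state_def
  using path.action_nonneg le by (intro nn_integral_mono ennreal_leI) simp

text \<open>The left-hand side starts after the first action rather than with V x. This retains the
  loss of a first action that is not minimizing.\<close>

lemma iterate_exp_state_le:
  assumes \<alpha>: "0 \<le> \<alpha>" and le: "\<And>x a. 0 \<le> a \<Longrightarrow> V x \<le> cost I x a + \<alpha> * post V (x + a)"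
  shows "exp_cost \<pi> x 0 + ennreal \<alpha> * exp_state V \<pi> x 1 \<le>
    (\<Sum>t<Suc n. ennreal (\<alpha> ^ t) * exp_cost \<pi> x t) + ennreal (\<alpha> ^ Suc n) * exp_state V \<pi> x (Suc n)"
proof (induction n)
  case (Suc n)
  have "ennreal (\<alpha> ^ Suc n) * exp_state V \<pi> x (Suc n) \<le>
      ennreal (\<alpha> ^ Suc n) * (exp_cost \<pi> x (Suc n) + ennreal \<alpha> * exp_state V \<pi> x (Suc (Suc n)))"
    using exp_state_le[OF assms] by (intro mult_left_mono) auto
  also have "\<dots> = ennreal (\<alpha> ^ Suc n) * exp_cost \<pi> x (Suc n) +
      ennreal (\<alpha> ^ Suc (Suc n)) * exp_state V \<pi> x (Suc (Suc n))"
    using \<alpha> by (simp add: distrib_left mult.assoc[symmetric] ennreal_mult[symmetric] mult.commute del: power_Suc)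
      (simp add: mult.commute)
  finally have "(\<Sum>t<Suc n. ennreal (\<alpha> ^ t) * exp_cost \<pi> x t) + ennreal (\<alpha> ^ Suc n) * exp_state V \<pi> x (Suc n)
      \<le> (\<Sum>t<Suc (Suc n). ennreal (\<alpha> ^ t) * exp_cost \<pi> x t) +
        ennreal (\<alpha> ^ Suc (Suc n)) * exp_state V \<pi> x (Suc (Suc n))"
    by (simp add: add.assoc add_left_mono del: power_Suc)
  with Suc show ?case by (rule order_trans)
qed simp

lemma disc_cost_upper:
  assumes \<alpha>: "0 \<le> \<alpha>" and \<phi>: "\<pi> = stationary \<phi>" "\<phi> \<in> stationary_maps"
    and eq: "\<And>x. V x = cost I x (\<phi> x) + \<alpha> * post V (x + \<phi> x)"
  shows "disc_cost I \<alpha> \<pi> x \<le> ennreal (V x)"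
  unfolding disc_cost_eq[OF \<alpha>]
proof (rule suminf_le_const)
  fix n
  have step: "exp_state V \<pi> x t = exp_cost \<pi> x t + ennreal \<alpha> * exp_state V \<pi> x (Suc t)" for t
    unfolding exp_cost_plus_state_stationary[OF \<alpha> \<phi>] eq[symmetric] by (rule exp_state_def)
  have "(\<Sum>t<n. ennreal (\<alpha> ^ t) * exp_cost \<pi> x t) + ennreal (\<alpha> ^ n) * exp_state V \<pi> x n = ennreal (V x)"
  proof (induction n)
    case (Suc n)
    have "ennreal (\<alpha> ^ n) * exp_state V \<pi> x n =
        ennreal (\<alpha> ^ n) * exp_cost \<pi> x n + ennreal (\<alpha> ^ Suc n) * exp_state V \<pi> x (Suc n)"
      unfolding step[of n] using \<alpha>
      by (simp add: distrib_left mult.assoc[symmetric] ennreal_mult[symmetric] mult.commute)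
    then show ?case
      using Suc by (simp add: add.assoc del: power_Suc)
  qed (use exp_state_0[OF V(1)] in simp)
  then show "(\<Sum>t<n. ennreal (\<alpha> ^ t) * exp_cost \<pi> x t) \<le> ennreal (V x)"
    by (metis le_iff_add)
qed (rule summableI)

text \<open>The equation telescopes to total cost + E[V(x_n)] = w * n + V(x). Dropping the
  nonnegative E[V(x_n)] and dividing by n leaves w + V(x) / n.\<close>

lemma avg_cost_upper:
  assumes w: "0 \<le> w" and \<phi>: "\<pi> = stationary \<phi>" "\<phi> \<in> stationary_maps"
    and eq: "\<And>x. w + V x = cost I x (\<phi> x) + post V (x + \<phi> x)"
  shows "avg_cost I \<pi> x \<le> ennreal w"
proof -
  have Vm: "(\<lambda>\<omega>. V (fst (\<omega> t))) \<in> borel_measurable (process I \<pi> x)" for t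
    using path_measurable[OF measurable_compose[OF fst_state_action borel_measurable_continuous_onI[OF V(1)]]] .
  have step: "exp_cost \<pi> x t + exp_state V \<pi> x (Suc t) = ennreal w + exp_state V \<pi> x t" for t
  proof -
    have "exp_cost \<pi> x t + exp_state V \<pi> x (Suc t) =
        (\<integral>\<^sup>+\<omega>. ennreal w + ennreal (V (fst (\<omega> t))) \<partial>process I \<pi> x)"
      using exp_cost_plus_state_stationary[of 1, OF _ \<phi>, of t] w V(3)
      by (simp add: eq[symmetric] ennreal_plus)
    also have "\<dots> = ennreal w + exp_state V \<pi> x t"
      unfolding exp_state_def using Vm nn_integral_const_process[of "ennreal w"]
      by (simp add: nn_integral_add del: nn_integral_const)
    finally show ?thesis .
  qed
  have sum: "(\<Sum>t<n. exp_cost \<pi> x t) + exp_state V \<pi> x n = ennreal (w * real n + V x)" for n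
  proof (induction n)
    case 0
    then show ?case using exp_state_0[OF V(1)] by simp
  next
    case (Suc n)
    have "(\<Sum>t<Suc n. exp_cost \<pi> x t) + exp_state V \<pi> x (Suc n) =
        ennreal w + ((\<Sum>t<n. exp_cost \<pi> x t) + exp_state V \<pi> x n)"
      using step[of n] by (simp add: add.assoc add.left_commute)
    also have "\<dots> = ennreal (w * real (Suc n) + V x)"
      unfolding Suc using w V(3)[of x] by (simp add: ennreal_plus[symmetric] algebra_simps del: ennreal_plus)
    finally show ?case .
  qed
  have "avg_cost I \<pi> x \<le> limsup (\<lambda>n. ennreal (w + V x / real n))"
    unfolding avg_cost_eq
  proof (rule Limsup_mono)
    show "eventually (\<lambda>n. (\<Sum>t<n. exp_cost \<pi> x t) / of_nat n \<le> ennreal (w + V x / real n)) sequentially"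
      using eventually_gt_at_top[of 0]
    proof eventually_elim
      case (elim n)
      have "(\<Sum>t<n. exp_cost \<pi> x t) \<le> ennreal (w * real n + V x)"
        using sum[of n] by (metis le_iff_add)
      then have "(\<Sum>t<n. exp_cost \<pi> x t) / of_nat n \<le> ennreal (w * real n + V x) / of_nat n"
        by (rule divide_right_mono_ennreal)
      also have "\<dots> = ennreal ((w * real n + V x) / real n)"
        using elim w V(3)[of x]
        by (simp add: divide_ennreal ennreal_of_nat_eq_real_of_nat del: ennreal_plus)
      also have "(w * real n + V x) / real n = w + V x / real n"
        using elim by (simp add: add_divide_distrib)
      finally show ?case .
    qed
  qed
  also have "\<dots> = ennreal w"
  proof (rule lim_imp_Limsup)
    have "(\<lambda>n. w + V x / real n) \<longlonglongrightarrow> w + 0"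
      by (intro tendsto_add tendsto_const lim_const_over_n)
    then show "(\<lambda>n. ennreal (w + V x / real n)) \<longlonglongrightarrow> ennreal w"
      by (intro tendsto_ennrealI) simp
  qed simp
  finally show ?thesis .
qed

end

text \<open>Orders only raise the level, so the backlog grows by at most the demand in each
  period.\<close>

lemma exp_negative_part:
  "exp_state (\<lambda>y. max 0 (- y)) \<pi> x t \<le> ennreal (max 0 (- x) + real t * mean)"
proof (induction t)
  case 0
  have "continuous_on UNIV (\<lambda>y::real. max 0 (- y))"
    by (intro continuous_intros)
  then show ?case using exp_state_0 by simp
next
  case (Suc t)
  have m: "(\<lambda>\<omega>. max 0 (- fst (\<omega> t))) \<in> borel_measurable (process I \<pi> x)"
  proof -
    have "(\<lambda>p. max 0 (- fst p)) \<in> borel_measurable state_action"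
      by measurable
    then show ?thesis by (rule path_measurable)
  qed
  have "exp_state (\<lambda>y. max 0 (- y)) \<pi> x (Suc t) =
      (\<integral>\<^sup>+\<omega>. (\<integral>\<^sup>+d. ennreal (max 0 (- (fst (\<omega> t) + snd (\<omega> t) - d))) \<partial>demand_law I) \<partial>process I \<pi> x)"
    unfolding exp_state_def by (intro path.nn_integral_state_Suc) measurable
  also have "\<dots> \<le> (\<integral>\<^sup>+\<omega>. ennreal (max 0 (- fst (\<omega> t))) + ennreal mean \<partial>process I \<pi> x)"
  proof (rule nn_integral_mono)
    fix \<omega> assume \<omega>: "\<omega> \<in> space (process I \<pi> x)"
    have "(\<integral>\<^sup>+d. ennreal (max 0 (- (fst (\<omega> t) + snd (\<omega> t) - d))) \<partial>demand_law I)
        \<le> (\<integral>\<^sup>+d. ennreal (max 0 (- fst (\<omega> t))) + ennreal d \<partial>demand_law I)"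
    proof (rule nn_integral_mono_AE)
      show "AE d in demand_law I. ennreal (max 0 (- (fst (\<omega> t) + snd (\<omega> t) - d)))
          \<le> ennreal (max 0 (- fst (\<omega> t))) + ennreal d"
        using demand_nonneg
      proof eventually_elim
        case (elim d)
        then have "max 0 (- (fst (\<omega> t) + snd (\<omega> t) - d)) \<le> max 0 (- fst (\<omega> t)) + d"
          using path.action_nonneg[OF \<omega>, of t] by auto
        then have "ennreal (max 0 (- (fst (\<omega> t) + snd (\<omega> t) - d))) \<le> ennreal (max 0 (- fst (\<omega> t)) + d)"
          by (rule ennreal_leI)
        also have "\<dots> = ennreal (max 0 (- fst (\<omega> t))) + ennreal d"
          using elim by (intro ennreal_plus) auto
        finally show ?case .
      qed
    qed
    also have "\<dots> = ennreal (max 0 (- fst (\<omega> t))) + ennreal mean"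
    proof -
      have "(\<integral>\<^sup>+d. ennreal d \<partial>demand_law I) = ennreal mean"
        unfolding mean_def using integrable_demand demand_nonneg by (rule nn_integral_eq_integral)
      then show ?thesis
        using emeasure_space_1 by (subst nn_integral_add) auto
    qed
    finally show "(\<integral>\<^sup>+d. ennreal (max 0 (- (fst (\<omega> t) + snd (\<omega> t) - d))) \<partial>demand_law I)
        \<le> ennreal (max 0 (- fst (\<omega> t))) + ennreal mean" .
  qed
  also have "\<dots> = exp_state (\<lambda>y. max 0 (- y)) \<pi> x t + ennreal mean"
    unfolding exp_state_def using m nn_integral_const_process[of "ennreal mean"]
    by (simp add: nn_integral_add del: nn_integral_const)
  also have "\<dots> \<le> ennreal (max 0 (- x) + real t * mean) + ennreal mean"
    using Suc by (rule add_right_mono)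
  also have "\<dots> = ennreal (max 0 (- x) + real (Suc t) * mean)"
    using mean_nonneg by (subst ennreal_plus[symmetric]) (auto simp: algebra_simps)
  finally show ?case .
qed

text \<open>The holding cost g(x_t + a_t) that bounds the next value is itself part of the cost of
  period t. What remains grows linearly in t, which \<alpha>^t suppresses.\<close>

lemma exp_state_v_growth:
  assumes \<alpha>: "0 \<le> \<alpha>" "\<alpha> < 1" and crit: "critical \<alpha> s S"
  obtains C where "0 \<le> C" "\<And>t. exp_state (v \<alpha> s) \<pi> x (Suc t) \<le>
    ennreal (1 / (1 - \<alpha>)) * exp_cost \<pi> x t + ennreal (c * (max 0 (- x) + real t * mean) + C)"
proof -
  obtain C where C: "0 \<le> C"
    "\<And>y. post (v \<alpha> s) y \<le> g y / (1 - \<alpha>) + c * max 0 (- y) + C"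
    using post_v_growth[OF assms] by blast
  note V = v_admissible[OF assms]
  show thesis
  proof (rule that[OF C(1)])
    fix t
    have m: "(\<lambda>\<omega>. max 0 (- fst (\<omega> t))) \<in> borel_measurable (process I \<pi> x)"
      "(\<lambda>\<omega>. cost I (fst (\<omega> t)) (snd (\<omega> t))) \<in> borel_measurable (process I \<pi> x)"
    proof -
      have "(\<lambda>p. max 0 (- fst p)) \<in> borel_measurable state_action"
        by measurable
      then show "(\<lambda>\<omega>. max 0 (- fst (\<omega> t))) \<in> borel_measurable (process I \<pi> x)"
        by (rule path_measurable)
    qed (rule path_measurable[OF cost_measurable])
    have "exp_state (v \<alpha> s) \<pi> x (Suc t) \<le> (\<integral>\<^sup>+\<omega>. ennreal (1 / (1 - \<alpha>)) *
        ennreal (cost I (fst (\<omega> t)) (snd (\<omega> t))) + (ennreal c * ennreal (max 0 (- fst (\<omega> t))) + ennreal C)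
        \<partial>process I \<pi> x)"
      unfolding exp_state_Suc[OF V]
    proof (rule nn_integral_mono)
      fix \<omega> assume \<omega>: "\<omega> \<in> space (process I \<pi> x)"
      define y a where "y = fst (\<omega> t)" and "a = snd (\<omega> t)"
      have a: "0 \<le> a" using path.action_nonneg[OF \<omega>] by (simp add: a_def)
      have "g (y + a) \<le> cost I y a"
        using a K_pos c_pos by (simp add: cost_def)
      then have "g (y + a) / (1 - \<alpha>) \<le> cost I y a / (1 - \<alpha>)"
        using \<alpha> by (intro divide_right_mono) auto
      moreover have "c * max 0 (- (y + a)) \<le> c * max 0 (- y)"
        using a c_pos by (intro mult_left_mono) auto
      ultimately have "post (v \<alpha> s) (y + a) \<le> 1 / (1 - \<alpha>) * cost I y a + (c * max 0 (- y) + C)"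
        using C(2)[of "y + a"] by simp
      then have "ennreal (post (v \<alpha> s) (y + a)) \<le>
          ennreal (1 / (1 - \<alpha>) * cost I y a + (c * max 0 (- y) + C))"
        by (rule ennreal_leI)
      also have "\<dots> = ennreal (1 / (1 - \<alpha>)) * ennreal (cost I y a) +
          (ennreal c * ennreal (max 0 (- y)) + ennreal C)"
      proof -
        have *: "ennreal (p * q + (r * z + C)) = ennreal p * ennreal q + (ennreal r * ennreal z + ennreal C)"
          if "0 \<le> p" "0 \<le> q" "0 \<le> r" "0 \<le> z" for p q r z
          using that C(1) by (simp add: ennreal_mult ennreal_plus)
        show ?thesis
          by (rule *) (use \<alpha> c_pos cost_nonneg[OF a] in auto)
      qed
      finally show "ennreal (post (v \<alpha> s) (fst (\<omega> t) + snd (\<omega> t))) \<le>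
          ennreal (1 / (1 - \<alpha>)) * ennreal (cost I (fst (\<omega> t)) (snd (\<omega> t))) +
          (ennreal c * ennreal (max 0 (- fst (\<omega> t))) + ennreal C)"
        by (simp add: y_def a_def)
    qed
    also have "\<dots> = ennreal (1 / (1 - \<alpha>)) * exp_cost \<pi> x t +
        (ennreal c * exp_state (\<lambda>y. max 0 (- y)) \<pi> x t + ennreal C)"
      unfolding exp_cost_def exp_state_def using m nn_integral_const_process[of "ennreal C"]
      by (simp add: nn_integral_add nn_integral_cmult del: nn_integral_const)
    also have "\<dots> \<le> ennreal (1 / (1 - \<alpha>)) * exp_cost \<pi> x t +
        (ennreal c * ennreal (max 0 (- x) + real t * mean) + ennreal C)"
      by (intro add_mono order_refl mult_left_mono exp_negative_part) simp
    also have "ennreal c * ennreal (max 0 (- x) + real t * mean) + ennreal C =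
        ennreal (c * (max 0 (- x) + real t * mean) + C)"
      using c_pos C(1) mean_nonneg
      by (simp add: ennreal_mult[symmetric] ennreal_plus[symmetric] del: ennreal_plus)
    finally show "exp_state (v \<alpha> s) \<pi> x (Suc t) \<le>
        ennreal (1 / (1 - \<alpha>)) * exp_cost \<pi> x t + ennreal (c * (max 0 (- x) + real t * mean) + C)" .
  qed
qed

text \<open>For finite discounted cost the terms \<alpha>^t * E[cost] tend to 0, and through the
  growth bound so does the remainder \<alpha>^n * E[v(x_n)] of the iterated inequality.\<close>

lemma disc_cost_lower:
  assumes \<alpha>: "0 \<le> \<alpha>" "\<alpha> < 1" and crit: "critical \<alpha> s S"
  shows "exp_cost \<pi> x 0 + ennreal \<alpha> * exp_state (v \<alpha> s) \<pi> x 1 \<le> disc_cost I \<alpha> \<pi> x"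
proof (cases "disc_cost I \<alpha> \<pi> x = \<top>")
  case False
  note V = v_admissible[OF assms]
  have le: "v \<alpha> s x \<le> cost I x a + \<alpha> * post (v \<alpha> s) (x + a)" if "0 \<le> a" for x a
    using v_le[OF assms that] by (simp add: cost_def)
  obtain C where C: "0 \<le> C" "\<And>t. exp_state (v \<alpha> s) \<pi> x (Suc t) \<le>
    ennreal (1 / (1 - \<alpha>)) * exp_cost \<pi> x t + ennreal (c * (max 0 (- x) + real t * mean) + C)"
    using exp_state_v_growth[OF assms] by blast
  define k where "k t = ennreal (\<alpha> ^ t) * exp_cost \<pi> x t" for t
  have sum_k: "(\<Sum>t. k t) = disc_cost I \<alpha> \<pi> x"
    using disc_cost_eq[OF \<alpha>(1)] by (simp add: k_def)
  have k_le: "(\<Sum>t<n. k t) \<le> disc_cost I \<alpha> \<pi> x" for n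
    unfolding sum_k[symmetric] by (rule sum_le_suminf) (auto intro: summableI)
  have "k t \<noteq> \<top>" for t
  proof -
    have "k t \<le> (\<Sum>t<Suc t. k t)"
      by (rule member_le_sum) auto
    then show ?thesis
      using k_le[of "Suc t"] False by (metis top_unique)
  qed
  then have k: "k t = ennreal (enn2real (k t))" for t
    by (simp add: less_top)
  have "summable (\<lambda>t. enn2real (k t))"
    using False sum_k k by (intro summable_suminf_not_top) auto
  then have k0: "(\<lambda>t. enn2real (k t)) \<longlonglongrightarrow> 0"
    by (rule summable_LIMSEQ_zero)
  \<comment> \<open>The bound on the remainder, arranged as a combination of three null sequences:
    the discounted cost terms, \<alpha>^t and t * \<alpha>^t.\<close>
  define b where
    "b t = enn2real (k t) / (1 - \<alpha>) + (\<alpha> ^ t * (c * max 0 (- x) + C) + c * mean * (real t * \<alpha> ^ t))" for t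
  have b: "b \<longlonglongrightarrow> 0 / (1 - \<alpha>) + (0 * (c * max 0 (- x) + C) + c * mean * 0)"
    unfolding b_def using \<alpha>
    by (intro tendsto_intros k0 LIMSEQ_power_zero powser_times_n_limit_0) auto
  have bound: "exp_cost \<pi> x 0 + ennreal \<alpha> * exp_state (v \<alpha> s) \<pi> x 1 \<le> disc_cost I \<alpha> \<pi> x + ennreal (b n)" for n
  proof -
    have "ennreal (\<alpha> ^ Suc n) * exp_state (v \<alpha> s) \<pi> x (Suc n) \<le>
        ennreal (\<alpha> ^ n) * exp_state (v \<alpha> s) \<pi> x (Suc n)"
      using \<alpha> by (intro mult_right_mono ennreal_leI) (auto simp: mult_left_le_one_le)
    also have "\<dots> \<le> ennreal (\<alpha> ^ n) *
        (ennreal (1 / (1 - \<alpha>)) * exp_cost \<pi> x n + ennreal (c * (max 0 (- x) + real n * mean) + C))"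
      using C(2) by (intro mult_left_mono) auto
    also have "\<dots> = ennreal (1 / (1 - \<alpha>)) * k n +
        ennreal (\<alpha> ^ n) * ennreal (c * (max 0 (- x) + real n * mean) + C)"
      by (simp add: k_def distrib_left ac_simps)
    also have "\<dots> = ennreal (b n)"
    proof -
      have "0 \<le> c * (max 0 (- x) + real n * mean) + C"
        using c_pos C(1) mean_nonneg by simp
      moreover have "ennreal p * ennreal q + ennreal r * ennreal z = ennreal (p * q + r * z)"
        if "0 \<le> p" "0 \<le> q" "0 \<le> r" "0 \<le> z" for p q r z
        using that by (simp add: ennreal_mult ennreal_plus)
      ultimately have "ennreal (1 / (1 - \<alpha>)) * ennreal (enn2real (k n)) +
          ennreal (\<alpha> ^ n) * ennreal (c * (max 0 (- x) + real n * mean) + C) =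
          ennreal (1 / (1 - \<alpha>) * enn2real (k n) + \<alpha> ^ n * (c * (max 0 (- x) + real n * mean) + C))"
        using \<alpha> by simp
      also have "1 / (1 - \<alpha>) * enn2real (k n) + \<alpha> ^ n * (c * (max 0 (- x) + real n * mean) + C) = b n"
        unfolding b_def by (simp add: algebra_simps)
      finally show ?thesis
        unfolding k[symmetric] .
    qed
    finally have "ennreal (\<alpha> ^ Suc n) * exp_state (v \<alpha> s) \<pi> x (Suc n) \<le> ennreal (b n)" .
    with k_le[of "Suc n"] show ?thesis
      using iterate_exp_state_le[OF V \<alpha>(1) le, of n] unfolding k_def
      by (meson add_mono order_trans)
  qed
  have "(\<lambda>n. disc_cost I \<alpha> \<pi> x + ennreal (b n)) \<longlonglongrightarrow> disc_cost I \<alpha> \<pi> x + ennreal 0"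
    using b by (intro tendsto_add tendsto_const tendsto_ennrealI) simp
  then show ?thesis
    using bound by (intro LIMSEQ_le_const) auto
qed simp

lemma disc_cost_ge_v:
  assumes \<alpha>: "0 \<le> \<alpha>" "\<alpha> < 1" and crit: "critical \<alpha> s S"
  shows "ennreal (v \<alpha> s x) \<le> disc_cost I \<alpha> \<pi> x"
proof -
  note V = v_admissible[OF assms]
  have le: "v \<alpha> s x \<le> cost I x a + \<alpha> * post (v \<alpha> s) (x + a)" if "0 \<le> a" for x a
    using v_le[OF assms that] by (simp add: cost_def)
  show ?thesis
    using exp_state_le[OF V \<alpha>(1) le, of 0] disc_cost_lower[OF assms] exp_state_0[OF V(1)] by simp
qed

end

section \<open>Discount-optimal (s,S) policies\<close>

lemma sS_map_stationary: "s \<le> S \<Longrightarrow> sS_map s S \<in> stationary_maps"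
proof -
  assume "s \<le> S"
  moreover have "sS_map s S \<in> borel_measurable borel"
    unfolding sS_map_def by measurable
  ultimately show ?thesis
    by (auto simp: stationary_maps_def sS_map_def)
qed

lemma v_policy_eq:
  assumes \<alpha>: "0 \<le> \<alpha>" "\<alpha> < 1" and crit: "critical \<alpha> s S"
  shows "v \<alpha> s x = cost I x (sS_map s S x) + \<alpha> * post (v \<alpha> s) (x + sS_map s S x)"
  using J_eq_W_policy[OF _ _ crit, of x] \<alpha> unfolding cost_def v_eq_iff[OF \<alpha>] by simp

lemma value_fn_eq_v:
  assumes \<alpha>: "0 \<le> \<alpha>" "\<alpha> < 1" and crit: "critical \<alpha> s S"
  shows "value_fn I \<alpha> x = ennreal (v \<alpha> s x)"
    and "disc_optimal I \<alpha> (stationary (sS_map s S))"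
proof -
  have sS: "sS_map s S \<in> stationary_maps"
    using critical_less[OF crit] by (intro sS_map_stationary) simp
  have pol: "stationary (sS_map s S) \<in> policies"
    by (rule stationary_in_policies[OF sS])
  note V = v_admissible[OF assms]
  have upper: "disc_cost I \<alpha> (stationary (sS_map s S)) x \<le> ennreal (v \<alpha> s x)" for x
    by (rule disc_cost_upper[OF pol V \<alpha>(1) refl sS v_policy_eq[OF assms]])
  have eq: "value_fn I \<alpha> x = ennreal (v \<alpha> s x)" for x
    unfolding value_fn_def
  proof (rule antisym)
    show "(INF \<pi>\<in>policies. disc_cost I \<alpha> \<pi> x) \<le> ennreal (v \<alpha> s x)"
      by (rule INF_lower2[OF pol]) (rule upper)
    show "ennreal (v \<alpha> s x) \<le> (INF \<pi>\<in>policies. disc_cost I \<alpha> \<pi> x)"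
      using disc_cost_ge_v[OF _ assms] by (rule INF_greatest)
  qed
  show "value_fn I \<alpha> x = ennreal (v \<alpha> s x)" by (rule eq)
  show "disc_optimal I \<alpha> (stationary (sS_map s S))"
    unfolding disc_optimal_def eq using pol upper disc_cost_ge_v[OF pol assms] by (auto intro: antisym)
qed

text \<open>The lower bound on the discounted cost contains the actual first action. Since
  optimality leaves no loss, this action attains the minimum in the optimality equation, from every
  initial state x.\<close>

lemma critical_of_disc_optimal:
  assumes \<alpha>: "0 \<le> \<alpha>" "\<alpha> < 1" and crit: "critical \<alpha> s S" and s'S': "s' \<le> S'"
    and opt: "disc_optimal I \<alpha> (stationary (sS_map s' S'))"
  shows "critical \<alpha> s' S'"
proof (rule critical_of_policy[OF _ _ crit s'S'])
  fix x
  let ?\<phi> = "sS_map s' S'"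
  have \<phi>: "?\<phi> \<in> stationary_maps"
    by (rule sS_map_stationary[OF s'S'])
  have pol: "stationary ?\<phi> \<in> policies"
    by (rule stationary_in_policies[OF \<phi>])
  have a: "0 \<le> ?\<phi> x" using \<phi> by (simp add: stationary_maps_def)
  note V = v_admissible[OF \<alpha> crit]
  have "ennreal (cost I x (?\<phi> x) + \<alpha> * post (v \<alpha> s) (x + ?\<phi> x)) \<le> ennreal (v \<alpha> s x)"
    using disc_cost_lower[OF pol \<alpha> crit, of x] exp_cost_plus_state_0[OF pol V \<alpha>(1) refl \<phi>, of x]
      opt value_fn_eq_v(1)[OF \<alpha> crit, of x] by (simp add: disc_optimal_def)
  then have "cost I x (?\<phi> x) + \<alpha> * post (v \<alpha> s) (x + ?\<phi> x) \<le> v \<alpha> s x"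
    using V(3) by (subst (asm) ennreal_le_iff) auto
  then have "v \<alpha> s x = K * of_bool (0 < ?\<phi> x) + c * ?\<phi> x + g (x + ?\<phi> x) + \<alpha> * post (v \<alpha> s) (x + ?\<phi> x)"
    using v_le[OF \<alpha> crit a, of x] by (simp add: cost_def)
  then show "J \<alpha> s x = K * of_bool (0 < ?\<phi> x) + W \<alpha> s (x + ?\<phi> x)"
    unfolding v_eq_iff[OF \<alpha>] .
qed (use \<alpha> in auto)

end

section \<open>The average-cost optimality equation\<close>

lemma quasiconvex_between:
  assumes F: "quasiconvex F" and "x \<le> z" "z \<le> y"
  shows "F z \<le> max (F x) (F y)"
proof (cases "x = y")
  case False
  define l where "l = (y - z) / (y - x)"
  have "l * (y - x) = y - z"
    using False by (simp add: l_def)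
  then have "l * x + (1 - l) * y = z"
    by (simp add: algebra_simps)
  moreover have "l \<in> {0..1}"
    using assms False by (auto simp: l_def field_simps)
  ultimately show ?thesis
    using F unfolding quasiconvex_def by metis
qed (use assms in auto)

context inventory
begin

lemma demand_measurable: "demand I 1 \<in> borel_measurable (prob_sp I)"
  using model by (auto simp: inventory_model_def)

lemma ED_eq:
  assumes "(\<lambda>d. q d) \<in> borel_measurable borel"
  shows "ED I q = (\<integral>d. q d \<partial>demand_law I)"
  unfolding ED_def demand_law_def using assms demand_measurable by (subst integral_distr) auto

lemma nn_integral_demand:
  assumes "q \<in> borel_measurable borel"
  shows "(\<integral>\<^sup>+\<omega>. q (demand I 1 \<omega>) \<partial>prob_sp I) = (\<integral>\<^sup>+d. q d \<partial>demand_law I)"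
  unfolding demand_law_def using assms demand_measurable by (subst nn_integral_distr) auto

lemma integrable_demand_law:
  fixes q :: "real \<Rightarrow> real"
  assumes "integrable (demand_law I) q"
  shows "integrable (prob_sp I) (\<lambda>\<omega>. q (demand I 1 \<omega>))"
  using assms demand_measurable unfolding demand_law_def by (rule integrable_distr[rotated])

text \<open>The terms -(1 - \<alpha>) * c * mean and c * mean combine to a constant in x, so the
  hypotheses on the expected modified holding cost pass to \<open>f \<alpha>\<close>.\<close>

lemma exp_h_disc_eq: "exp_h_disc I \<alpha> x = f \<alpha> x + \<alpha> * c * mean"
proof -
  interpret P: prob_space "prob_sp I"
    using model by (simp add: inventory_model_def)
  have mean: "mean = (\<integral>\<omega>. demand I 1 \<omega> \<partial>prob_sp I)"
    using ED_eq[of "\<lambda>d. d"] by (simp add: mean_def ED_def)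
  have int: "integrable (prob_sp I) (\<lambda>\<omega>. holding I (x - demand I 1 \<omega>))"
      "integrable (prob_sp I) (\<lambda>\<omega>. (1 - \<alpha>) * c * (x - demand I 1 \<omega>))"
    using model by (auto simp: inventory_model_def simp del: One_nat_def)
  have "exp_h_disc I \<alpha> x = (\<integral>\<omega>. holding I (x - demand I 1 \<omega>) + (1 - \<alpha>) * c * (x - demand I 1 \<omega>) + c * mean \<partial>prob_sp I)"
    by (simp add: exp_h_disc_def h_disc_def ED_def mean)
  also have "\<dots> = g x + (\<integral>\<omega>. (1 - \<alpha>) * c * (x - demand I 1 \<omega>) \<partial>prob_sp I) + c * mean"
    using int by (simp add: exp_holding_def ED_def P.prob_space)
  also have "(\<integral>\<omega>. (1 - \<alpha>) * c * (x - demand I 1 \<omega>) \<partial>prob_sp I) = (1 - \<alpha>) * c * (x - mean)"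
    using model by (simp add: inventory_model_def mean P.prob_space del: One_nat_def)
  finally show ?thesis
    by (simp add: f_def algebra_simps)
qed

lemma f_eventually_large:
  assumes "\<alpha> \<le> 1"
  obtains b where "\<And>x. b \<le> x \<Longrightarrow> f \<alpha> z < f \<alpha> x"
proof -
  obtain b where b: "0 \<le> b" "\<And>x. b \<le> x \<Longrightarrow> f \<alpha> z + 1 \<le> g x"
    using g_eventually_ge by metis
  have "f \<alpha> z < f \<alpha> x" if "b \<le> x" for x
  proof -
    have "0 \<le> (1 - \<alpha>) * c * x"
      using assms c_pos b that by simp
    then show ?thesis
      using b(2)[OF that] by (simp add: f_def)
  qed
  then show thesis by (rule that)
qed

lemma unimodalI:
  assumes quasi: "quasiconvex (exp_h_disc I \<alpha>)" and x0: "\<And>y. f \<alpha> x0 \<le> f \<alpha> y"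
  shows "unimodal \<alpha> x0"
  unfolding unimodal_def
proof (intro conjI allI impI)
  fix y z assume "y \<le> z" "z \<le> x0"
  from quasiconvex_between[OF quasi this] show "f \<alpha> z \<le> f \<alpha> y"
    using x0[of y] by (simp add: exp_h_disc_eq max_def split: if_splits)
next
  fix y z assume "x0 \<le> y" "y \<le> z"
  from quasiconvex_between[OF quasi this] show "f \<alpha> y \<le> f \<alpha> z"
    using x0[of z] by (simp add: exp_h_disc_eq max_def split: if_splits)
qed

text \<open>The limit at minus infinity excludes minimizers far to the left, also when it is
  infinite; coercivity of g excludes them far to the right. A minimum is therefore attained, and
  quasiconvexity makes it a mode.\<close>

lemma unimodal_exists:
  assumes \<alpha>: "\<alpha> \<le> 1" and quasi: "quasiconvex (exp_h_disc I \<alpha>)"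
    and lim: "((\<lambda>x. ereal (exp_h_disc I \<alpha> x)) \<longlongrightarrow> L) at_bot"
      "L > ereal K + (INF x. ereal (exp_h_disc I \<alpha> x))"
  obtains x0 a where "unimodal \<alpha> x0" "a \<le> x0" "\<And>x. x \<le> a \<Longrightarrow> K + f \<alpha> x0 < f \<alpha> x"
proof -
  have "(INF x. ereal (exp_h_disc I \<alpha> x)) < L - ereal K"
    using lim(2) by (subst ereal_less_minus) (auto simp: add.commute)
  then obtain z where "ereal (exp_h_disc I \<alpha> z) < L - ereal K"
    by (auto simp: INF_less_iff)
  then have "ereal (exp_h_disc I \<alpha> z + K) < L"
    by (subst (asm) ereal_less_minus) auto
  from order_tendstoD(1)[OF lim(1) this]
  obtain a where a: "\<And>x. x \<le> a \<Longrightarrow> K + f \<alpha> z < f \<alpha> x"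
    by (auto simp: eventually_at_bot_linorder exp_h_disc_eq add.commute)
  obtain b where b: "\<And>x. b \<le> x \<Longrightarrow> f \<alpha> z < f \<alpha> x"
    using f_eventually_large[OF \<alpha>] by metis
  have "\<exists>x. \<forall>y. f \<alpha> x \<le> f \<alpha> y"
  proof (rule continuous_attains_min_outside[OF f_continuous[of \<alpha>], of a b z])
    show "f \<alpha> z < f \<alpha> x" if "x < a \<or> b < x" for x
      using a[of x] b[of x] K_pos that by auto
  qed
  then obtain x0 where x0: "\<And>y. f \<alpha> x0 \<le> f \<alpha> y" by blast
  have far: "K + f \<alpha> x0 < f \<alpha> x" if "x \<le> a" for x
    using a[OF that] x0[of z] by simp
  moreover have "a \<le> x0"
    using far[of x0] K_pos by (cases "a \<le> x0") auto
  ultimately show thesis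
    using that unimodalI[OF quasi x0] by blast
qed

text \<open>\<open>x_min\<close> is defined by \<open>LEAST\<close>, so a least minimizer must first
  be shown to exist: the set of minimizers is nonempty, closed and bounded below.\<close>

lemma strict_mode_x_min:
  assumes quasi: "quasiconvex (exp_h_disc I 1)"
    and decr: "strict_antimono_on {..x_min I 1} (exp_h_disc I 1)"
  shows "strict_mode (x_min I 1)"
proof -
  define T where "T = {x. \<forall>y. f 1 x \<le> f 1 y}"
  have T: "T = (\<Inter>y. {x. f 1 x \<le> f 1 y})"
    by (auto simp: T_def)
  have f1: "f 1 = g" by (auto simp: f_def)
  have "eventually (\<lambda>x. g 0 + 1 \<le> g x) at_bot"
    using filterlim_mono[OF g_coercive order_refl at_bot_le_at_infinity] by (simp add: filterlim_at_top)
  then obtain a where a: "\<And>x. x \<le> a \<Longrightarrow> g 0 + 1 \<le> g x"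
    by (auto simp: eventually_at_bot_linorder)
  obtain b where b: "\<And>x. b \<le> x \<Longrightarrow> f 1 0 < f 1 x"
    using f_eventually_large[of 1] by auto
  have "\<exists>x. \<forall>y. f 1 x \<le> f 1 y"
  proof (rule continuous_attains_min_outside[OF f_continuous[of 1], of a b 0])
    show "f 1 0 < f 1 x" if "x < a \<or> b < x" for x
      using a[of x] b[of x] that by (auto simp: f1)
  qed
  then have "T \<noteq> {}" by (auto simp: T_def)
  moreover have bdd: "bdd_below T"
  proof (rule bdd_belowI[of _ a])
    fix x assume "x \<in> T"
    then have "f 1 x \<le> f 1 0" by (simp add: T_def)
    then show "a \<le> x" using a[of x] by (cases "a \<le> x") (auto simp: f1)
  qed
  moreover have "closed T"
    unfolding T by (intro closed_INT ballI closed_Collect_le continuous_intros f_continuous)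
  ultimately have "Inf T \<in> T"
    by (intro closed_contains_Inf)
  moreover have "minimizes (exp_h_disc I 1) x \<longleftrightarrow> x \<in> T" for x
    by (auto simp: is_arg_min_def T_def exp_h_disc_eq not_less)
  ultimately have "x_min I 1 = Inf T"
    unfolding x_min_def using bdd by (intro Least_equality) (auto intro: cInf_lower)
  with \<open>Inf T \<in> T\<close> have "f 1 (x_min I 1) \<le> f 1 y" for y
    by (simp add: T_def)
  then have "unimodal 1 (x_min I 1)"
    by (rule unimodalI[OF quasi])
  moreover have "f 1 z < f 1 y" if "y < z" "z \<le> x_min I 1" for y z
    using decr that by (auto simp: monotone_on_def exp_h_disc_eq)
  ultimately show ?thesis
    by (simp add: strict_mode_def)
qed

lemma f_tendsto_compose:
  assumes "(\<beta> \<longlongrightarrow> \<alpha>) F" "(\<sigma> \<longlongrightarrow> s) F"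
  shows "((\<lambda>i. f (\<beta> i) (\<sigma> i)) \<longlongrightarrow> f \<alpha> s) F"
  unfolding f_def
  by (intro tendsto_intros assms continuous_on_tendsto_compose[OF g_continuous]) auto

lemma min_value_eq:
  assumes \<alpha>: "0 \<le> \<alpha>" "\<alpha> < 1" and crit: "critical \<alpha> s S"
  shows "enn2ereal (min_value I \<alpha>) = ereal (inf_\<psi> \<alpha> s + (f \<alpha> s + \<alpha> * c * mean) / (1 - \<alpha>))"
proof -
  have \<alpha>1: "\<alpha> \<le> 1" using \<alpha> by simp
  obtain z where z: "inf_\<psi> \<alpha> s = \<psi> \<alpha> s z" "\<And>y. \<psi> \<alpha> s z \<le> \<psi> \<alpha> s y"
    by (rule inf_psi_attained[OF \<alpha>(1) \<alpha>1, of s]) (rule that)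
  have "min_value I \<alpha> = ennreal (v \<alpha> s z)"
    unfolding min_value_def value_fn_eq_v(1)[OF assms]
    using z by (intro antisym INF_lower INF_greatest ennreal_leI) (auto simp: v_def)
  then show ?thesis
    using v_nonneg[OF assms, of z] by (simp add: z(1) v_def)
qed

lemma rel_value_eq:
  assumes "0 \<le> \<alpha>" "\<alpha> < 1" "critical \<alpha> s S"
  shows "rel_value I \<alpha> x = ereal (\<psi> \<alpha> s x - inf_\<psi> \<alpha> s)"
  using v_nonneg[OF assms, of x]
  by (simp add: rel_value_def value_fn_eq_v(1)[OF assms] min_value_eq[OF assms] v_def)

lemma G_fn_eq:
  assumes \<alpha>: "0 \<le> \<alpha>" "\<alpha> < 1" and crit: "critical \<alpha> s S"
  shows "G_fn I \<alpha> x = ereal (W \<alpha> s x + (f \<alpha> s + \<alpha> * c * mean) / (1 - \<alpha>))"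
proof -
  note V = v_admissible[OF assms]
  have [measurable]: "v \<alpha> s \<in> borel_measurable borel"
    by (rule borel_measurable_continuous_onI[OF V(1)])
  have "(\<integral>\<^sup>+\<omega>. value_fn I \<alpha> (x - demand I 1 \<omega>) \<partial>prob_sp I) = (\<integral>\<^sup>+d. ennreal (v \<alpha> s (x - d)) \<partial>demand_law I)"
    unfolding value_fn_eq_v(1)[OF assms] by (rule nn_integral_demand) measurable
  also have "\<dots> = ennreal (post (v \<alpha> s) x)"
    unfolding post_def using V by (intro nn_integral_eq_integral) auto
  finally show ?thesis
    using post_v[OF \<alpha>, of x s] post_nonneg[of "v \<alpha> s" x] V(3) by (simp add: G_fn_def)
qed

lemma H_fn_eq: "H_fn I (u s) x = W 1 s x + (f 1 s + c * mean - inf_\<psi> 1 s)"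
proof -
  have "ED I (\<lambda>d. u s (x - d)) = post (u s) x"
    unfolding post_def using borel_measurable_continuous_onI[OF u_continuous] by (intro ED_eq) auto
  then show ?thesis
    using post_u[of x s] by (simp add: H_fn_def)
qed

lemma avg_opt_equation_critical:
  assumes crit: "critical 1 s S"
  shows "avg_opt_equation I (f 1 s + c * mean) (u s) (sS_map s S)"
  unfolding avg_opt_equation_def
proof (intro allI conjI)
  fix x
  have u: "f 1 s + c * mean + u s x = J 1 s x + (f 1 s + c * mean - inf_\<psi> 1 s) - c * x"
    by (simp add: u_def \<psi>_def)
  show "f 1 s + c * mean + u s x = K * of_bool (0 < sS_map s S x) +
      H_fn I (u s) (x + sS_map s S x) - c * x"
    unfolding u H_fn_eq using J_eq_W_policy[OF _ _ crit, of x] by simp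
  obtain y where y: "x \<le> y" "\<And>z. x \<le> z \<Longrightarrow> W 1 s y \<le> W 1 s z"
    using W_argmin_above[OF crit, of x] by blast
  have J: "J 1 s x = min (K + W 1 s y) (W 1 s x)"
    using J_eq_min_W[OF crit y(1)] y(2) by blast
  have "is_arg_min (\<lambda>a. K + H_fn I (u s) (x + a)) (\<lambda>a. 0 \<le> a) (y - x)"
    using y by (auto simp: is_arg_min_def H_fn_eq not_less)
  moreover have "f 1 s + c * mean + u s x = min (K + H_fn I (u s) (x + (y - x))) (H_fn I (u s) x) - c * x"
    unfolding u H_fn_eq J by (simp add: min_def)
  ultimately show "\<exists>a. is_arg_min (\<lambda>a. K + H_fn I (u s) (x + a)) (\<lambda>a. 0 \<le> a) a \<and>
      f 1 s + c * mean + u s x = min (K + H_fn I (u s) (x + a)) (H_fn I (u s) x) - c * x"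
    by blast
qed

lemma avg_cost_critical_le:
  assumes crit: "critical 1 s S"
  shows "avg_cost I (stationary (sS_map s S)) x \<le> ennreal (f 1 s + c * mean)"
proof -
  have \<phi>: "sS_map s S \<in> stationary_maps"
    using critical_less[OF crit] by (intro sS_map_stationary) simp
  have w: "0 \<le> f 1 s + c * mean"
    using g_nonneg[of s] c_pos mean_nonneg by (simp add: f_def)
  show ?thesis
  proof (rule avg_cost_upper[OF stationary_in_policies[OF \<phi>] u_continuous[of s] u_integrable u_nonneg w refl \<phi>])
    fix x
    let ?a = "sS_map s S x"
    show "f 1 s + c * mean + u s x = cost I x ?a + post (u s) (x + ?a)"
      using post_u[of "x + ?a" s] J_eq_W_policy[OF _ _ crit, of x]
      by (simp add: cost_def u_def \<psi>_def algebra_simps)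
  qed
qed

end

section \<open>Limits as the discount factor tends to 1 under the quasiconvexity hypotheses\<close>

locale quasiconvex_inventory = inventory I for I :: "'w inventory" +
  fixes \<alpha>s :: real
  assumes \<alpha>s: "0 \<le> \<alpha>s" "\<alpha>s < 1"
    and quasi: "\<And>\<alpha>. \<alpha> \<in> {\<alpha>s<..1} \<Longrightarrow> quasiconvex (exp_h_disc I \<alpha>)"
    and lim: "\<And>\<alpha>. \<alpha> \<in> {\<alpha>s<..1} \<Longrightarrow> \<exists>L. ((\<lambda>x. ereal (exp_h_disc I \<alpha> x)) \<longlongrightarrow> L) at_bot \<and>
                L > ereal K + (INF x. ereal (exp_h_disc I \<alpha> x))"
    and decr: "strict_antimono_on {..x_min I 1} (exp_h_disc I 1)"
begin

lemma unimodal_far: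
  assumes "\<alpha> \<in> {\<alpha>s<..1}"
  obtains x0 a where "unimodal \<alpha> x0" "a \<le> x0" "\<And>x. x \<le> a \<Longrightarrow> K + f \<alpha> x0 < f \<alpha> x"
proof -
  obtain L where L: "((\<lambda>x. ereal (exp_h_disc I \<alpha> x)) \<longlongrightarrow> L) at_bot"
      "L > ereal K + (INF x. ereal (exp_h_disc I \<alpha> x))"
    using lim[OF assms] by blast
  show thesis
    by (rule unimodal_exists[OF _ quasi[OF assms] L]) (use assms in simp, fact that)
qed

lemma strict_mode: "strict_mode (x_min I 1)"
  using \<alpha>s by (intro strict_mode_x_min quasi decr) auto

lemma critical_ex: "\<alpha> \<in> {\<alpha>s<..1} \<Longrightarrow> \<exists>s S. critical \<alpha> s S"
proof -
  assume \<alpha>: "\<alpha> \<in> {\<alpha>s<..1}"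
  obtain x0 a where "unimodal \<alpha> x0" "a \<le> x0" "\<And>x. x \<le> a \<Longrightarrow> K + f \<alpha> x0 < f \<alpha> x"
    by (rule unimodal_far[OF \<alpha>]) (rule that)
  then show ?thesis
    using \<alpha> \<alpha>s by (intro critical_exists[of \<alpha> x0 a]) (auto intro: less_imp_le)
qed

lemma critical_threshold:
  assumes \<alpha>: "\<alpha> \<in> {\<alpha>s<..1}" and crit: "critical \<alpha> s S0" and S: "\<And>y. W \<alpha> s S \<le> W \<alpha> s y"
  shows "critical \<alpha> (lower_threshold K (W \<alpha> s) S) S" "lower_threshold K (W \<alpha> s) S \<le> S"
proof -
  obtain x0 a where "unimodal \<alpha> x0" "a \<le> x0" and far: "\<And>x. x \<le> a \<Longrightarrow> K + f \<alpha> x0 < f \<alpha> x"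
    by (rule unimodal_far[OF \<alpha>]) (rule that)
  have \<alpha>': "0 \<le> \<alpha>" "\<alpha> \<le> 1" using \<alpha> \<alpha>s by auto
  have "f \<alpha> s < f \<alpha> x" if "x \<le> a" for x
    using far[OF that] critical_f_le[OF \<alpha>' crit, of x0] by simp
  then show "critical \<alpha> (lower_threshold K (W \<alpha> s) S) S" "lower_threshold K (W \<alpha> s) S \<le> S"
    using critical_lower_threshold[OF \<alpha>' crit S] by blast+
qed

lemma eventually_range: "eventually (\<lambda>\<alpha>. \<alpha> \<in> {\<alpha>s<..<1}) (at_left 1)"
  unfolding eventually_at_left_field using \<alpha>s by (intro exI[of _ \<alpha>s]) auto

text \<open>An arbitrary choice: critical thresholds for \<alpha> < 1 need not be unique. The limit
  at 1 is nevertheless determined, because all of them converge to the unique critical threshold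
  there.\<close>

definition \<sigma> :: "real \<Rightarrow> real" where "\<sigma> \<alpha> = (SOME s. \<exists>S. critical \<alpha> s S)"

definition \<Sigma> :: "real \<Rightarrow> real" where "\<Sigma> \<alpha> = (SOME S. critical \<alpha> (\<sigma> \<alpha>) S)"

lemma critical_choice: "\<alpha> \<in> {\<alpha>s<..1} \<Longrightarrow> critical \<alpha> (\<sigma> \<alpha>) (\<Sigma> \<alpha>)"
proof -
  assume "\<alpha> \<in> {\<alpha>s<..1}"
  then have "\<exists>S. critical \<alpha> (\<sigma> \<alpha>) S"
    unfolding \<sigma>_def by (rule someI_ex[OF critical_ex])
  then show ?thesis
    unfolding \<Sigma>_def by (rule someI_ex)
qed

lemma critical_1: "critical 1 (\<sigma> 1) (\<Sigma> 1)"
  using \<alpha>s by (intro critical_choice) auto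

lemma critical_thresholds_tendsto:
  assumes "\<And>\<alpha>. \<alpha> \<in> {\<alpha>s<..<1} \<Longrightarrow> \<exists>S. critical \<alpha> (\<tau> \<alpha>) S"
  shows "(\<tau> \<longlongrightarrow> \<sigma> 1) (at_left 1)"
proof (rule critical_tendsto[OF critical_1 strict_mode])
  show "eventually (\<lambda>\<alpha>. \<exists>x0. unimodal \<alpha> x0) (at_left 1)"
    using eventually_range
  proof eventually_elim
    case (elim \<alpha>)
    then have "\<alpha> \<in> {\<alpha>s<..1}" by auto
    then show ?case by (rule unimodal_far) blast
  qed
  show "eventually (\<lambda>\<alpha>. \<exists>S. critical \<alpha> (\<tau> \<alpha>) S) (at_left 1)"
    using eventually_range by eventually_elim (rule assms)
qed

lemma sigma_tendsto: "(\<sigma> \<longlongrightarrow> \<sigma> 1) (at_left 1)"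
  using critical_choice by (intro critical_thresholds_tendsto) fastforce

definition w :: real where "w = f 1 (\<sigma> 1) + c * mean"

text \<open>The factor 1 - \<alpha> cancels the denominator of the constant and kills the convergent
  part y. Taking \<psi> for y gives the values at a fixed state, taking its infimum gives the
  minimal values, both with limit w.\<close>

lemma scaled_value_tendsto:
  "((\<lambda>\<alpha>. (1 - \<alpha>) * (y \<alpha> + (f \<alpha> (\<sigma> \<alpha>) + \<alpha> * c * mean) / (1 - \<alpha>))) \<longlongrightarrow> w) (at_left 1)"
  if "(y \<longlongrightarrow> y1) (at_left 1)" for y
proof (rule Lim_transform_eventually)
  have "((\<lambda>\<alpha>. (1 - \<alpha>) * y \<alpha> + (f \<alpha> (\<sigma> \<alpha>) + \<alpha> * c * mean)) \<longlongrightarrow>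
      (1 - 1) * y1 + (f 1 (\<sigma> 1) + 1 * c * mean)) (at_left 1)"
    by (intro tendsto_intros that f_tendsto_compose sigma_tendsto)
  then show "((\<lambda>\<alpha>. (1 - \<alpha>) * y \<alpha> + (f \<alpha> (\<sigma> \<alpha>) + \<alpha> * c * mean)) \<longlongrightarrow> w) (at_left 1)"
    by (simp add: w_def)
  show "eventually (\<lambda>\<alpha>. (1 - \<alpha>) * y \<alpha> + (f \<alpha> (\<sigma> \<alpha>) + \<alpha> * c * mean) =
      (1 - \<alpha>) * (y \<alpha> + (f \<alpha> (\<sigma> \<alpha>) + \<alpha> * c * mean) / (1 - \<alpha>))) (at_left 1)"
    using eventually_range by eventually_elim (simp add: field_simps)
qed

lemma psi_tendsto: "((\<lambda>\<alpha>. \<psi> \<alpha> (\<sigma> \<alpha>) x) \<longlongrightarrow> \<psi> 1 (\<sigma> 1) x) (at_left 1)"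
  unfolding \<psi>_def
  by (intro tendsto_intros J_tendsto eventually_at_left_1 sigma_tendsto) auto

lemma inf_psi_sigma_tendsto: "((\<lambda>\<alpha>. inf_\<psi> \<alpha> (\<sigma> \<alpha>)) \<longlongrightarrow> inf_\<psi> 1 (\<sigma> 1)) (at_left 1)"
  by (intro inf_psi_tendsto tendsto_ident_at eventually_at_left_1 sigma_tendsto) auto

lemma avg_cost_ge:
  assumes \<pi>: "\<pi> \<in> policies"
  shows "ennreal w \<le> avg_cost I \<pi> x"
  unfolding avg_cost_eq[OF \<pi>]
proof (rule tauberian_limsup)
  show "((\<lambda>\<alpha>. (1 - \<alpha>) * v \<alpha> (\<sigma> \<alpha>) x) \<longlongrightarrow> w) (at_left 1)"
    unfolding v_def by (rule scaled_value_tendsto[OF psi_tendsto])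
  show "eventually (\<lambda>\<alpha>. ennreal (v \<alpha> (\<sigma> \<alpha>) x) \<le> (\<Sum>t. ennreal (\<alpha> ^ t) * exp_cost \<pi> x t)) (at_left 1)"
    using eventually_range
  proof eventually_elim
    case (elim \<alpha>)
    then have \<alpha>: "0 \<le> \<alpha>" "\<alpha> < 1" "\<alpha> \<in> {\<alpha>s<..1}" using \<alpha>s by auto
    show ?case
      using disc_cost_ge_v[OF \<pi> \<alpha>(1,2) critical_choice[OF \<alpha>(3)], of x] disc_cost_eq[OF \<pi> \<alpha>(1), of x]
      by simp
  qed
qed

lemma critical_avg_optimal:
  assumes "critical 1 s S"
  shows "s = \<sigma> 1" "s \<le> S" "sS_map s S \<in> stationary_maps"
    "avg_optimal I (stationary (sS_map s S))" "avg_opt_equation I w (u (\<sigma> 1)) (sS_map s S)"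
proof -
  show s: "s = \<sigma> 1"
    by (rule critical_unique[OF strict_mode assms critical_1])
  show "s \<le> S"
    using critical_less[OF assms] by simp
  then show \<phi>: "sS_map s S \<in> stationary_maps"
    by (rule sS_map_stationary)
  show "avg_opt_equation I w (u (\<sigma> 1)) (sS_map s S)"
    using avg_opt_equation_critical[OF assms] by (simp add: w_def s)
  show "avg_optimal I (stationary (sS_map s S))"
    unfolding avg_optimal_def
  proof (intro conjI ballI allI)
    show "stationary (sS_map s S) \<in> policies"
      by (rule stationary_in_policies[OF \<phi>])
    fix \<pi>' x assume "\<pi>' \<in> policies"
    then have "ennreal w \<le> avg_cost I \<pi>' x"
      by (rule avg_cost_ge)
    with avg_cost_critical_le[OF assms, of x]
    show "avg_cost I (stationary (sS_map s S)) x \<le> avg_cost I \<pi>' x"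
      by (simp add: w_def s)
  qed
qed

lemma disc_seqD:
  assumes "disc_seq \<alpha>s a"
  shows "a n \<in> {\<alpha>s<..<1}" "filterlim a (at_left 1) sequentially"
proof -
  show "a n \<in> {\<alpha>s<..<1}"
    using assms incseqD[of a 0 n] by (auto simp: disc_seq_def)
  have "a n < 1" "a n \<noteq> 1" for n
    using assms by (auto simp: disc_seq_def less_imp_neq)
  then show "filterlim a (at_left 1) sequentially"
    using assms by (auto simp: disc_seq_def filterlim_at)
qed

text \<open>The lower thresholds converge, but the order-up-to levels are only bounded, since J at
  \<alpha> = 1 may have several minimizers. Hence limit points exist, and by continuity of J each of
  them is critical.\<close>

lemma threshold_sequence:
  assumes a: "disc_seq \<alpha>s a" and thr: "disc_thresholds I \<alpha>s s' S'"
  shows "\<exists>l. seq_limit_point (\<lambda>n. (s' (a n), S' (a n))) l"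
    and "seq_limit_point (\<lambda>n. (s' (a n), S' (a n))) (s, S) \<Longrightarrow> critical 1 s S"
proof -
  note a_in = disc_seqD(1)[OF a] and a_lim = disc_seqD(2)[OF a]
  have crit: "critical \<alpha> (s' \<alpha>) (S' \<alpha>)" if \<alpha>: "\<alpha> \<in> {\<alpha>s<..<1}" for \<alpha>
  proof -
    have "0 \<le> \<alpha>" "\<alpha> < 1" "critical \<alpha> (\<sigma> \<alpha>) (\<Sigma> \<alpha>)"
      using \<alpha> \<alpha>s by (auto intro!: critical_choice)
    moreover have "s' \<alpha> \<le> S' \<alpha>" "disc_optimal I \<alpha> (stationary (sS_map (s' \<alpha>) (S' \<alpha>)))"
      using thr \<alpha> by (simp_all add: disc_thresholds_def)
    ultimately show ?thesis
      by (rule critical_of_disc_optimal)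
  qed
  have "(s' \<longlongrightarrow> \<sigma> 1) (at_left 1)"
    using crit by (intro critical_thresholds_tendsto) blast
  then have s'_lim: "(\<lambda>n. s' (a n)) \<longlonglongrightarrow> \<sigma> 1"
    using a_lim by (rule filterlim_compose)
  have bounds: "0 \<le> a n" "a n \<le> 1" for n
    using a_in[of n] \<alpha>s by auto
  have "Bseq (\<lambda>n. S' (a n))"
    by (rule critical_sequence_bounded[OF bounds crit[OF a_in] s'_lim])
  then obtain l r where r: "strict_mono r" "((\<lambda>n. S' (a n)) \<circ> r) \<longlonglongrightarrow> l"
    unfolding Bseq_eq_bounded using bounded_imp_convergent_subsequence by metis
  then have "((\<lambda>n. (s' (a n), S' (a n))) \<circ> r) \<longlonglongrightarrow> (\<sigma> 1, l)"
    using tendsto_Pair[OF LIMSEQ_subseq_LIMSEQ[OF s'_lim r(1)] r(2)] by (simp add: comp_def)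
  then show "\<exists>l. seq_limit_point (\<lambda>n. (s' (a n), S' (a n))) l"
    using r(1) by (auto simp: seq_limit_point_def)
  assume "seq_limit_point (\<lambda>n. (s' (a n), S' (a n))) (s, S)"
  then obtain q where q: "strict_mono q" "((\<lambda>n. (s' (a n), S' (a n))) \<circ> q) \<longlonglongrightarrow> (s, S)"
    by (auto simp: seq_limit_point_def)
  have s: "(\<lambda>n. s' (a (q n))) \<longlonglongrightarrow> s" and S: "(\<lambda>n. S' (a (q n))) \<longlonglongrightarrow> S"
    using tendsto_fst[OF q(2)] tendsto_snd[OF q(2)] by (simp_all add: comp_def)
  have "s = \<sigma> 1"
    using LIMSEQ_unique[OF s] LIMSEQ_subseq_LIMSEQ[OF s'_lim q(1)] by (simp add: comp_def)
  moreover have "(\<lambda>n. a (q n)) \<longlonglongrightarrow> 1"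
    using LIMSEQ_subseq_LIMSEQ[of a 1 q] a q(1) by (simp add: disc_seq_def comp_def)
  ultimately show "critical 1 s S"
    using critical_limit[of "\<lambda>n. a (q n)" "\<lambda>n. s' (a (q n))" "\<lambda>n. S' (a (q n))" s S "\<Sigma> 1"]
      bounds crit[OF a_in] s S critical_1 by simp
qed

text \<open>Joint continuity of J gives the same limit along every sequence y n -> x, so the infimum
  is taken over a constant.\<close>

lemma liminf_rel_value_eq:
  assumes a: "disc_seq \<alpha>s a"
  shows "liminf_rel_value I a x = ereal (u (\<sigma> 1) x)"
proof -
  note a_in = disc_seqD(1)[OF a] and a_lim = disc_seqD(2)[OF a]
  have bounds: "0 \<le> a n" "a n \<le> 1" "a n < 1" "a n \<in> {\<alpha>s<..1}" for n
    using a_in[of n] \<alpha>s by auto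
  have a_lim': "a \<longlonglongrightarrow> 1"
    using a by (simp add: disc_seq_def)
  note \<sigma>_lim = filterlim_compose[OF sigma_tendsto a_lim]
  note inf_lim = filterlim_compose[OF inf_psi_sigma_tendsto a_lim]
  have "liminf (\<lambda>n. rel_value I (a n) (y n)) = ereal (u (\<sigma> 1) x)" if y: "y \<longlonglongrightarrow> x" for y
  proof (rule lim_imp_Liminf)
    have "(\<lambda>n. \<psi> (a n) (\<sigma> (a n)) (y n) - inf_\<psi> (a n) (\<sigma> (a n))) \<longlonglongrightarrow> u (\<sigma> 1) x"
      unfolding u_def \<psi>_def[of _ _ "y _"] \<psi>_def[of _ _ x]
      using bounds by (intro tendsto_intros J_tendsto a_lim' \<sigma>_lim inf_lim y) auto
    then show "(\<lambda>n. rel_value I (a n) (y n)) \<longlonglongrightarrow> ereal (u (\<sigma> 1) x)"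
      using rel_value_eq[OF bounds(1,3) critical_choice[OF bounds(4)]] by simp
  qed simp
  then have "liminf_rel_value I a x = (INF y\<in>{y. y \<longlonglongrightarrow> x}. ereal (u (\<sigma> 1) x))"
    unfolding liminf_rel_value_def by (intro INF_cong) auto
  also have "\<dots> = ereal (u (\<sigma> 1) x)"
    using tendsto_const[of x sequentially] by (intro INF_const) auto
  finally show ?thesis .
qed

lemma min_value_tendsto:
  "((\<lambda>\<alpha>. ereal (1 - \<alpha>) * enn2ereal (min_value I \<alpha>)) \<longlongrightarrow> ereal w) (at_left 1)"
proof (rule Lim_transform_eventually)
  show "((\<lambda>\<alpha>. ereal ((1 - \<alpha>) * (inf_\<psi> \<alpha> (\<sigma> \<alpha>) + (f \<alpha> (\<sigma> \<alpha>) + \<alpha> * c * mean) / (1 - \<alpha>))))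
      \<longlongrightarrow> ereal w) (at_left 1)"
    by (intro tendsto_ereal scaled_value_tendsto[OF inf_psi_sigma_tendsto])
  show "eventually (\<lambda>\<alpha>. ereal ((1 - \<alpha>) * (inf_\<psi> \<alpha> (\<sigma> \<alpha>) + (f \<alpha> (\<sigma> \<alpha>) + \<alpha> * c * mean) / (1 - \<alpha>))) =
      ereal (1 - \<alpha>) * enn2ereal (min_value I \<alpha>)) (at_left 1)"
    using eventually_range
  proof eventually_elim
    case (elim \<alpha>)
    then have "0 \<le> \<alpha>" "\<alpha> < 1" "critical \<alpha> (\<sigma> \<alpha>) (\<Sigma> \<alpha>)"
      using \<alpha>s by (auto intro!: critical_choice)
    from min_value_eq[OF this] show ?case by simp
  qed
qed

lemma rel_value_tendsto: "((\<lambda>\<alpha>. rel_value I \<alpha> x) \<longlongrightarrow> ereal (u (\<sigma> 1) x)) (at_left 1)"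
proof (rule Lim_transform_eventually)
  show "((\<lambda>\<alpha>. ereal (\<psi> \<alpha> (\<sigma> \<alpha>) x - inf_\<psi> \<alpha> (\<sigma> \<alpha>))) \<longlongrightarrow> ereal (u (\<sigma> 1) x)) (at_left 1)"
    unfolding u_def by (intro tendsto_ereal tendsto_diff psi_tendsto inf_psi_sigma_tendsto)
  show "eventually (\<lambda>\<alpha>. ereal (\<psi> \<alpha> (\<sigma> \<alpha>) x - inf_\<psi> \<alpha> (\<sigma> \<alpha>)) = rel_value I \<alpha> x) (at_left 1)"
    using eventually_range
  proof eventually_elim
    case (elim \<alpha>)
    then have "0 \<le> \<alpha>" "\<alpha> < 1" "critical \<alpha> (\<sigma> \<alpha>) (\<Sigma> \<alpha>)"
      using \<alpha>s by (auto intro!: critical_choice)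
    from rel_value_eq[OF this] show ?case by simp
  qed
qed

lemma
  assumes \<alpha>: "\<alpha> \<in> {\<alpha>s<..<1}"
  shows minimizes_G_fn_iff: "minimizes (G_fn I \<alpha>) S \<longleftrightarrow> (\<forall>y. W \<alpha> (\<sigma> \<alpha>) S \<le> W \<alpha> (\<sigma> \<alpha>) y)"
    and lower_threshold_G_fn:
      "lower_threshold (ereal K) (G_fn I \<alpha>) S = lower_threshold K (W \<alpha> (\<sigma> \<alpha>)) S"
proof -
  have "0 \<le> \<alpha>" "\<alpha> < 1" "critical \<alpha> (\<sigma> \<alpha>) (\<Sigma> \<alpha>)"
    using \<alpha> \<alpha>s by (auto intro!: critical_choice)
  note G = G_fn_eq[OF this]
  show "minimizes (G_fn I \<alpha>) S \<longleftrightarrow> (\<forall>y. W \<alpha> (\<sigma> \<alpha>) S \<le> W \<alpha> (\<sigma> \<alpha>) y)"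
    by (auto simp: is_arg_min_def G not_less)
  show "lower_threshold (ereal K) (G_fn I \<alpha>) S = lower_threshold K (W \<alpha> (\<sigma> \<alpha>)) S"
    by (simp add: lower_threshold_def G add.assoc[symmetric])
qed

lemma minimizes_G_fn_ex:
  assumes \<alpha>: "\<alpha> \<in> {\<alpha>s<..<1}" shows "\<exists>S. minimizes (G_fn I \<alpha>) S"
proof -
  have c: "0 \<le> \<alpha>" "\<alpha> \<le> 1" "critical \<alpha> (\<sigma> \<alpha>) (\<Sigma> \<alpha>)"
    using \<alpha> \<alpha>s by (auto intro!: critical_choice)
  have "W \<alpha> (\<sigma> \<alpha>) (\<Sigma> \<alpha>) \<le> W \<alpha> (\<sigma> \<alpha>) y" for y
    using W_minimum[OF c] W_ge[OF c] by simp
  then show ?thesis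
    unfolding minimizes_G_fn_iff[OF \<alpha>] by blast
qed

lemma lower_threshold_G_fn_tendsto:
  assumes S: "\<forall>\<alpha>\<in>{\<alpha>s<..<1}. minimizes (G_fn I \<alpha>) (S \<alpha>)"
  shows "((\<lambda>\<alpha>. lower_threshold (ereal K) (G_fn I \<alpha>) (S \<alpha>)) \<longlongrightarrow> \<sigma> 1) (at_left 1)"
proof (rule critical_thresholds_tendsto)
  fix \<alpha> assume \<alpha>: "\<alpha> \<in> {\<alpha>s<..<1}"
  then have "\<alpha> \<in> {\<alpha>s<..1}" by auto
  moreover have "W \<alpha> (\<sigma> \<alpha>) (S \<alpha>) \<le> W \<alpha> (\<sigma> \<alpha>) y" for y
    using S \<alpha> minimizes_G_fn_iff[OF \<alpha>] by blast
  ultimately have "critical \<alpha> (lower_threshold K (W \<alpha> (\<sigma> \<alpha>)) (S \<alpha>)) (S \<alpha>)"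
    using critical_threshold(1)[OF _ critical_choice] by blast
  then show "\<exists>Sa. critical \<alpha> (lower_threshold (ereal K) (G_fn I \<alpha>) (S \<alpha>)) Sa"
    unfolding lower_threshold_G_fn[OF \<alpha>] by blast
qed

section \<open>Properties of H and the policies derived from it\<close>

lemma u_demand_integrable: "integrable (prob_sp I) (\<lambda>\<omega>. u s (x - demand I 1 \<omega>))"
  using u_integrable[of s x] by (rule integrable_demand_law)

lemma H_fn_continuous: "continuous_on UNIV (H_fn I (u s))"
  unfolding H_fn_eq[abs_def] by (intro continuous_intros W_continuous) auto

lemma H_fn_inf_compact: "inf_compact (H_fn I (u (\<sigma> 1)))"
proof (rule inf_compactI[OF H_fn_continuous])
  fix r
  show "\<exists>a b. \<forall>x. H_fn I (u (\<sigma> 1)) x \<le> r \<longrightarrow> a \<le> x \<and> x \<le> b"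
    using W_bounds[OF critical_1, of "r - (f 1 (\<sigma> 1) + c * mean - inf_\<psi> 1 (\<sigma> 1))"]
    by (simp add: H_fn_eq algebra_simps)
qed

lemma disc_thresholds_ex: "disc_thresholds I \<alpha>s \<sigma> \<Sigma>"
  unfolding disc_thresholds_def
proof (intro ballI conjI)
  fix \<alpha> assume \<alpha>: "\<alpha> \<in> {\<alpha>s<..<1}"
  then have crit: "0 \<le> \<alpha>" "\<alpha> < 1" "critical \<alpha> (\<sigma> \<alpha>) (\<Sigma> \<alpha>)"
    using \<alpha>s by (auto intro!: critical_choice)
  show "\<sigma> \<alpha> \<le> \<Sigma> \<alpha>"
    using critical_less[OF crit(3)] by simp
  show "disc_optimal I \<alpha> (stationary (sS_map (\<sigma> \<alpha>) (\<Sigma> \<alpha>)))"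
    by (rule value_fn_eq_v(2)[OF crit])
qed

lemma minimizes_H_fn_iff:
  "minimizes (H_fn I (u (\<sigma> 1))) S \<longleftrightarrow> (\<forall>y. W 1 (\<sigma> 1) S \<le> W 1 (\<sigma> 1) y)"
  by (auto simp: is_arg_min_def H_fn_eq not_less)

lemma minimizes_H_fn: "minimizes (H_fn I (u (\<sigma> 1))) (\<Sigma> 1)"
  unfolding minimizes_H_fn_iff using W_minimum[OF _ _ critical_1] W_ge[OF _ _ critical_1] by simp

lemma critical_H_fn:
  assumes "minimizes (H_fn I (u (\<sigma> 1))) S"
  shows "critical 1 (lower_threshold K (H_fn I (u (\<sigma> 1))) S) S"
proof -
  have "lower_threshold K (H_fn I (u (\<sigma> 1))) S = lower_threshold K (W 1 (\<sigma> 1)) S"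
    by (simp add: lower_threshold_def H_fn_eq add.assoc[symmetric])
  then show ?thesis
    using assms \<alpha>s critical_1 unfolding minimizes_H_fn_iff
    by (auto intro!: critical_threshold(1))
qed

end

theorem corollary7p5:
  fixes I :: "'w inventory" and \<alpha>s :: real
  assumes model: "inventory_model I"
    and \<alpha>s: "0 \<le> \<alpha>s" "\<alpha>s < 1"
    and quasi: "\<forall>\<alpha>\<in>{\<alpha>s<..1}. quasiconvex (exp_h_disc I \<alpha>)"
    and lim: "\<forall>\<alpha>\<in>{\<alpha>s<..1}. \<exists>L. ((\<lambda>x. ereal (exp_h_disc I \<alpha> x)) \<longlongrightarrow> L) at_bot \<and>
                L > ereal (fixed_cost I) + (INF x. ereal (exp_h_disc I \<alpha> x))"
    and decr: "strict_antimono_on {..x_min I 1} (exp_h_disc I 1)"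
  shows "\<exists>w u s_star.
    ((\<lambda>\<alpha>. ereal (1 - \<alpha>) * enn2ereal (min_value I \<alpha>)) \<longlongrightarrow> ereal w) (at_left 1) \<and>
    (\<forall>x. ((\<lambda>\<alpha>. rel_value I \<alpha> x) \<longlongrightarrow> ereal (u x)) (at_left 1)) \<and>
    (\<forall>\<alpha>\<in>{\<alpha>s<..<1}. \<exists>S. minimizes (G_fn I \<alpha>) S) \<and>
    (\<forall>S. (\<forall>\<alpha>\<in>{\<alpha>s<..<1}. minimizes (G_fn I \<alpha>) (S \<alpha>)) \<longrightarrow>
       ((\<lambda>\<alpha>. lower_threshold (ereal (fixed_cost I)) (G_fn I \<alpha>) (S \<alpha>)) \<longlongrightarrow> s_star) (at_left 1)) \<and>
    \<comment> \<open>$E[u(x-D)]$ is finite, so that $H$ is well defined\<close>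
    (\<forall>x. integrable (prob_sp I) (\<lambda>\<omega>. u (x - demand I 1 \<omega>))) \<and>
    (\<exists>\<phi>\<in>stationary_maps. avg_opt_equation I w u \<phi>) \<and>
    continuous_on UNIV u \<and> inf_compact u \<and>
    continuous_on UNIV (H_fn I u) \<and> inf_compact (H_fn I u) \<and>
    (\<exists>s' S'. disc_thresholds I \<alpha>s s' S') \<and>
    (\<forall>a s' S'. disc_seq \<alpha>s a \<and> disc_thresholds I \<alpha>s s' S' \<longrightarrow>
       (\<exists>l. seq_limit_point (\<lambda>n. (s' (a n), S' (a n))) l) \<and>
       (\<forall>s S. seq_limit_point (\<lambda>n. (s' (a n), S' (a n))) (s, S) \<longrightarrow>
          s = s_star \<and> s_star \<le> S \<and>
          sS_map s_star S \<in> stationary_maps \<and>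
          avg_optimal I (stationary (sS_map s_star S)) \<and>
          avg_opt_equation I w u (sS_map s_star S))) \<and>
    (\<exists>S. minimizes (H_fn I u) S) \<and>
    (\<forall>s S. minimizes (H_fn I u) S \<and> s = lower_threshold (fixed_cost I) (H_fn I u) S \<longrightarrow>
       s \<le> S \<and>
       sS_map s S \<in> stationary_maps \<and>
       avg_optimal I (stationary (sS_map s S)) \<and>
       avg_opt_equation I w u (sS_map s S)) \<and>
    (\<forall>a. disc_seq \<alpha>s a \<longrightarrow> (\<forall>x. liminf_rel_value I a x = ereal (u x)))"
proof -
  interpret Q: quasiconvex_inventory I \<alpha>s
    by unfold_locales (use model \<alpha>s quasi lim decr in auto)
  \<comment> \<open>The witnesses are explicit: the critical threshold at \<alpha> = 1 and the
    normalized \<psi> belonging to it.\<close>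
  let ?u = "Q.u (Q.\<sigma> 1)" and ?s = "Q.\<sigma> 1"
  have limits: "\<forall>x. ((\<lambda>\<alpha>. rel_value I \<alpha> x) \<longlongrightarrow> ereal (?u x)) (at_left 1)"
    and G_min: "\<forall>\<alpha>\<in>{\<alpha>s<..<1}. \<exists>S. minimizes (G_fn I \<alpha>) S"
    and G_threshold: "\<forall>S. (\<forall>\<alpha>\<in>{\<alpha>s<..<1}. minimizes (G_fn I \<alpha>) (S \<alpha>)) \<longrightarrow>
       ((\<lambda>\<alpha>. lower_threshold (ereal (fixed_cost I)) (G_fn I \<alpha>) (S \<alpha>)) \<longlongrightarrow> ?s) (at_left 1)"
    and u_int: "\<forall>x. integrable (prob_sp I) (\<lambda>\<omega>. ?u (x - demand I 1 \<omega>))"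
    and liminf: "\<forall>a. disc_seq \<alpha>s a \<longrightarrow> (\<forall>x. liminf_rel_value I a x = ereal (?u x))"
    using Q.rel_value_tendsto Q.minimizes_G_fn_ex Q.lower_threshold_G_fn_tendsto
      Q.u_demand_integrable Q.liminf_rel_value_eq by blast+
  have acoe: "\<exists>\<phi>\<in>stationary_maps. avg_opt_equation I Q.w ?u \<phi>"
    using Q.critical_avg_optimal[OF Q.critical_1] by blast
  have thresholds: "\<exists>s' S'. disc_thresholds I \<alpha>s s' S'" and H_min: "\<exists>S. minimizes (H_fn I ?u) S"
    using Q.disc_thresholds_ex Q.minimizes_H_fn by blast+
  have critical: "s = ?s \<and> ?s \<le> S \<and> sS_map ?s S \<in> stationary_maps \<and>
      avg_optimal I (stationary (sS_map ?s S)) \<and> avg_opt_equation I Q.w ?u (sS_map ?s S)"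
    if "Q.critical 1 s S" for s S
    using Q.critical_avg_optimal[OF that] by simp
  have limit_points: "\<forall>a s' S'. disc_seq \<alpha>s a \<and> disc_thresholds I \<alpha>s s' S' \<longrightarrow>
       (\<exists>l. seq_limit_point (\<lambda>n. (s' (a n), S' (a n))) l) \<and>
       (\<forall>s S. seq_limit_point (\<lambda>n. (s' (a n), S' (a n))) (s, S) \<longrightarrow>
          s = ?s \<and> ?s \<le> S \<and>
          sS_map ?s S \<in> stationary_maps \<and>
          avg_optimal I (stationary (sS_map ?s S)) \<and>
          avg_opt_equation I Q.w ?u (sS_map ?s S))"
  proof (intro allI impI, elim conjE)
    fix a s' S' assume a: "disc_seq \<alpha>s a" "disc_thresholds I \<alpha>s s' S'"
    then show "(\<exists>l. seq_limit_point (\<lambda>n. (s' (a n), S' (a n))) l) \<and>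
       (\<forall>s S. seq_limit_point (\<lambda>n. (s' (a n), S' (a n))) (s, S) \<longrightarrow>
          s = ?s \<and> ?s \<le> S \<and>
          sS_map ?s S \<in> stationary_maps \<and>
          avg_optimal I (stationary (sS_map ?s S)) \<and>
          avg_opt_equation I Q.w ?u (sS_map ?s S))"
      using Q.threshold_sequence(1)[OF a] critical[OF Q.threshold_sequence(2)[OF a]] by blast
  qed
  have H_policies: "\<forall>s S. minimizes (H_fn I ?u) S \<and> s = lower_threshold (fixed_cost I) (H_fn I ?u) S \<longrightarrow>
       s \<le> S \<and>
       sS_map s S \<in> stationary_maps \<and>
       avg_optimal I (stationary (sS_map s S)) \<and>
       avg_opt_equation I Q.w ?u (sS_map s S)"
    using Q.critical_avg_optimal(2-5)[OF Q.critical_H_fn] by blast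
  show ?thesis
    by (rule exI[of _ Q.w], rule exI[of _ ?u], rule exI[of _ ?s], intro conjI)
      (fact Q.min_value_tendsto limits G_min G_threshold u_int acoe Q.u_continuous Q.inf_compact_u
        Q.H_fn_continuous Q.H_fn_inf_compact thresholds limit_points H_min H_policies liminf)+
qed

end
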